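(* Let $m,n,k,\ell$ be positive integers. If $(m,n)\neq(k,\ell)$, then the oriented Legendrian trefoils $T(m,n)$ and $T(k,\ell)$ are not Legendrian isotopic (as oriented Legendrian knots).
   Context: $\mathbb{R}^3$ carries the contact structure $\xi^{std}=\ker(dz-y\,dx)$. A Legendrian knot is a smooth embedding $\gamma:\mathbb{S}^1\to\mathbb{R}^3$ everywhere tangent to $\xi^{std}$, oriented by its parametrisation. Two oriented Legendrian knots are Legendrian isotopic if they are connected by a smooth one-parameter family of Legendrian embeddings, compatibly with orientations. The front projection is $(x,y,z)\mapsto(x,z)$; generically it is an immersion with no vertical tangency apart from finitely many cusps and double points (crossings), at each crossing the strand of smaller slope $dz/dx$ is the over-strand, and the front determines the Legendrian knot (since $y=dz/dx$). A cusp of an oriented front is an up cusp (resp. down cusp) if, following the orientation through it, one moves in the positive (resp. negative) $z$-direction. $T(m,n)$ denotes the oriented Legendrian trefoil given by a front diagram with exactly three crossings, all negative, whose underlying smooth knot diagram (after smoothing cusps) is the standard three-crossing diagram of the left-handed trefoil, and which has exactly $2m$ up cusps and $2n+2$ down cusps. For reference: a rack is a set $X$ with a binary operation $*$ such that each map $x\mapsto x*y$ is bijective (inverse $x\mapsto x*^{-1}y$) and $(x*y)*z=(x*z)*(y*z)$; a $\mathrm{GL}$-rack is a rack with maps $\mathtt{u},\mathtt{d}:X\to X$ such that $\mathtt{u}\mathtt{d}(x*x)=x=\mathtt{d}\mathtt{u}(x*x)$, $\mathtt{u}(x*y)=\mathtt{u}(x)*y$, $\mathtt{d}(x*y)=\mathtt{d}(x)*y$,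 $x*\mathtt{u}(y)=x*y=x*\mathtt{d}(y)$. The $\mathrm{GL}$-rack of an oriented front has one generator per strand (strands end at under-crossings and cusps), with relations: at a positive crossing with over-strand $y$, outgoing under-strand $=$ incoming under-strand $*\,y$; at a negative crossing, incoming under-strand $=$ outgoing under-strand $*\,y$; and $y=\mathtt{u}(x)$ (resp. $y=\mathtt{d}(x)$) when $x$ is followed by $y$ at an up (resp. down) cusp. The $\mathrm{GL}$-rack of $T(m,n)$ is the one presented by generators $a,g$ and relations $g*a=\mathtt{u}^{2m}\mathtt{d}^{2n}(a*^{-1}g)$ and $a*g=\mathtt{d}\,\mathtt{u}^{-1}(g*^{-1}a)$. *)

theory Defs
  imports "HOL-Analysis.Analysis"
begin

section \<open>Smooth maps\<close>

text \<open>
  \<open>Ck_on k S f\<close>: partial derivatives up to order \<open>k\<close> exist and are continuous on \<open>S\<close>. Derivatives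
  are taken within \<open>S\<close>, so for \<open>S = {0..1} \<times> UNIV\<close> they are one-sided at the boundary;
  \<open>D b\<close> is the partial derivative in direction \<open>b\<close>.
\<close>

primrec Ck_on :: "nat \<Rightarrow> 'a::euclidean_space set \<Rightarrow> ('a \<Rightarrow> 'b::real_normed_vector) \<Rightarrow> bool" where
  "Ck_on 0 S f \<longleftrightarrow> continuous_on S f"
| "Ck_on (Suc k) S f \<longleftrightarrow>
     (\<exists>D. (\<forall>x\<in>S. (f has_derivative (\<lambda>h. \<Sum>b\<in>Basis. (h \<bullet> b) *\<^sub>R D b x)) (at x within S)) \<and>
          (\<forall>b\<in>Basis. Ck_on k S (D b)))"

definition smooth_on :: "'a::euclidean_space set \<Rightarrow> ('a \<Rightarrow> 'b::real_normed_vector) \<Rightarrow> bool" where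
  "smooth_on S f \<longleftrightarrow> (\<forall>k. Ck_on k S f)"


section \<open>Legendrian knots and Legendrian isotopy\<close>

text \<open>
  Coordinates \<open>(x, y, z)\<close> of \<open>real ^ 3\<close> are the components \<open>1, 2, 3\<close>. Maps on the circle are
  maps on \<open>real\<close> of period 1, the circle being the quotient of the reals by the integers.
\<close>

definition contact_plane :: "real ^ 3 \<Rightarrow> (real ^ 3) set" where
  "contact_plane p = {v. v $ 3 - p $ 2 * v $ 1 = 0}"

text \<open>
  The equivalence with \<open>s - t \<in> \<int>\<close> says both that \<open>\<gamma>\<close> has period 1 and that it is injective on the
  circle. As the circle is compact, an injective immersion is an embedding.
\<close>

definition legendrian_knot :: "(real \<Rightarrow> real ^ 3) \<Rightarrow> bool" where
  "legendrian_knot \<gamma> \<longleftrightarrow>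
     smooth_on UNIV \<gamma> \<and>
     (\<forall>s t. \<gamma> s = \<gamma> t \<longleftrightarrow> s - t \<in> \<int>) \<and>
     (\<forall>t. vector_derivative \<gamma> (at t) \<noteq> 0) \<and>
     (\<forall>t. vector_derivative \<gamma> (at t) \<in> contact_plane (\<gamma> t))"

text \<open>Lifts to the real line of orientation-preserving diffeomorphisms of the circle.\<close>

definition oriented_reparametrisation :: "(real \<Rightarrow> real) \<Rightarrow> bool" where
  "oriented_reparametrisation \<phi> \<longleftrightarrow>
     smooth_on UNIV \<phi> \<and> (\<forall>t. deriv \<phi> t > 0) \<and> (\<forall>t. \<phi> (t + 1) = \<phi> t + 1)"

text \<open>
  An oriented knot is a parametrised one up to orientation-preserving reparametrisation, so the
  family only has to end at some such reparametrisation of \<open>\<gamma>\<^sub>1\<close>.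
\<close>

definition legendrian_isotopic :: "(real \<Rightarrow> real ^ 3) \<Rightarrow> (real \<Rightarrow> real ^ 3) \<Rightarrow> bool" where
  "legendrian_isotopic \<gamma>\<^sub>0 \<gamma>\<^sub>1 \<longleftrightarrow>
     (\<exists>\<Gamma> :: real \<times> real \<Rightarrow> real ^ 3. \<exists>\<phi>.
        smooth_on ({0..1} \<times> UNIV) \<Gamma> \<and>
        (\<forall>s\<in>{0..1}. legendrian_knot (\<lambda>t. \<Gamma> (s, t))) \<and>
        oriented_reparametrisation \<phi> \<and>
        (\<forall>t. \<Gamma> (0, t) = \<gamma>\<^sub>0 t) \<and>
        (\<forall>t. \<Gamma> (1, t) = \<gamma>\<^sub>1 (\<phi> t)))"


section \<open>Fronts\<close>

definition front :: "(real \<Rightarrow> real ^ 3) \<Rightarrow> real \<Rightarrow> real \<times> real" where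
  "front \<gamma> t = (\<gamma> t $ 1, \<gamma> t $ 3)"

definition cusp :: "(real \<Rightarrow> real ^ 3) \<Rightarrow> real \<Rightarrow> bool" where
  "cusp \<gamma> t \<longleftrightarrow> vector_derivative (front \<gamma>) (at t) = 0"

text \<open>
  The tangent at a cusp need not be horizontal, and then both branches leave the cusp on the same
  side of its height. So ``moving in the positive \<open>z\<close>-direction through the cusp'' compares the two
  branches over the same \<open>x\<close>: one passes from the lower branch to the upper one.
\<close>

definition up_cusp :: "(real \<Rightarrow> real ^ 3) \<Rightarrow> real \<Rightarrow> bool" where
  "up_cusp \<gamma> t \<longleftrightarrow> cusp \<gamma> t \<and>
     (\<exists>\<epsilon>>0. \<forall>r s. t - \<epsilon> < r \<and> r < t \<and> t < s \<and> s < t + \<epsilon> \<and> \<gamma> r $ 1 = \<gamma> s $ 1 \<longrightarrow> \<gamma> r $ 3 < \<gamma> s $ 3)"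

definition down_cusp :: "(real \<Rightarrow> real ^ 3) \<Rightarrow> real \<Rightarrow> bool" where
  "down_cusp \<gamma> t \<longleftrightarrow> cusp \<gamma> t \<and>
     (\<exists>\<epsilon>>0. \<forall>r s. t - \<epsilon> < r \<and> r < t \<and> t < s \<and> s < t + \<epsilon> \<and> \<gamma> r $ 1 = \<gamma> s $ 1 \<longrightarrow> \<gamma> r $ 3 > \<gamma> s $ 3)"

text \<open>
  The strand at \<open>s\<close> crosses over the strand at \<open>t\<close>; \<open>\<gamma> s $ 2\<close> is the slope \<open>dz/dx\<close> of the front at \<open>s\<close>.
\<close>

definition front_over :: "(real \<Rightarrow> real ^ 3) \<Rightarrow> real \<Rightarrow> real \<Rightarrow> bool" where
  "front_over \<gamma> s t \<longleftrightarrow> front \<gamma> s = front \<gamma> t \<and> \<gamma> s $ 2 < \<gamma> t $ 2"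

text \<open>Each crossing is listed once, as the pair of its over- and under-parameter.\<close>

definition front_crossings :: "(real \<Rightarrow> real ^ 3) \<Rightarrow> (real \<times> real) set" where
  "front_crossings \<gamma> = {(s, t). s \<in> {0..<1} \<and> t \<in> {0..<1} \<and> front_over \<gamma> s t}"

text \<open>
  For the over-direction \<open>v\<close> and the under-direction \<open>w\<close>, the crossing is positive iff the frame
  \<open>(v, w)\<close> is positive in the \<open>(x, z)\<close>-plane.
\<close>

definition negative_crossing :: "(real \<Rightarrow> real ^ 3) \<Rightarrow> real \<Rightarrow> real \<Rightarrow> bool" where
  "negative_crossing \<gamma> s t \<longleftrightarrow>
     (let v = vector_derivative (front \<gamma>) (at s); w = vector_derivative (front \<gamma>) (at t)
      in fst v * snd w - snd v * fst w < 0)"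

text \<open>
  Cusps are semicubical, multiple points are double points away from the cusps. For a Legendrian
  knot nothing else has to be required: \<open>dz = y dx\<close> excludes vertical tangents, the two strands at
  a double point differ in \<open>y\<close> and so cross transversally, and at a point with \<open>dx = dz = 0\<close> a
  nonzero second derivative of \<open>x\<close> makes the cusp semicubical, as then \<open>dy \<noteq> 0\<close>.
\<close>

definition generic_front :: "(real \<Rightarrow> real ^ 3) \<Rightarrow> bool" where
  "generic_front \<gamma> \<longleftrightarrow>
     (\<forall>t. cusp \<gamma> t \<longrightarrow> deriv (deriv (\<lambda>u. \<gamma> u $ 1)) t \<noteq> 0) \<and>
     finite {t \<in> {0..<1}. cusp \<gamma> t} \<and>
     finite (front_crossings \<gamma>) \<and>
     (\<forall>s t. front \<gamma> s = front \<gamma> t \<and> cusp \<gamma> s \<longrightarrow> s - t \<in> \<int>) \<and>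
     (\<forall>r s t. front \<gamma> r = front \<gamma> s \<and> front \<gamma> s = front \<gamma> t \<longrightarrow>
        r - s \<in> \<int> \<or> s - t \<in> \<int> \<or> r - t \<in> \<int>)"


section \<open>Knot diagrams\<close>

text \<open>
  A knot diagram is a closed plane curve \<open>c\<close> of period 1 together with a relation telling which of
  two parameters with the same image is the upper one. As usual, diagrams are compared up to isotopy
  of the sphere, that is, of the plane with a point at infinity. Every isotopy of the plane extends
  to the sphere, so two diagrams that agree up to planar isotopy are equivalent.
\<close>

definition stereo :: "real \<times> real \<Rightarrow> (real \<times> real) \<times> real" where
  "stereo p = ((2 / (1 + (norm p)\<^sup>2)) *\<^sub>R p, ((norm p)\<^sup>2 - 1) / ((norm p)\<^sup>2 + 1))"

definition sphere_isotopy ::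
  "(real \<Rightarrow> (real \<times> real) \<times> real \<Rightarrow> (real \<times> real) \<times> real) \<Rightarrow> bool" where
  "sphere_isotopy \<Phi> \<longleftrightarrow>
     continuous_on ({0..1} \<times> sphere 0 1) (\<lambda>(s, p). \<Phi> s p) \<and>
     (\<forall>s\<in>{0..1}. \<exists>\<Psi>. homeomorphism (sphere 0 1) (sphere 0 1) (\<Phi> s) \<Psi>) \<and>
     (\<forall>p\<in>sphere 0 1. \<Phi> 0 p = p)"

text \<open>Lifts to the real line of homeomorphisms of the circle, of either orientation.\<close>

definition circle_homeo_lift :: "(real \<Rightarrow> real) \<Rightarrow> bool" where
  "circle_homeo_lift \<phi> \<longleftrightarrow> continuous_on UNIV \<phi> \<and>
     (strict_mono \<phi> \<and> (\<forall>t. \<phi> (t + 1) = \<phi> t + 1) \<or>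
      strict_mono (\<lambda>t. - \<phi> t) \<and> (\<forall>t. \<phi> (t + 1) = \<phi> t - 1))"

text \<open>
  Equivalence of unoriented diagrams. The isotopy is only topological, so it does not see cusps:
  a front with cusps is equivalent to the diagram in which the cusps have been smoothed.
\<close>

definition diagram_equiv ::
  "(real \<Rightarrow> real \<times> real) \<Rightarrow> (real \<Rightarrow> real \<Rightarrow> bool) \<Rightarrow>
   (real \<Rightarrow> real \<times> real) \<Rightarrow> (real \<Rightarrow> real \<Rightarrow> bool) \<Rightarrow> bool" where
  "diagram_equiv c over c' over' \<longleftrightarrow>
     (\<exists>\<Phi> \<phi>. sphere_isotopy \<Phi> \<and> circle_homeo_lift \<phi> \<and>
        (\<forall>t. \<Phi> 1 (stereo (c t)) = stereo (c' (\<phi> t))) \<and>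
        (\<forall>s t. over s t \<longleftrightarrow> over' (\<phi> s) (\<phi> t)))"

text \<open>
  With \<open>\<theta> = 2 \<pi> t\<close>, the curve \<open>(2 + cos 3\<theta>) (cos 2\<theta>, sin 2\<theta>)\<close> at height \<open>sin 3\<theta>\<close> over the plane is
  a trefoil. Its double points are the pairs \<open>\<theta>, \<theta> + \<pi>\<close> with \<open>cos 3\<theta> = 0\<close>. At each of them, in the
  basis of the radial and the angular direction, the over-strand (\<open>sin 3\<theta> = 1\<close>) has tangent
  \<open>(-3, 4)\<close> and the under-strand \<open>(3, 4)\<close>; hence the crossings are negative and the trefoil is
  left-handed.
\<close>

definition trefoil_curve :: "real \<Rightarrow> real \<times> real" where
  "trefoil_curve t = (2 + cos (6 * pi * t)) *\<^sub>R (cos (4 * pi * t), sin (4 * pi * t))"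

definition trefoil_over :: "real \<Rightarrow> real \<Rightarrow> bool" where
  "trefoil_over s t \<longleftrightarrow>
     trefoil_curve s = trefoil_curve t \<and> sin (6 * pi * s) > sin (6 * pi * t)"


section \<open>The Legendrian trefoils\<close>

text \<open>
  \<open>legendrian_trefoil m n \<gamma>\<close>: the oriented Legendrian knot \<open>\<gamma>\<close> is given by a front diagram of the
  kind that defines \<open>T(m,n)\<close>.
\<close>

definition legendrian_trefoil :: "nat \<Rightarrow> nat \<Rightarrow> (real \<Rightarrow> real ^ 3) \<Rightarrow> bool" where
  "legendrian_trefoil m n \<gamma> \<longleftrightarrow>
     legendrian_knot \<gamma> \<and>
     generic_front \<gamma> \<and>
     card (front_crossings \<gamma>) = 3 \<and>
     (\<forall>(s, t)\<in>front_crossings \<gamma>. negative_crossing \<gamma> s t) \<and>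
     diagram_equiv (front \<gamma>) (front_over \<gamma>) trefoil_curve trefoil_over \<and>
     card {t \<in> {0..<1}. up_cusp \<gamma> t} = 2 * m \<and>
     card {t \<in> {0..<1}. down_cusp \<gamma> t} = 2 * n + 2"

end

theory Submission
  imports Defs
begin

text \<open>
  Two integers attached to a Legendrian loop are invariant under Legendrian isotopy and determine
  \<open>(m, n)\<close>. The first is the winding number of \<open>(x' + i y')\<^sup>2\<close>; it counts cusps as \<open>D - U\<close>, where
  \<open>U\<close> and \<open>D\<close> are the numbers of up and down cusps (twice the rotation number). The second is minus
  the Thurston-Bennequin number, which for a front with only negative crossings is the number of
  crossings plus half the number of cusps.

  The second one is obtained without Reidemeister moves and without degree theory. For a base point
  \<open>u\<close>, the chords \<open>\<gamma> (u + i/N) - \<gamma> u\<close>, \<open>0 < i < N\<close>, preceded and followed by the vertical vector,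
  form a chain of directions on the sphere. If \<open>N\<close> is large, consecutive directions are never
  antipodal: the chord is never \<open>0\<close>, and the short chords are almost tangent to the contact planes,
  hence far from vertical. So the product of the corresponding spin projections, a discrete holonomy
  in the tautological line bundle, is a nonzero complex number, and its winding number in \<open>u\<close> is an
  isotopy invariant. It is computed with the gauge that is singular only in the direction of the
  positive \<open>y\<close>-axis: a crossing of the front is precisely a chord in that direction, and each one
  contributes one turn, while the first and the last step of the chain together contribute one
  turn for each right cusp.
\<close>

section \<open>Winding numbers of periodic functions\<close>

text \<open>Both numbers compare the curve with the contact planes. A contact plane projects
  isomorphically to the (x,y)-plane, so \<open>x' + i y'\<close> never vanishes; it is squared
  because \<open>y'\<close> may have either sign at a cusp, and the square puts both cases on the
  negative real axis. The second number counts chord directions in the manner of Gauss. For a fixed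
  base point the chords run from the tangent to minus the tangent, so their directions do not form a
  closed path. The vertical vector is transverse to every contact plane and closes the path at both
  ends; this is where the contact framing enters. Replacing the path by a finite chain makes the
  holonomy a product of rank one matrices, continuous in the base point and in the isotopy
  parameter. Zeros in the singular gauge are counted with orientation; negative crossings all have
  the same sign, which turns the signed count into \<open>card\<close>. For \<open>T(m,n)\<close>
  the two numbers are \<open>2n + 2 - 2m\<close> and \<open>3 + (m + n + 1)\<close>: one fixes the
  difference, the other the sum.\<close>

definition has_wind :: "(real \<Rightarrow> complex) \<Rightarrow> int \<Rightarrow> bool" where
  "has_wind f n \<longleftrightarrow>
     (\<exists>g. continuous_on UNIV g \<and> (\<forall>u. f u = exp (g u)) \<and>
          (\<forall>u. g (u + 1) = g u + of_int n * (2 * of_real pi * \<i>)))"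

text \<open>The values lie in the discrete set of integer multiples of \<open>2 pi i\<close>,
  between which a continuous function on a connected set cannot move.\<close>

lemma constant_on_if_exp_eq_1:
  fixes g :: "'a::topological_space \<Rightarrow> complex"
  assumes "connected S" and cont: "continuous_on S g" and "\<And>x. x \<in> S \<Longrightarrow> exp (g x) = 1"
  shows "g constant_on S"
proof (rule continuous_discrete_range_constant [OF \<open>connected S\<close> cont])
  fix x assume "x \<in> S"
  show "\<exists>e>0. \<forall>y. y \<in> S \<and> g y \<noteq> g x \<longrightarrow> e \<le> norm (g y - g x)"
  proof (intro exI [of _ "2 * pi"] conjI allI impI)
    fix y assume y: "y \<in> S \<and> g y \<noteq> g x"
    have "exp (g y - g x) = 1"
      using assms(3) y \<open>x \<in> S\<close> by (simp add: exp_diff)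
    then obtain k :: int where k: "Re (g y - g x) = 0" "Im (g y - g x) = of_int (2 * k) * pi"
      by (auto simp: exp_eq_1)
    with y have "k \<noteq> 0"
      by (auto simp: complex_eq_iff)
    then have "2 * pi \<le> \<bar>of_int (2 * k) * pi\<bar>"
      by (simp add: abs_mult)
    also have "\<dots> \<le> norm (g y - g x)"
      using abs_Im_le_cmod [of "g y - g x"] k by simp
    finally show "2 * pi \<le> norm (g y - g x)" .
  qed simp
qed

text \<open>Two continuous logarithms of \<open>f\<close> differ by a constant, so their increments
  over a period agree.\<close>

lemma has_wind_unique:
  assumes "has_wind f m" and "has_wind f n"
  shows "m = n"
proof -
  obtain g where g: "continuous_on UNIV g" "\<And>u. f u = exp (g u)"
    "\<And>u. g (u + 1) = g u + of_int m * (2 * of_real pi * \<i>)"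
    using assms(1) unfolding has_wind_def by blast
  obtain h where h: "continuous_on UNIV h" "\<And>u. f u = exp (h u)"
    "\<And>u. h (u + 1) = h u + of_int n * (2 * of_real pi * \<i>)"
    using assms(2) unfolding has_wind_def by blast
  have "exp (g u) = exp (h u)" for u
    using g(2) h(2) by metis
  then have "(\<lambda>u. g u - h u) constant_on UNIV"
    by (intro constant_on_if_exp_eq_1 continuous_intros g(1) h(1)) (auto simp: exp_diff)
  then have "g 1 - h 1 = g 0 - h 0"
    unfolding constant_on_def by force
  moreover have "g 1 = g 0 + of_int m * (2 * of_real pi * \<i>)"
    "h 1 = h 0 + of_int n * (2 * of_real pi * \<i>)"
    using g(3) [of 0] h(3) [of 0] by auto
  ultimately have "of_int m * (2 * of_real pi * \<i>) = of_int n * (2 * of_real pi * \<i>)"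
    by (simp add: algebra_simps)
  then show ?thesis by simp
qed

text \<open>The strip is convex, so \<open>F\<close> has a single continuous logarithm
  \<open>g\<close> on all of it. The increment of \<open>g\<close> over a period is an integer
  multiple of \<open>2 pi i\<close> and therefore the same for all \<open>s\<close> and
  \<open>u\<close>.\<close>

lemma has_wind_homotopic_ex:
  fixes F :: "real \<times> real \<Rightarrow> complex"
  assumes cont: "continuous_on ({a..b} \<times> UNIV) F"
    and nz: "\<And>s u. s \<in> {a..b} \<Longrightarrow> F (s, u) \<noteq> 0"
    and per: "\<And>s u. s \<in> {a..b} \<Longrightarrow> F (s, u + 1) = F (s, u)"
  shows "\<exists>n. \<forall>s\<in>{a..b}. has_wind (\<lambda>u. F (s, u)) n"
proof (cases "a \<le> b")
  case True
  let ?S = "{a..b} \<times> (UNIV :: real set)"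
  have conv: "convex ?S"
    by (intro convex_Times) auto
  obtain g where g: "continuous_on ?S g" "\<And>x. x \<in> ?S \<Longrightarrow> F x = exp (g x)"
    using continuous_logarithm_on_contractible [OF cont convex_imp_contractible [OF conv]] nz
    by (metis mem_Sigma_iff surj_pair)
  define d where "d = (\<lambda>p. g (fst p, snd p + 1) - g p)"
  have "continuous_on ?S d"
    unfolding d_def
    by (intro continuous_intros g(1) continuous_on_compose2 [OF g(1), of _ "\<lambda>p. (fst p, snd p + 1)"]) auto
  moreover have "exp (d p) = 1" if "p \<in> ?S" for p
    using that g(2) [of p] g(2) [of "(fst p, snd p + 1)"] per [of "fst p" "snd p"]
      nz [of "fst p" "snd p"]
    by (cases p) (auto simp: d_def exp_diff)
  ultimately have "d constant_on ?S"
    using conv convex_connected constant_on_if_exp_eq_1 by blast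
  then obtain c where c: "\<And>p. p \<in> ?S \<Longrightarrow> d p = c"
    unfolding constant_on_def by blast
  have "exp c = 1"
    using \<open>\<And>p. p \<in> ?S \<Longrightarrow> exp (d p) = 1\<close> [of "(a, 0)"] c [of "(a, 0)"] True by simp
  then obtain n :: int where "Re c = 0" "Im c = of_int (2 * n) * pi"
    by (auto simp: exp_eq_1)
  then have n: "c = of_int n * (2 * of_real pi * \<i>)"
    by (auto simp: complex_eq_iff)
  have "has_wind (\<lambda>u. F (s, u)) n" if s: "s \<in> {a..b}" for s
    unfolding has_wind_def
  proof (intro exI [of _ "\<lambda>u. g (s, u)"] conjI allI)
    show "continuous_on UNIV (\<lambda>u. g (s, u))"
      by (rule continuous_on_compose2 [OF g(1), of _ "\<lambda>u. (s, u)"]) (use s in \<open>auto intro!: continuous_intros\<close>)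
    show "F (s, u) = exp (g (s, u))" for u
      using s g(2) by auto
    show "g (s, u + 1) = g (s, u) + of_int n * (2 * of_real pi * \<i>)" for u
      using c [of "(s, u)"] s by (auto simp: d_def n algebra_simps)
  qed
  then show ?thesis by blast
qed auto

lemma has_wind_ex:
  assumes "continuous_on UNIV f" and "\<And>u. f u \<noteq> 0" and "\<And>u. f (u + 1) = f u"
  obtains n where "has_wind f n"
proof -
  have "continuous_on ({0..0::real} \<times> UNIV) (\<lambda>p. f (snd p))"
    by (rule continuous_on_compose2 [OF assms(1) continuous_on_snd]) (auto intro: continuous_on_id)
  then show thesis
    using has_wind_homotopic_ex [of 0 0 "\<lambda>p. f (snd p)"] assms that by auto
qed

lemma has_wind_homotopic:
  fixes F :: "real \<times> real \<Rightarrow> complex"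
  assumes "continuous_on ({a..b} \<times> UNIV) F"
    and "\<And>s u. s \<in> {a..b} \<Longrightarrow> F (s, u) \<noteq> 0"
    and "\<And>s u. s \<in> {a..b} \<Longrightarrow> F (s, u + 1) = F (s, u)"
    and "a \<le> b" and "has_wind (\<lambda>u. F (a, u)) n"
  shows "has_wind (\<lambda>u. F (b, u)) n"
proof -
  obtain k where k: "\<forall>s\<in>{a..b}. has_wind (\<lambda>u. F (s, u)) k"
    using has_wind_homotopic_ex [of a b F] assms by blast
  then have "k = n"
    using assms(4,5) has_wind_unique [of "\<lambda>u. F (a, u)" k n] by simp
  with k \<open>a \<le> b\<close> show ?thesis by simp
qed

lemma has_wind_imp_nonzero: "has_wind f n \<Longrightarrow> f u \<noteq> 0"
  unfolding has_wind_def by auto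

lemma has_wind_imp_continuous: "has_wind f n \<Longrightarrow> continuous_on S f"
proof -
  assume "has_wind f n"
  then obtain g where g: "continuous_on UNIV g" "f = (\<lambda>u. exp (g u))"
    unfolding has_wind_def by blast
  then show ?thesis
    by (auto intro!: continuous_intros continuous_on_subset [OF g(1)])
qed

lemma has_wind_mult:
  assumes "has_wind f m" and "has_wind g n"
  shows "has_wind (\<lambda>u. f u * g u) (m + n)"
proof -
  obtain F where F: "continuous_on UNIV F" "\<forall>u. f u = exp (F u)"
    "\<forall>u. F (u + 1) = F u + of_int m * (2 * of_real pi * \<i>)"
    using assms(1) unfolding has_wind_def by blast
  obtain G where G: "continuous_on UNIV G" "\<forall>u. g u = exp (G u)"
    "\<forall>u. G (u + 1) = G u + of_int n * (2 * of_real pi * \<i>)"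
    using assms(2) unfolding has_wind_def by blast
  show ?thesis
    unfolding has_wind_def
    by (rule exI [of _ "\<lambda>u. F u + G u"])
      (use F G in \<open>auto intro!: continuous_intros simp: exp_add algebra_simps\<close>)
qed

lemma has_wind_cnj:
  assumes "has_wind f n"
  shows "has_wind (\<lambda>u. cnj (f u)) (- n)"
proof -
  obtain F where F: "continuous_on UNIV F" "\<forall>u. f u = exp (F u)"
    "\<forall>u. F (u + 1) = F u + of_int n * (2 * of_real pi * \<i>)"
    using assms unfolding has_wind_def by blast
  show ?thesis
    unfolding has_wind_def
    by (rule exI [of _ "\<lambda>u. cnj (F u)"])
      (use F in \<open>auto intro!: continuous_intros simp: exp_cnj\<close>)
qed

lemma has_wind_Re_pos:
  assumes "continuous_on UNIV f" and "\<And>u. f (u + 1) = f u" and "\<And>u. Re (f u) > 0"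
  shows "has_wind f 0"
  unfolding has_wind_def
proof (intro exI [of _ "\<lambda>u. Ln (f u)"] conjI allI)
  show "continuous_on UNIV (\<lambda>u. Ln (f u))"
    using assms by (intro continuous_intros) (auto simp: complex_nonpos_Reals_iff not_le)
  show "f u = exp (Ln (f u))" for u
    using assms(3) [of u] by (metis exp_Ln less_irrefl zero_complex.simps(1))
qed (simp add: assms(2))

lemma has_wind_exp:
  assumes "c \<noteq> 0"
  shows "has_wind (\<lambda>u. c * exp (2 * of_real pi * \<i> * of_real u)) 1"
  unfolding has_wind_def
proof (intro exI [of _ "\<lambda>u. Ln c + 2 * of_real pi * \<i> * of_real u"] conjI allI)
  show "c * exp (2 * of_real pi * \<i> * of_real u) = exp (Ln c + 2 * of_real pi * \<i> * of_real u)" for u :: real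
    using assms by (simp add: exp_add)
qed (auto intro!: continuous_intros simp: ring_distribs)

lemma has_wind_shift:
  assumes "has_wind f n"
  shows "has_wind (\<lambda>u. f (u + a)) n"
proof -
  obtain g where g: "continuous_on UNIV g" "\<forall>u. f u = exp (g u)"
    "\<And>u. g (u + 1) = g u + of_int n * (2 * of_real pi * \<i>)"
    using assms unfolding has_wind_def by blast
  show ?thesis
    unfolding has_wind_def
  proof (rule exI [of _ "\<lambda>u. g (u + a)"], intro conjI allI)
    show "continuous_on UNIV (\<lambda>u. g (u + a))"
      by (intro continuous_on_compose2 [OF g(1)] continuous_intros) auto
    show "g (u + 1 + a) = g (u + a) + of_int n * (2 * of_real pi * \<i>)" for u
      using g(3) [of "u + a"] by (simp add: algebra_simps)
  qed (use g in auto)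
qed

section \<open>Counting jumps and axis crossings\<close>

text \<open>A fundamental theorem for step functions. The value of \<open>k\<close> at a jump is
  unconstrained, so the proof works with the left limits \<open>l\<close>. These fit half-open
  intervals: from \<open>x\<close> to \<open>y\<close> the jump at \<open>x\<close> counts and the
  one at \<open>y\<close> does not.\<close>

lemma periodic_jump_sum:
  fixes k :: "real \<Rightarrow> int" and j :: "real \<Rightarrow> int"
  assumes jump: "\<And>u. \<exists>e>0. \<forall>r s. u - e < r \<and> r < u \<and> u < s \<and> s < u + e \<longrightarrow> k s = k r + j u"
    and per: "\<And>u. k (u + 1) = k u + d"
  shows "d = (\<Sum>u\<in>{u \<in> {0..<1}. j u \<noteq> 0}. j u)"
proof -
  obtain e where e: "\<And>u. e u > 0"
    "\<And>u r s. u - e u < r \<Longrightarrow> r < u \<Longrightarrow> u < s \<Longrightarrow> s < u + e u \<Longrightarrow> k s = k r + j u"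
    using jump by metis
  define l where "l u = k (u - e u / 2)" for u
  have left: "k r = l u" if "u - e u < r" "r < u" for u r
    using e(1) [of u] e(2) [of u r "u + e u / 2"] e(2) [of u "u - e u / 2" "u + e u / 2"] that
    by (auto simp: l_def)
  have right: "k s = l u + j u" if "u < s" "s < u + e u" for u s
    using e(1) [of u] e(2) [of u "u - e u / 2" s] that by (auto simp: l_def)
  have lleft: "l v = l u" if "u - e u < v" "v \<le> u" for u v
  proof (cases "v = u")
    case False
    define r where "r = max (v - e v / 2) ((u - e u + v) / 2)"
    have "v - e v < r" "r < v" "u - e u < r" "r < u"
      using e(1) [of v] that False by (auto simp: r_def less_max_iff_disj)
    then show ?thesis using left by metis
  qed auto
  have lright: "l v = l u + j u" if "u < v" "v < u + e u" for u v
  proof -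
    define r where "r = max (v - e v / 2) ((u + v) / 2)"
    have "v - e v < r" "r < v" "u < r" "r < u + e u"
      using e(1) [of v] that by (auto simp: r_def less_max_iff_disj)
    then show ?thesis using left [of v r] right [of u r] by simp
  qed
  have j0: "j v = 0" if "\<bar>v - u\<bar> < e u" "v \<noteq> u" for u v
  proof -
    define d where "d = min (e v / 2) (min \<bar>v - u\<bar> (e u - \<bar>v - u\<bar>) / 2)"
    have "0 < d" "d < e v" "d < \<bar>v - u\<bar>" "d < e u - \<bar>v - u\<bar>"
      using e(1) [of v] that by (auto simp: d_def min_less_iff_disj min_def)
    then have "k (v + d) = k (v - d) + j v" "k (v + d) = k (v - d)"
      using e(2) [of v "v - d" "v + d"] left [of u "v - d"] left [of u "v + d"]
        right [of u "v - d"] right [of u "v + d"]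
      by (auto simp: abs_if split: if_splits)
    then show ?thesis by simp
  qed
  let ?J = "\<lambda>x y. {u \<in> {x..<y}. j u \<noteq> 0}"
  \<comment> \<open>Finiteness belongs to the bisection predicate, because a sum over an infinite
    set is \<open>0\<close> by convention and would not be additive.\<close>
  let ?P = "\<lambda>x y. finite (?J x y) \<and> l y = l x + (\<Sum>u\<in>?J x y. j u)"
  have "?P 0 1"
  proof (rule Bolzano [of 0 1 ?P])
    fix a b c assume P: "?P a b" "?P b c" and le: "a \<le> b" "b \<le> c"
    have *: "?J a c = ?J a b \<union> ?J b c" "?J a b \<inter> ?J b c = {}"
      using le by auto
    have "finite (?J a c)"
      unfolding *(1) using P by (intro finite_UnI) auto
    moreover have "sum j (?J a c) = sum j (?J a b) + sum j (?J b c)"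
      unfolding *(1) by (rule sum.union_disjoint) (use P *(2) in blast)+
    moreover have "l b = l a + sum j (?J a b)" "l c = l b + sum j (?J b c)"
      using P by blast+
    ultimately show "?P a c"
      by linarith
  next
    fix u
    show "\<exists>d>0. \<forall>a b. a \<le> u \<and> u \<le> b \<and> b - a < d \<longrightarrow> ?P a b"
    proof (intro exI [of _ "e u"] conjI allI impI)
      fix a b assume ab: "a \<le> u \<and> u \<le> b \<and> b - a < e u"
      have "v = u" if "v \<in> ?J a b" for v
      proof -
        have "a \<le> v" "v < b" "j v \<noteq> 0"
          using that by auto
        then show ?thesis
          using ab j0 [of v u] by linarith
      qed
      then have *: "?J a b = (if u < b \<and> j u \<noteq> 0 then {u} else {})"
        using ab by auto
      show "finite (?J a b)"
        unfolding * by simp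
      show "l b = l a + (\<Sum>u\<in>?J a b. j u)"
        unfolding * using ab lleft [of u a] lright [of u b] by (cases "u = b") auto
    qed (rule e(1))
  qed auto
  moreover have "l 1 = l 0 + d"
  proof -
    \<comment> \<open>A point to the left of \<open>0\<close> in the window of \<open>0\<close>
      whose translate lies in the window of \<open>1\<close>; there \<open>k\<close> equals the two
      left limits.\<close>
    define r where "r = max (- e 0 / 2) (- e 1 / 2)"
    have "k r = l 0" "k (r + 1) = l 1"
      using e(1) [of 0] e(1) [of 1] by (intro left; auto simp: r_def less_max_iff_disj)+
    then show ?thesis using per [of r] by simp
  qed
  ultimately show ?thesis by simp
qed

lemma periodic_of_int:
  fixes f :: "'a::ring_1 \<Rightarrow> 'b"
  assumes "\<And>w. f (w + 1) = f w"
  shows "f (w + of_int k) = f w"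
proof (induction k arbitrary: w rule: int_induct [of _ 0])
  case (step1 i)
  then show ?case
    using assms [of "w + of_int i"] by (simp add: add.assoc)
next
  case (step2 i)
  then show ?case
    using assms [of "w + of_int i - 1"] by (simp add: algebra_simps)
qed auto

lemma periodic_Ints:
  fixes f :: "'a::ring_1 \<Rightarrow> 'b"
  assumes "\<And>w. f (w + 1) = f w" and "v - w \<in> \<int>"
  shows "f v = f w"
proof -
  obtain k where "v - w = of_int k"
    using assms(2) by (elim Ints_cases)
  then have "v = w + of_int k"
    by (simp add: algebra_simps)
  then show ?thesis
    using periodic_of_int [of f w k] assms(1) by simp
qed

lemma has_wind_periodic: "has_wind f n \<Longrightarrow> f (u + 1) = f u"
proof -
  assume "has_wind f n"
  then obtain g where g: "\<And>u. f u = exp (g u)" "\<And>u. g (u + 1) = g u + of_int n * (2 * of_real pi * \<i>)"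
    unfolding has_wind_def by blast
  have "exp (g (u + 1)) = exp (g u)"
    unfolding exp_eq by (rule exI [of _ n]) (simp add: g(2))
  then show ?thesis by (simp add: g(1))
qed

text \<open>The sign \<open>\<sigma> u = 1\<close> means that the negative real axis is crossed counterclockwise.\<close>

lemma has_wind_crossings:
  fixes \<sigma> :: "real \<Rightarrow> int"
  assumes wind: "has_wind f n"
    and cross: "\<And>u. f u \<in> \<real>\<^sub>\<le>\<^sub>0 \<Longrightarrow> (\<sigma> u = 1 \<or> \<sigma> u = -1) \<and>
        (\<exists>e>0. \<forall>r s. u - e < r \<and> r < u \<and> u < s \<and> s < u + e \<longrightarrow>
           of_int (\<sigma> u) * Im (f r) > 0 \<and> of_int (\<sigma> u) * Im (f s) < 0)"
  shows "n = (\<Sum>u\<in>{u \<in> {0..<1}. f u \<in> \<real>\<^sub>\<le>\<^sub>0}. \<sigma> u)"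
proof -
  obtain g where g: "continuous_on UNIV g" "\<And>u. f u = exp (g u)"
    "\<And>u. g (u + 1) = g u + of_int n * (2 * of_real pi * \<i>)"
    using wind unfolding has_wind_def by blast
  have nz: "f u \<noteq> 0" for u
    by (simp add: g(2))
  have per: "f (u + 1) = f u" for u
    using wind by (rule has_wind_periodic)
  have "\<exists>k::int. Im (g u) = Im (Ln (f u)) + 2 * pi * of_int k" for u
  proof -
    have "exp (g u) = exp (Ln (f u))"
      using nz [of u] by (simp add: g(2))
    then obtain k :: int where "g u = Ln (f u) + (of_int (2 * k) * pi) * \<i>"
      unfolding exp_eq by blast
    then show ?thesis
      by (intro exI [of _ k]) simp
  qed
  \<comment> \<open>\<open>k\<close> is the sheet of the continuous argument relative to the
    principal one. It is locally constant off the branch cut of \<open>Ln\<close>, the negative real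
    axis, and jumps by \<open>\<sigma>\<close> there. Being an integer, it need only be known up to
    an error of less than one turn.\<close>
  then obtain k :: "real \<Rightarrow> int" where k: "\<And>u. Im (g u) = Im (Ln (f u)) + 2 * pi * of_int (k u)"
    by metis
  define j where "j u = (if f u \<in> \<real>\<^sub>\<le>\<^sub>0 then \<sigma> u else 0)" for u
  have contf: "isCont f u" for u
    using has_wind_imp_continuous [OF wind, of UNIV] by (simp add: continuous_on_eq_continuous_at)
  have contg: "isCont g u" for u
    using g(1) by (simp add: continuous_on_eq_continuous_at)
  have k_eq: "k s = k r + i" if "\<bar>(Im (g s) - Im (g r)) - (Im (Ln (f s)) - Im (Ln (f r))) - 2 * pi * of_int i\<bar> < 2 * pi" for r s i
  proof -
    have "\<bar>2 * pi * of_int (k s - k r - i)\<bar> < 2 * pi * 1"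
      using that k [of s] k [of r] by (simp add: algebra_simps)
    then have "\<bar>real_of_int (k s - k r - i)\<bar> < 1"
      by (simp add: abs_mult)
    then show ?thesis by linarith
  qed
  have gnear: "\<exists>e>0. \<forall>v. \<bar>v - u\<bar> < e \<longrightarrow> \<bar>Im (g v) - Im (g u)\<bar> < pi / 4" for u
  proof -
    have "isCont (\<lambda>v. Im (g v)) u"
      by (rule continuous_Im [OF contg])
    then show ?thesis
      unfolding continuous_at_eps_delta dist_real_def by (metis pi_gt_zero zero_less_divide_iff zero_less_numeral)
  qed
  have sgn_nz: "\<sigma> u \<noteq> 0" if "f u \<in> \<real>\<^sub>\<le>\<^sub>0" for u
    using cross [OF that] by auto
  have "n = (\<Sum>u\<in>{u \<in> {0..<1}. j u \<noteq> 0}. j u)"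
  proof (rule periodic_jump_sum [of k])
    show "k (u + 1) = k u + n" for u
    proof -
      have "2 * pi * of_int (k (u + 1)) = 2 * pi * of_int (k u + n)"
        using k [of "u + 1"] k [of u] unfolding per g(3) by (simp add: algebra_simps)
      then show ?thesis
        by (metis mult_cancel_left of_int_eq_iff mult_eq_0_iff pi_neq_zero zero_neq_numeral)
    qed
    fix u
    obtain e where e: "e > 0" "\<And>v. \<bar>v - u\<bar> < e \<Longrightarrow> \<bar>Im (g v) - Im (g u)\<bar> < pi / 4"
      using gnear [of u] by blast
    show "\<exists>e>0. \<forall>r s. u - e < r \<and> r < u \<and> u < s \<and> s < u + e \<longrightarrow> k s = k r + j u"
    proof (cases "f u \<in> \<real>\<^sub>\<le>\<^sub>0")
      case False
      then have "isCont (\<lambda>v. Im (Ln (f v))) u"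
        by (intro isCont_Im isCont_Ln' contf)
      then obtain e' where e': "e' > 0" "\<And>v. \<bar>v - u\<bar> < e' \<Longrightarrow> \<bar>Im (Ln (f v)) - Im (Ln (f u))\<bar> < pi / 4"
        unfolding continuous_at_eps_delta dist_real_def by (metis pi_gt_zero zero_less_divide_iff zero_less_numeral)
      show ?thesis
      proof (intro exI [of _ "min e e'"] conjI allI impI)
        fix r s assume *: "u - min e e' < r \<and> r < u \<and> u < s \<and> s < u + min e e'"
        then have "\<bar>r - u\<bar> < e" "\<bar>s - u\<bar> < e" "\<bar>r - u\<bar> < e'" "\<bar>s - u\<bar> < e'"
          by linarith+
        then have "\<bar>(Im (g s) - Im (g r)) - (Im (Ln (f s)) - Im (Ln (f r)))\<bar> < 2 * pi"
          using e(2) [of r] e(2) [of s] e'(2) [of r] e'(2) [of s] pi_gt_zero by linarith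
        then have "k s = k r + 0"
          by (intro k_eq) simp
        then show "k s = k r + j u"
          using False by (simp add: j_def)
      qed (use e e' in auto)
    next
      case True
      then obtain e' where sg: "\<sigma> u = 1 \<or> \<sigma> u = -1" and e': "e' > 0"
        "\<And>r s. u - e' < r \<Longrightarrow> r < u \<Longrightarrow> u < s \<Longrightarrow> s < u + e' \<Longrightarrow>
           of_int (\<sigma> u) * Im (f r) > 0 \<and> of_int (\<sigma> u) * Im (f s) < 0"
        using cross [of u] by blast
      have "Re (f u) < 0"
        using True nz [of u] by (auto simp: complex_nonpos_Reals_iff complex_eq_iff less_le)
      moreover have "isCont (\<lambda>v. Re (f v)) u"
        by (rule continuous_Re [OF contf])
      ultimately obtain e'' where e'': "e'' > 0" "\<And>v. \<bar>v - u\<bar> < e'' \<Longrightarrow> \<bar>Re (f v) - Re (f u)\<bar> < - Re (f u)"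
        unfolding continuous_at_eps_delta dist_real_def by (metis neg_0_less_iff_less)
      show ?thesis
      proof (intro exI [of _ "min e (min e' e'')"] conjI allI impI)
        fix r s assume *: "u - min e (min e' e'') < r \<and> r < u \<and> u < s \<and> s < u + min e (min e' e'')"
        have "Re (f r) < 0" "Re (f s) < 0"
          using * e''(2) [of r] e''(2) [of s] by linarith+
        \<comment> \<open>Left of the imaginary axis the principal argument exceeds
          \<open>pi / 2\<close> in modulus, so it jumps by more than \<open>pi\<close> when
          \<open>Im\<close> changes sign, whereas the continuous argument moves by less than
          \<open>pi / 2\<close>.\<close>
        then have far: "\<bar>Im (Ln (f r))\<bar> > pi / 2" "\<bar>Im (Ln (f s))\<bar> > pi / 2"
          using Re_Ln_pos_le [OF nz [of r]] Re_Ln_pos_le [OF nz [of s]] by auto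
        have Im: "of_int (\<sigma> u) * Im (f r) > 0" "of_int (\<sigma> u) * Im (f s) < 0"
          using * e'(2) [of r s] by linarith+
        have ran: "- pi < Im (Ln (f v))" "Im (Ln (f v)) \<le> pi" for v
          using nz [of v] mpi_less_Im_Ln Im_Ln_le_pi by auto
        have pos: "0 < Im (Ln (f v)) \<and> Im (Ln (f v)) < pi \<longleftrightarrow> 0 < Im (f v)" for v
          using Im_Ln_pos_lt [OF nz [of v]] .
        have pos': "0 \<le> Im (Ln (f v)) \<longleftrightarrow> 0 \<le> Im (f v)" for v
          using Im_Ln_pos_le [OF nz [of v]] ran by auto
        have g_close: "\<bar>Im (g s) - Im (g r)\<bar> < pi / 2"
        proof -
          have "\<bar>r - u\<bar> < e" "\<bar>s - u\<bar> < e"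
            using * by linarith+
          then show ?thesis
            using e(2) [of r] e(2) [of s] by linarith
        qed
        from sg have "k s = k r + \<sigma> u"
        proof
          assume 1: "\<sigma> u = 1"
          then have "0 < Im (f r)" "Im (f s) < 0"
            using Im by auto
          then have "0 < Im (Ln (f r))" "Im (Ln (f s)) < 0"
            using pos [of r] pos' [of s] by linarith+
          then have "\<bar>(Im (g s) - Im (g r)) - (Im (Ln (f s)) - Im (Ln (f r))) - 2 * pi\<bar> < 2 * pi"
            using far ran [of r] ran [of s] g_close by linarith
          then show ?thesis
            unfolding 1 by (intro k_eq) simp
        next
          assume 1: "\<sigma> u = -1"
          then have "0 < Im (f s)" "Im (f r) < 0"
            using Im by auto
          then have "0 < Im (Ln (f s))" "Im (Ln (f r)) < 0"
            using pos [of s] pos' [of r] by linarith+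
          then have "\<bar>(Im (g s) - Im (g r)) - (Im (Ln (f s)) - Im (Ln (f r))) + 2 * pi\<bar> < 2 * pi"
            using far ran [of r] ran [of s] g_close by linarith
          then show ?thesis
            unfolding 1 by (intro k_eq) simp
        qed
        then show "k s = k r + j u"
          using True by (simp add: j_def)
      qed (use e e' e'' in auto)
    qed
  qed
  also have "{u \<in> {0..<1}. j u \<noteq> 0} = {u \<in> {0..<1}. f u \<in> \<real>\<^sub>\<le>\<^sub>0}"
    using sgn_nz by (auto simp: j_def)
  also have "(\<Sum>u\<in>{u \<in> {0..<1}. f u \<in> \<real>\<^sub>\<le>\<^sub>0}. j u) = (\<Sum>u\<in>{u \<in> {0..<1}. f u \<in> \<real>\<^sub>\<le>\<^sub>0}. \<sigma> u)"
    by (rule sum.cong) (auto simp: j_def)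
  finally show ?thesis .
qed

section \<open>Winding numbers of functions on a cylinder with nondegenerate zeros\<close>

lemma has_derivative_mult_vanishing:
  fixes f g :: "'a::real_normed_vector \<Rightarrow> 'b::real_normed_algebra"
  assumes g: "(g has_derivative g') (at x)" and "g x = 0" and cont: "isCont f x"
  shows "((\<lambda>y. f y * g y) has_derivative (\<lambda>h. f x * g' h)) (at x)"
  unfolding has_derivative_at_within
proof (intro conjI)
  show "bounded_linear (\<lambda>h. f x * g' h)"
    by (rule bounded_linear_const_mult [OF has_derivative_bounded_linear [OF g]])
  let ?q = "\<lambda>y. (g y - g x - g' (y - x)) /\<^sub>R norm (y - x)"
  obtain B where B: "\<And>h. norm (g' h) \<le> norm h * B"
    using bounded_linear.bounded [OF has_derivative_bounded_linear [OF g]] by blast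
  have "?q \<midarrow>x\<rightarrow> 0"
    using g by (simp add: has_derivative_at_within)
  moreover have "f \<midarrow>x\<rightarrow> f x"
    using cont by (simp add: isCont_def)
  ultimately have "(\<lambda>y. f y * ?q y) \<midarrow>x\<rightarrow> 0"
    using tendsto_mult [of f "f x" "at x" ?q 0] by simp
  moreover have "(\<lambda>y. (f y - f x) * (g' (y - x) /\<^sub>R norm (y - x))) \<midarrow>x\<rightarrow> 0"
  proof (rule tendsto_0_le [of "\<lambda>y. f y - f x" _ _ B])
    show "(\<lambda>y. f y - f x) \<midarrow>x\<rightarrow> 0"
      using \<open>f \<midarrow>x\<rightarrow> f x\<close> by (simp add: LIM_zero)
    have "norm ((f y - f x) * (g' (y - x) /\<^sub>R norm (y - x))) \<le> norm (f y - f x) * B" if "y \<noteq> x" for y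
    proof -
      have "norm (g' (y - x) /\<^sub>R norm (y - x)) \<le> B"
        using B [of "y - x"] that by (simp add: field_simps)
      then show ?thesis
        by (rule order_trans [OF norm_mult_ineq mult_left_mono]) simp
    qed
    then show "\<forall>\<^sub>F y in at x. norm ((f y - f x) * (g' (y - x) /\<^sub>R norm (y - x))) \<le> norm (f y - f x) * B"
      by (simp add: eventually_at_filter)
  qed
  \<comment> \<open>As \<open>g x = 0\<close>, the difference quotient of the product is exactly
    this sum; hence continuity of \<open>f\<close> suffices.\<close>
  ultimately have "(\<lambda>y. f y * ?q y + (f y - f x) * (g' (y - x) /\<^sub>R norm (y - x))) \<midarrow>x\<rightarrow> 0"
    using tendsto_add by force
  then show "(\<lambda>y. (f y * g y - f x * g x - f x * g' (y - x)) /\<^sub>R norm (y - x)) \<midarrow>x\<rightarrow> 0"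
    by (rule Lim_transform_eventually)
       (simp add: \<open>g x = 0\<close> algebra_simps)
qed

text \<open>A reference function on the cylinder: entire, of period 1, with simple zeros at the
  integer translates of \<open>q\<close> and nowhere else. Its winding number along horizontal lines
  drops from 1 to 0 as the line rises past \<open>q\<close>.\<close>

definition unit_zero :: "complex \<Rightarrow> complex \<Rightarrow> complex" where
  "unit_zero q w = 1 - exp (2 * of_real pi * \<i> * (w - q))"

lemma unit_zero_eq_0_iff: "unit_zero q w = 0 \<longleftrightarrow> w - q \<in> \<int>"
proof -
  have "unit_zero q w = 0 \<longleftrightarrow> exp (2 * of_real pi * \<i> * (w - q)) = exp 0"
    by (auto simp: unit_zero_def)
  also have "\<dots> \<longleftrightarrow> (\<exists>n::int. 2 * of_real pi * \<i> * (w - q) = 0 + (of_int (2 * n) * pi) * \<i>)"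
    unfolding exp_eq ..
  also have "\<dots> \<longleftrightarrow> (\<exists>n::int. (2 * of_real pi * \<i>) * (w - q) = (2 * of_real pi * \<i>) * of_int n)"
    by (simp add: mult_ac)
  also have "\<dots> \<longleftrightarrow> (\<exists>n::int. w - q = of_int n)"
    unfolding mult_cancel_left by simp
  finally show ?thesis
    by (auto simp: Ints_def)
qed

lemma unit_zero_periodic: "unit_zero q (w + 1) = unit_zero q w"
proof -
  have "exp (2 * of_real pi * \<i> * (w + 1 - q)) = exp (2 * of_real pi * \<i> * (w - q))"
    unfolding exp_eq by (rule exI [of _ 1]) (simp add: algebra_simps)
  then show ?thesis
    by (simp add: unit_zero_def)
qed

lemma continuous_on_unit_zero [continuous_intros]:
  "continuous_on S f \<Longrightarrow> continuous_on S (\<lambda>x. unit_zero q (f x))"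
  unfolding unit_zero_def by (intro continuous_intros)

lemma unit_zero_has_derivative:
  "(unit_zero q has_derivative (\<lambda>h. - (2 * of_real pi * \<i>) * h)) (at q)"
proof -
  have "(unit_zero q has_field_derivative - (2 * of_real pi * \<i>)) (at q)"
    unfolding unit_zero_def by (auto intro!: derivative_eq_intros)
  then show ?thesis
    unfolding has_field_derivative_def .
qed

lemma norm_exp_unit_zero: "norm (exp (2 * of_real pi * \<i> * (w - q))) = exp (2 * pi * (Im q - Im w))"
  by (simp add: algebra_simps)

text \<open>Above the level of \<open>q\<close> the exponential has modulus below 1, so the values
  stay in the right half-plane.\<close>

lemma has_wind_unit_zero_above:
  assumes "t > Im q"
  shows "has_wind (\<lambda>u. unit_zero q (Complex u t)) 0"
proof (rule has_wind_Re_pos)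
  show "continuous_on UNIV (\<lambda>u. unit_zero q (Complex u t))"
    by (auto simp: Complex_eq intro!: continuous_intros)
  show "unit_zero q (Complex (u + 1) t) = unit_zero q (Complex u t)" for u
    using unit_zero_periodic [of q "Complex u t"] by (simp add: Complex_eq algebra_simps)
  fix u
  have "Re (exp (2 * of_real pi * \<i> * (Complex u t - q))) \<le> exp (2 * pi * (Im q - t))"
    using complex_Re_le_cmod norm_exp_unit_zero [of "Complex u t" q] by (metis complex.sel(2))
  also have "\<dots> < 1"
    using assms by (simp add: mult_pos_neg)
  finally show "Re (unit_zero q (Complex u t)) > 0"
    by (simp add: unit_zero_def)
qed

text \<open>Below the level of \<open>q\<close> the exponential dominates. Factoring it out leaves 1
  minus a term of modulus below 1, and the factor itself turns once.\<close>

lemma has_wind_unit_zero_below: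
  assumes "t < Im q"
  shows "has_wind (\<lambda>u. unit_zero q (Complex u t)) 1"
proof -
  let ?c = "- exp (2 * of_real pi * \<i> * (\<i> * t - q))"
  have eq: "unit_zero q (Complex u t) =
    ?c * exp (2 * of_real pi * \<i> * of_real u) * (1 - exp (- (2 * of_real pi * \<i> * (Complex u t - q))))" for u
  proof -
    have "?c * exp (2 * of_real pi * \<i> * of_real u) = - exp (2 * of_real pi * \<i> * (Complex u t - q))"
      by (simp add: Complex_eq exp_add [symmetric] algebra_simps)
    moreover have "exp E * exp (- E) = 1" for E :: complex
      by (simp add: exp_minus)
    ultimately show ?thesis
      unfolding unit_zero_def by (simp only: right_diff_distrib mult_minus_left mult_1_right) simp
  qed
  have "has_wind (\<lambda>u. 1 - exp (- (2 * of_real pi * \<i> * (Complex u t - q)))) 0"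
  proof (rule has_wind_Re_pos)
    show "continuous_on UNIV (\<lambda>u. 1 - exp (- (2 * of_real pi * \<i> * (Complex u t - q))))"
      by (auto simp: Complex_eq intro!: continuous_intros)
    show "1 - exp (- (2 * of_real pi * \<i> * (Complex (u + 1) t - q)))
        = 1 - exp (- (2 * of_real pi * \<i> * (Complex u t - q)))" for u
    proof -
      have "exp (- (2 * of_real pi * \<i> * (Complex (u + 1) t - q)))
         = exp (- (2 * of_real pi * \<i> * (Complex u t - q)))"
        unfolding exp_eq by (rule exI [of _ "-1"]) (simp add: Complex_eq algebra_simps)
      then show ?thesis by simp
    qed
    fix u
    have "norm (exp (- (2 * of_real pi * \<i> * (Complex u t - q)))) = exp (2 * pi * (t - Im q))"
      by (simp add: algebra_simps)
    then have "Re (exp (- (2 * of_real pi * \<i> * (Complex u t - q)))) \<le> exp (2 * pi * (t - Im q))"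
      by (metis complex_Re_le_cmod)
    also have "\<dots> < 1"
      using assms by (simp add: mult_pos_neg)
    finally show "Re (1 - exp (- (2 * of_real pi * \<i> * (Complex u t - q)))) > 0"
      by simp
  qed
  from has_wind_mult [OF has_wind_exp this, of ?c]
  show ?thesis unfolding eq by simp
qed

text \<open>Near \<open>1\<close> the exponential is inverted by \<open>Ln\<close>, which is
  continuous there. This allows neighbourhoods of all translates of \<open>q\<close> to be described
  at once by the periodic quantity \<open>norm (unit_zero q w)\<close>.\<close>

lemma small_unit_zero:
  assumes "\<rho> > 0"
  shows "\<exists>r>0. \<forall>w. norm (unit_zero q w) < r \<longrightarrow> (\<exists>w'. w - w' \<in> \<int> \<and> norm (w' - q) < \<rho>)"
proof -
  have "isCont Ln 1"
    by (rule continuous_intros) auto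
  then obtain d where d: "d > 0" "\<And>z. norm (z - 1) < d \<Longrightarrow> norm (Ln z - Ln 1) < 2 * pi * \<rho>"
    unfolding continuous_at_eps_delta dist_norm using assms by (metis mult_pos_pos pi_gt_zero zero_less_numeral)
  show ?thesis
  proof (intro exI [of _ d] conjI allI impI)
    fix w assume *: "norm (unit_zero q w) < d"
    define z where "z = exp (2 * of_real pi * \<i> * (w - q))"
    define w' where "w' = q + Ln z / (2 * of_real pi * \<i>)"
    have "z \<noteq> 0"
      by (simp add: z_def)
    have "norm (z - 1) < d"
      using * by (simp add: unit_zero_def z_def norm_minus_commute)
    then have "norm (Ln z) < 2 * pi * \<rho>"
      using d(2) [of z] by simp
    then have "norm (w' - q) < \<rho>"
      by (simp add: w'_def norm_divide norm_mult field_simps)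
    moreover have "w - w' \<in> \<int>"
    proof -
      have "exp (2 * of_real pi * \<i> * (w - w')) = exp (2 * of_real pi * \<i> * (w - q) - Ln z)"
        by (simp add: w'_def algebra_simps)
      also have "\<dots> = 1"
        using \<open>z \<noteq> 0\<close> by (simp add: exp_diff z_def [symmetric])
      finally show ?thesis
        using unit_zero_eq_0_iff [of w' w] by (simp add: unit_zero_def)
    qed
    ultimately show "\<exists>w'. w - w' \<in> \<int> \<and> norm (w' - q) < \<rho>"
      by blast
  qed (rule d)
qed

text \<open>For \<open>norm \<beta> < norm \<alpha>\<close> the real-linear map
  \<open>\<alpha> * h + \<beta> * cnj h\<close> is invertible and preserves orientation. The
  constant \<open>a\<close> gives \<open>a * unit_zero q\<close> the complex-linear part as its
  derivative, and the antilinear part is too small to cancel it.\<close>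

lemma near_nondegenerate_zero:
  assumes deriv: "(G has_derivative (\<lambda>h. \<alpha> * h + \<beta> * cnj h)) (at q)"
    and "norm \<beta> < norm \<alpha>" and "G q = 0"
  defines "a \<equiv> \<alpha> / - (2 * of_real pi * \<i>)"
  shows "\<exists>\<rho>>0. \<forall>w. w \<noteq> q \<and> norm (w - q) < \<rho> \<longrightarrow> norm (G w - a * unit_zero q w) < norm (a * unit_zero q w)"
proof -
  let ?K = "\<lambda>w. a * unit_zero q w"
  \<comment> \<open>The two linearisation errors leave \<open>norm \<beta> + 2 * \<epsilon> = norm
    \<alpha> - 2 * \<epsilon>\<close> as the bound for the difference, against
    \<open>norm \<alpha> - \<epsilon>\<close> for the reference function.\<close>
  define \<epsilon> where "\<epsilon> = (norm \<alpha> - norm \<beta>) / 4"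
  have "\<epsilon> > 0"
    using assms by (simp add: \<epsilon>_def)
  have "(?K has_derivative (\<lambda>h. a * (- (2 * of_real pi * \<i>) * h))) (at q)"
    by (intro has_derivative_mult_right unit_zero_has_derivative)
  also have "(\<lambda>h. a * (- (2 * of_real pi * \<i>) * h)) = (\<lambda>h. \<alpha> * h)"
    unfolding mult.assoc [symmetric] by (simp add: a_def)
  finally have K: "(?K has_derivative (\<lambda>h. \<alpha> * h)) (at q)" .
  obtain d1 where d1: "d1 > 0" "\<And>w. norm (w - q) < d1 \<Longrightarrow>
      norm (G w - G q - (\<alpha> * (w - q) + \<beta> * cnj (w - q))) \<le> \<epsilon> * norm (w - q)"
    using deriv \<open>\<epsilon> > 0\<close> unfolding has_derivative_at_alt by blast
  obtain d2 where d2: "d2 > 0" "\<And>w. norm (w - q) < d2 \<Longrightarrow>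
      norm (?K w - ?K q - \<alpha> * (w - q)) \<le> \<epsilon> * norm (w - q)"
    using K \<open>\<epsilon> > 0\<close> unfolding has_derivative_at_alt by blast
  have Kq: "?K q = 0"
    by (simp add: unit_zero_def)
  show ?thesis
  proof (intro exI [of _ "min d1 d2"] conjI allI impI)
    fix w assume w: "w \<noteq> q \<and> norm (w - q) < min d1 d2"
    define h where "h = w - q"
    have "norm h > 0"
      using w by (simp add: h_def)
    have 1: "norm (G w - (\<alpha> * h + \<beta> * cnj h)) \<le> \<epsilon> * norm h"
      using d1(2) [of w] w \<open>G q = 0\<close> by (simp add: h_def)
    have 2: "norm (?K w - \<alpha> * h) \<le> \<epsilon> * norm h"
      using d2(2) [of w] w Kq by (simp add: h_def)
    have "G w - ?K w = (G w - (\<alpha> * h + \<beta> * cnj h)) + (\<beta> * cnj h - (?K w - \<alpha> * h))"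
      by (simp add: algebra_simps)
    also have "norm \<dots> \<le> norm (G w - (\<alpha> * h + \<beta> * cnj h)) + (norm (\<beta> * cnj h) + norm (?K w - \<alpha> * h))"
      by (intro order_trans [OF norm_triangle_ineq] add_left_mono norm_triangle_ineq4)
    also have "\<dots> \<le> \<epsilon> * norm h + (norm \<beta> * norm h + \<epsilon> * norm h)"
      using 1 2 by (simp add: norm_mult)
    also have "\<dots> = (norm \<alpha> - 2 * \<epsilon>) * norm h"
      by (simp add: \<epsilon>_def field_simps)
    also have "\<dots> < (norm \<alpha> - \<epsilon>) * norm h"
      using \<open>\<epsilon> > 0\<close> \<open>norm h > 0\<close> by simp
    also have "\<dots> \<le> norm (\<alpha> * h) - norm (?K w - \<alpha> * h)"
      using 2 by (simp add: norm_mult left_diff_distrib)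
    also have "\<dots> \<le> norm (?K w)"
      using norm_triangle_ineq2 [of "\<alpha> * h" "\<alpha> * h - ?K w"] by (simp add: norm_minus_commute)
    finally show "norm (G w - ?K w) < norm (?K w)" .
  qed (use d1 d2 in auto)
qed

lemma unit_zero_level_bound:
  assumes "t \<noteq> Im q"
  shows "\<exists>r>0. \<forall>w. Im w = t \<longrightarrow> r \<le> norm (unit_zero q w)"
proof (intro exI [of _ "\<bar>1 - exp (2 * pi * (Im q - t))\<bar>"] conjI allI impI)
  show "\<bar>1 - exp (2 * pi * (Im q - t))\<bar> > 0"
    using assms by simp
  fix w assume "Im w = t"
  then show "\<bar>1 - exp (2 * pi * (Im q - t))\<bar> \<le> norm (unit_zero q w)"
    using norm_triangle_ineq3 [of 1 "exp (2 * of_real pi * \<i> * (w - q))"]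
    unfolding norm_exp_unit_zero unit_zero_def by simp
qed

text \<open>
  Dividing by \<open>unit_zero q\<close> removes the zero at \<open>q\<close> at the cost of one turn. The quotient need
  not be continuous at \<open>q\<close>, but its values near \<open>q\<close> stay within a disc avoiding \<open>0\<close>, so it can be
  interpolated to the centre of that disc.
\<close>

lemma has_wind_jump:
  fixes G :: "complex \<Rightarrow> complex"
  assumes "finite Q" and "t1 \<le> t2"
    and "continuous_on {w. t1 \<le> Im w \<and> Im w \<le> t2} G"
    and "\<And>w. G (w + 1) = G w"
    and "\<And>w. t1 \<le> Im w \<Longrightarrow> Im w \<le> t2 \<Longrightarrow> G w = 0 \<longleftrightarrow> (\<exists>q\<in>Q. w - q \<in> \<int>)"
    and "\<And>q q'. q \<in> Q \<Longrightarrow> q' \<in> Q \<Longrightarrow> q - q' \<in> \<int> \<Longrightarrow> q = q'"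
    and "\<And>q. q \<in> Q \<Longrightarrow> t1 < Im q \<and> Im q < t2"
    and "\<And>q. q \<in> Q \<Longrightarrow> \<exists>\<alpha> \<beta>. norm \<beta> < norm \<alpha> \<and> (G has_derivative (\<lambda>h. \<alpha> * h + \<beta> * cnj h)) (at q)"
    and "has_wind (\<lambda>u. G (Complex u t1)) n"
  shows "has_wind (\<lambda>u. G (Complex u t2)) (n - int (card Q))"
  using assms
proof (induction Q arbitrary: G n rule: finite_induct)
  case empty
  let ?F = "\<lambda>p. G (Complex (snd p) (fst p))"
  have "has_wind (\<lambda>u. ?F (t2, u)) n"
  proof (rule has_wind_homotopic [of t1 t2 ?F])
    show "continuous_on ({t1..t2} \<times> UNIV) (\<lambda>p. G (Complex (snd p) (fst p)))"
      by (rule continuous_on_compose2 [OF empty.prems(2)]) (auto simp: Complex_eq intro!: continuous_intros)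
    show "?F (s, u + 1) = ?F (s, u)" for s u
      using empty.prems(3) [of "Complex u s"] by (simp add: Complex_eq algebra_simps)
  qed (use empty.prems in auto)
  then show ?case by simp
next
  case (insert q Q)
  note le = insert.prems(1) and cont = insert.prems(2) and per = insert.prems(3)
    and zero = insert.prems(4) and inj = insert.prems(5) and inside = insert.prems(6)
    and deriv = insert.prems(7) and wind = insert.prems(8)
  let ?S = "{w. t1 \<le> Im w \<and> Im w \<le> t2}"
  let ?K = "unit_zero q"
  obtain \<alpha> \<beta> where ab: "norm \<beta> < norm \<alpha>" "(G has_derivative (\<lambda>h. \<alpha> * h + \<beta> * cnj h)) (at q)"
    using deriv [of q] by blast
  define a where "a = \<alpha> / - (2 * of_real pi * \<i>)"
  have "a \<noteq> 0"
    using ab(1) by (auto simp: a_def)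
  have "G q = 0"
    using zero [of q] inside [of q] by auto
  obtain \<rho> where \<rho>: "\<rho> > 0"
    "\<And>w. w \<noteq> q \<Longrightarrow> norm (w - q) < \<rho> \<Longrightarrow> norm (G w - a * ?K w) < norm (a * ?K w)"
    using near_nondegenerate_zero [OF ab(2,1) \<open>G q = 0\<close>] unfolding a_def by blast
  \<comment> \<open>Four thresholds for \<open>norm (?K w)\<close>: below \<open>r1\<close> some
    translate of \<open>w\<close> lies where the estimate for \<open>\<rho>\<close> holds,
    \<open>r2\<close> and \<open>r3\<close> keep away from the two boundary lines, \<open>r4\<close>
    from the other zeros.\<close>
  obtain r1 where r1: "r1 > 0" "\<And>w. norm (?K w) < r1 \<Longrightarrow> \<exists>w'. w - w' \<in> \<int> \<and> norm (w' - q) < \<rho>"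
    using small_unit_zero [OF \<rho>(1), of q] by blast
  obtain r2 where r2: "r2 > 0" "\<And>w. Im w = t1 \<Longrightarrow> r2 \<le> norm (?K w)"
    using unit_zero_level_bound [of t1 q] inside [of q] by auto
  obtain r3 where r3: "r3 > 0" "\<And>w. Im w = t2 \<Longrightarrow> r3 \<le> norm (?K w)"
    using unit_zero_level_bound [of t2 q] inside [of q] by auto
  have KQ: "?K q' \<noteq> 0" if "q' \<in> Q" for q'
    using inj [of q' q] that insert.hyps unit_zero_eq_0_iff by auto
  define r4 where "r4 = Min (insert 1 ((\<lambda>q'. norm (?K q')) ` Q))"
  have r4: "r4 > 0" "\<And>q'. q' \<in> Q \<Longrightarrow> r4 \<le> norm (?K q')"
    using insert.hyps(1) KQ by (auto simp: r4_def)
  define r where "r = min (min r1 r2) (min r3 r4) / 3"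
  have r: "r > 0" "2 * r < r1" "2 * r < r2" "2 * r < r3" "2 * r < r4"
    using r1(1) r2(1) r3(1) r4(1) by (auto simp: r_def min_def)
  \<comment> \<open>A cutoff depending on \<open>norm (?K w)\<close> only, hence periodic:
    \<open>1\<close> up to \<open>r\<close> and \<open>0\<close> from \<open>2 * r\<close> on. The
    inner plateau makes \<open>H\<close> constant near \<open>q\<close>, where \<open>G / ?K\<close>
    need not have a limit.\<close>
  define \<kappa> where "\<kappa> w = max 0 (min 1 (2 - norm (?K w) / r))" for w
  have \<kappa>: "0 \<le> \<kappa> w" "\<kappa> w \<le> 1" for w
    by (auto simp: \<kappa>_def)
  have \<kappa>1: "\<kappa> w = 1" if "norm (?K w) \<le> r" for w
    using that r by (simp add: \<kappa>_def field_simps)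
  have \<kappa>0: "\<kappa> w = 0" if "norm (?K w) \<ge> 2 * r" for w
    using that r by (simp add: \<kappa>_def field_simps)
  define H where "H w = of_real (1 - \<kappa> w) * (G w / ?K w) + of_real (\<kappa> w) * a" for w
  have contH: "continuous_on ?S H"
  proof -
    have closed: "closed ?S"
      by (intro closed_Collect_conj closed_Collect_le continuous_intros)
    have S: "?S = (?S \<inter> {w. r \<le> norm (?K w)}) \<union> (?S \<inter> {w. norm (?K w) \<le> r})"
      by auto
    have cont\<kappa>: "continuous_on A \<kappa>" for A
      unfolding \<kappa>_def using r by (intro continuous_intros) auto
    have "continuous_on (?S \<inter> {w. r \<le> norm (?K w)}) H"
      unfolding H_def using r
      by (intro continuous_intros cont\<kappa> continuous_on_subset [OF cont]) auto
    moreover have "continuous_on (?S \<inter> {w. norm (?K w) \<le> r}) H"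
    proof (rule continuous_on_eq [of _ "\<lambda>_. a"])
      show "a = H w" if "w \<in> ?S \<inter> {w. norm (?K w) \<le> r}" for w
        using that \<kappa>1 [of w] by (simp add: H_def)
    qed simp
    ultimately show ?thesis
      by (subst S, intro continuous_on_closed_Un closed_Int closed closed_Collect_le continuous_intros) auto
  qed
  have perH: "H (w + 1) = H w" for w
    by (simp add: H_def \<kappa>_def per unit_zero_periodic)
  have H_far: "H w = G w / ?K w" if "norm (?K w) \<ge> 2 * r" for w
    using \<kappa>0 [OF that] by (simp add: H_def)
  have H_near: "H w \<noteq> 0" if small: "norm (?K w) < 2 * r" for w
  proof (cases "?K w = 0")
    case True
    then show ?thesis
      using \<kappa>1 [of w] r \<open>a \<noteq> 0\<close> by (simp add: H_def)
  next
    case False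
    obtain w' where w': "w - w' \<in> \<int>" "norm (w' - q) < \<rho>"
      using r1(2) [of w] small r by auto
    have eq: "G w = G w'" "?K w = ?K w'"
      using periodic_Ints [of G w w'] periodic_Ints [of ?K w w'] per unit_zero_periodic w'(1) by auto
    then have "w' \<noteq> q"
      using False by (auto simp: unit_zero_def)
    then have "norm (G w - a * ?K w) < norm (a * ?K w)"
      using \<rho>(2) [of w'] w' by (simp add: eq)
    \<comment> \<open>The relative error of \<open>G\<close> against \<open>a * ?K\<close>. As it is
      smaller than 1, the whole segment from \<open>G w / ?K w\<close> to \<open>a\<close> avoids
      \<open>0\<close>.\<close>
    moreover define \<eta> where "\<eta> = (G w - a * ?K w) / (a * ?K w)"
    ultimately have "norm \<eta> < 1"
      using False \<open>a \<noteq> 0\<close> by (simp add: norm_divide)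
    have "G w / ?K w = a * (1 + \<eta>)"
      using False \<open>a \<noteq> 0\<close> by (simp add: \<eta>_def field_simps)
    then have "H w = a * (1 + of_real (1 - \<kappa> w) * \<eta>)"
      by (simp add: H_def algebra_simps)
    moreover have "norm (of_real (1 - \<kappa> w) * \<eta>) < 1"
    proof -
      have "norm (of_real (1 - \<kappa> w) * \<eta>) = (1 - \<kappa> w) * norm \<eta>"
        using \<kappa> [of w] by (simp only: norm_mult norm_of_real abs_of_nonneg diff_ge_0_iff_ge)
      also have "\<dots> \<le> norm \<eta>"
        using \<kappa> [of w] by (simp add: mult_left_le_one_le)
      finally show ?thesis
        using \<open>norm \<eta> < 1\<close> by simp
    qed
    ultimately show ?thesis
      using \<open>a \<noteq> 0\<close> by (metis add_eq_0_iff less_irrefl mult_eq_0_iff norm_minus_cancel norm_one)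
  qed
  have zeroH: "H w = 0 \<longleftrightarrow> (\<exists>q'\<in>Q. w - q' \<in> \<int>)" if "t1 \<le> Im w" "Im w \<le> t2" for w
  proof (cases "norm (?K w) < 2 * r")
    case True
    have "w - q' \<notin> \<int>" if "q' \<in> Q" for q'
      using periodic_Ints [of ?K w q'] unit_zero_periodic r4(2) [OF that] r True by auto
    then show ?thesis
      using H_near [OF True] by blast
  next
    case False
    then have "?K w \<noteq> 0" "w - q \<notin> \<int>"
      using r unit_zero_eq_0_iff [of q w] by auto
    then show ?thesis
      using H_far [of w] False zero [OF that] by auto
  qed
  have derivH: "\<exists>\<alpha> \<beta>. norm \<beta> < norm \<alpha> \<and> (H has_derivative (\<lambda>h. \<alpha> * h + \<beta> * cnj h)) (at q')" if q': "q' \<in> Q" for q'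
  proof -
    obtain \<alpha>' \<beta>' where ab': "norm \<beta>' < norm \<alpha>'" "(G has_derivative (\<lambda>h. \<alpha>' * h + \<beta>' * cnj h)) (at q')"
      using deriv [of q'] q' by blast
    let ?c = "1 / ?K q'"
    have "G q' = 0"
      using zero [of q'] inside [of q'] q' by (auto intro: bexI [of _ q'])
    have contK: "isCont ?K w" for w
      using continuous_on_unit_zero [OF continuous_on_id, of UNIV q]
      by (simp add: continuous_on_eq_continuous_at)
    \<comment> \<open>Dividing by \<open>?K\<close> multiplies both coefficients of the derivative
      by one nonzero constant, so the remaining zeros keep their orientation.\<close>
    have "((\<lambda>w. 1 / ?K w * G w) has_derivative (\<lambda>h. ?c * (\<alpha>' * h + \<beta>' * cnj h))) (at q')"
      by (intro has_derivative_mult_vanishing ab' \<open>G q' = 0\<close> continuous_intros contK KQ q')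
    moreover have "\<forall>\<^sub>F w in at q'. 1 / ?K w * G w = H w"
    proof -
      have "\<forall>\<^sub>F w in at q'. norm (?K w) > 2 * r"
        using contK [of q'] r4(2) [OF q'] r
        by (intro order_tendstoD(1) [of _ "norm (?K q')"] tendsto_norm) (auto simp: isCont_def)
      then show ?thesis
        by eventually_elim (simp add: H_far)
    qed
    ultimately have "(H has_derivative (\<lambda>h. ?c * (\<alpha>' * h + \<beta>' * cnj h))) (at q')"
      by (rule has_derivative_transform_eventually) (use H_far [of q'] r4(2) [OF q'] r in auto)
    then have "(H has_derivative (\<lambda>h. (?c * \<alpha>') * h + (?c * \<beta>') * cnj h)) (at q')"
      by (simp add: ring_distribs mult_ac)
    moreover have "norm (?c * \<beta>') < norm (?c * \<alpha>')"
      using ab'(1) KQ [OF q'] by (simp add: norm_divide divide_strict_right_mono)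
    ultimately show ?thesis by blast
  qed
  have lines: "G (Complex u t) = H (Complex u t) * ?K (Complex u t)" if "t = t1 \<or> t = t2" for u t
  proof -
    have "norm (?K (Complex u t)) > 2 * r"
      using that r r2(2) [of "Complex u t"] r3(2) [of "Complex u t"] by auto
    moreover from this have "?K (Complex u t) \<noteq> 0"
      using r by auto
    ultimately show ?thesis
      using H_far [of "Complex u t"] by simp
  qed
  have "H (Complex u t1) \<noteq> 0" for u
    using has_wind_imp_nonzero [OF wind, of u] lines [of t1 u] by auto
  moreover have "continuous_on UNIV (\<lambda>u. H (Complex u t1))"
    by (rule continuous_on_compose2 [OF contH]) (use le in \<open>auto simp: Complex_eq intro!: continuous_intros\<close>)
  moreover have "H (Complex (u + 1) t1) = H (Complex u t1)" for u
    using perH [of "Complex u t1"] by (simp add: Complex_eq algebra_simps)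
  ultimately obtain m where m: "has_wind (\<lambda>u. H (Complex u t1)) m"
    using has_wind_ex [of "\<lambda>u. H (Complex u t1)"] by metis
  have "has_wind (\<lambda>u. G (Complex u t1)) (m + 1)"
    using has_wind_mult [OF m has_wind_unit_zero_below [of t1 q]] inside [of q] lines by simp
  with wind have "n = m + 1"
    by (rule has_wind_unique)
  have "has_wind (\<lambda>u. H (Complex u t2)) (m - int (card Q))"
    using inj inside by (intro insert.IH le contH perH zeroH derivH m) auto
  from has_wind_mult [OF this has_wind_unit_zero_above [of q t2]]
  have "has_wind (\<lambda>u. G (Complex u t2)) (m - int (card Q))"
    using inside [of q] lines by simp
  then show ?case
    using insert.hyps \<open>n = m + 1\<close> by simp
qed

section \<open>Holonomy of a chain of vectors in the spinor bundle\<close>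

definition fpart :: "real ^ 3 \<Rightarrow> complex" where
  "fpart D = Complex (D $ 1) (D $ 3)"

text \<open>
  \<open>spin_proj D\<close> is the matrix \<open>|D| + D \<cdot> \<sigma>\<close>, with the Pauli matrices numbered so that the \<open>y\<close>-axis is the
  diagonal one. It has rank one, and its range is the line over the direction of \<open>D\<close> in the
  tautological bundle over the sphere.
\<close>

definition spin_proj :: "real ^ 3 \<Rightarrow> complex \<times> complex \<Rightarrow> complex \<times> complex" where
  "spin_proj D v = (of_real (norm D - D $ 2) * fst v + cnj (fpart D) * snd v,
               fpart D * fst v + of_real (norm D + D $ 2) * snd v)"

text \<open>The vector \<open>(1, \<i>)\<close> spans the line over the vertical direction, in which the chain starts and ends.\<close>

primrec hol_vec :: "(nat \<Rightarrow> real ^ 3) \<Rightarrow> nat \<Rightarrow> complex \<times> complex" where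
  "hol_vec D 0 = (1, \<i>)"
| "hol_vec D (Suc k) = spin_proj (D (Suc k)) (hol_vec D k)"

text \<open>\<open>fst v - \<i> * snd v\<close> is the Hermitian product of \<open>v\<close> with
  \<open>(1, \<i>)\<close>, that is, the coefficient of the projection back to the vertical
  line.\<close>

definition hol :: "(nat \<Rightarrow> real ^ 3) \<Rightarrow> nat \<Rightarrow> complex" where
  "hol D k = fst (hol_vec D k) - \<i> * snd (hol_vec D k)"

text \<open>Half the trace of the product of the two matrices \<open>spin_proj\<close> vanishes,
  which is the form in which the condition is met. A zero vector is antiparallel to everything, so
  the negation also says that both vectors are nonzero.\<close>

definition antiparallel :: "real ^ 3 \<Rightarrow> real ^ 3 \<Rightarrow> bool" where
  "antiparallel D E \<longleftrightarrow> norm D * norm E + D \<bullet> E = 0"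

abbreviation e3 :: "real ^ 3" where
  "e3 \<equiv> axis 3 1"

lemma norm_squared_vec3: "(norm (D :: real ^ 3))\<^sup>2 = (D $ 1)\<^sup>2 + (D $ 2)\<^sup>2 + (D $ 3)\<^sup>2"
  unfolding power2_norm_eq_inner by (simp add: inner_vec_def sum_3 power2_eq_square)

lemma abs_component_le_norm: "\<bar>D $ 2\<bar> \<le> norm (D :: real ^ 3)"
  by (rule component_le_norm_cart)

lemma spin_proj_det: "complex_of_real (norm D - D $ 2) * of_real (norm D + D $ 2) = fpart D * cnj (fpart D)"
proof -
  have "(norm D - D $ 2) * (norm D + D $ 2) = (D $ 1)\<^sup>2 + (D $ 3)\<^sup>2"
    using norm_squared_vec3 [of D] by (simp add: algebra_simps power2_eq_square)
  then show ?thesis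
    unfolding complex_mult_cnj of_real_mult [symmetric] by (simp add: fpart_def)
qed

text \<open>The identity \<open>P E P = tr (P E) P\<close>, valid for matrices \<open>P\<close> of rank one.\<close>

lemma spin_proj_proj_proj:
  "spin_proj D (spin_proj E (spin_proj D v)) =
     (of_real (2 * (norm D * norm E + D \<bullet> E)) * fst (spin_proj D v),
      of_real (2 * (norm D * norm E + D \<bullet> E)) * snd (spin_proj D v))"
proof -
  define A where "A = complex_of_real (norm D - D $ 2)"
  define B where "B = complex_of_real (norm D + D $ 2)"
  define p where "p = fpart D"
  define c where "c = cnj (fpart D)"
  define A' where "A' = complex_of_real (norm E - E $ 2)"
  define B' where "B' = complex_of_real (norm E + E $ 2)"
  define p' where "p' = fpart E"
  define c' where "c' = cnj (fpart E)"
  define a where "a = fst v"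
  define b where "b = snd v"
  note folds = A_def [symmetric] B_def [symmetric] p_def [symmetric] A'_def [symmetric]
    B'_def [symmetric] p'_def [symmetric] a_def [symmetric] b_def [symmetric]
  have det: "A * B = p * c"
    unfolding A_def B_def p_def c_def by (rule spin_proj_det)
  have tr: "complex_of_real (2 * (norm D * norm E + D \<bullet> E)) = A * A' + B * B' + c * p' + p * c'"
    by (simp add: A_def A'_def B_def B'_def p_def p'_def c_def c'_def fpart_def complex_eq_iff
        inner_vec_def sum_3 algebra_simps)
  show ?thesis
    unfolding tr spin_proj_def fst_conv snd_conv c_def [symmetric] c'_def [symmetric]
    unfolding folds prod.inject by (intro conjI; use det in algebra)
qed

text \<open>By the trace identity, applying \<open>spin_proj D\<close> once more only rescales by a
  nonzero number, so \<open>spin_proj E\<close> is injective on the range of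
  \<open>spin_proj D\<close>.\<close>

lemma spin_proj_nonzero:
  assumes "\<not> antiparallel D E" and "spin_proj D v \<noteq> 0"
  shows "spin_proj E (spin_proj D v) \<noteq> 0"
proof
  assume "spin_proj E (spin_proj D v) = 0"
  then have "spin_proj D (spin_proj E (spin_proj D v)) = 0"
    by (simp add: spin_proj_def zero_prod_def)
  then show False
    using assms unfolding spin_proj_proj_proj antiparallel_def
    by (auto simp: zero_prod_def prod_eq_iff simp del: of_real_mult of_real_add)
qed

lemma norm_e3: "norm e3 = 1"
  by (simp add: norm_eq_sqrt_inner inner_axis_axis)

lemma spin_proj_e3: "spin_proj e3 v = (fst v - \<i> * snd v, \<i> * (fst v - \<i> * snd v))"
  unfolding spin_proj_def norm_e3 by (simp add: fpart_def axis_def complex_eq_iff)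

lemma hol_nonzero:
  assumes "k > 0"
    and "\<not> antiparallel e3 (D 1)" and "\<not> antiparallel (D k) e3"
    and "\<And>i. 1 \<le> i \<Longrightarrow> i < k \<Longrightarrow> \<not> antiparallel (D i) (D (Suc i))"
  shows "hol D k \<noteq> 0"
proof -
  \<comment> \<open>The induction also carries membership in the range of the latest projection,
    because the next projection is injective only on that line.\<close>
  have "\<exists>v. hol_vec D (Suc i) = spin_proj (D (Suc i)) v \<and> hol_vec D (Suc i) \<noteq> 0" if "Suc i \<le> k" for i
    using that
  proof (induction i)
    case 0
    have "hol_vec D (Suc 0) = spin_proj (D (Suc 0)) (spin_proj e3 (1, 0))"
      by (simp add: spin_proj_e3)
    moreover have "spin_proj e3 (1, 0) \<noteq> 0"
      by (simp add: spin_proj_e3 zero_prod_def)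
    ultimately show ?case
      using spin_proj_nonzero [of e3 "D 1" "(1, 0)"] assms(2) by (metis One_nat_def)
  next
    case (Suc i)
    then obtain v where v: "hol_vec D (Suc i) = spin_proj (D (Suc i)) v" "hol_vec D (Suc i) \<noteq> 0"
      by auto
    then have "spin_proj (D (Suc (Suc i))) (hol_vec D (Suc i)) \<noteq> 0"
      using spin_proj_nonzero [of "D (Suc i)" "D (Suc (Suc i))" v] assms(4) [of "Suc i"] Suc.prems by simp
    then show ?case
      by (metis hol_vec.simps(2))
  qed
  from this [of "k - 1"] obtain v where "hol_vec D k = spin_proj (D k) v" "hol_vec D k \<noteq> 0"
    using \<open>k > 0\<close> by auto
  then have "spin_proj e3 (hol_vec D k) \<noteq> 0"
    using spin_proj_nonzero [OF assms(3)] by metis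
  then show ?thesis
    by (auto simp: spin_proj_e3 hol_def zero_prod_def)
qed

lemma continuous_on_proj:
  assumes "continuous_on S D" and "continuous_on S v"
  shows "continuous_on S (\<lambda>x. spin_proj (D x) (v x))"
  unfolding spin_proj_def fpart_def Complex_eq
  by (intro continuous_intros assms)

lemma continuous_on_hol:
  assumes "\<And>i. continuous_on S (\<lambda>x. D x i)"
  shows "continuous_on S (\<lambda>x. hol (D x) k)"
proof -
  have "continuous_on S (\<lambda>x. hol_vec (D x) k)"
    by (induction k) (auto intro!: continuous_intros continuous_on_proj assms)
  then show ?thesis
    unfolding hol_def by (intro continuous_intros)
qed

text \<open>The first column of the matrix \<open>spin_proj D\<close>: a section of the tautological
  line bundle which, for nonzero \<open>D\<close>, vanishes only in the direction of the positive
  y-axis. It is the singular gauge of the computation.\<close>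

definition spinor :: "real ^ 3 \<Rightarrow> complex \<times> complex" where
  "spinor D = (of_real (norm D - D $ 2), fpart D)"

text \<open>The Hermitian product of the two spinors, conjugate linear in \<open>D\<close>, since
  the first row of \<open>spin_proj D\<close> is the conjugate of \<open>spinor D\<close>.\<close>

definition spin_prod :: "real ^ 3 \<Rightarrow> real ^ 3 \<Rightarrow> complex" where
  "spin_prod D E = fst (spin_proj D (spinor E))"

lemma spin_prod_eq:
  "spin_prod D E = of_real (norm D - D $ 2) * of_real (norm E - E $ 2) + cnj (fpart D) * fpart E"
  by (simp add: spin_prod_def spin_proj_def spinor_def)

lemma spinor_eq_0_iff: "spinor D = 0 \<longleftrightarrow> norm D = D $ 2"
proof -
  have "fpart D = 0" if "norm D = D $ 2"
    using spin_proj_det [of D] that by simp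
  then show ?thesis
    by (auto simp: spinor_def zero_prod_def)
qed

lemma spin_proj_eq_spinor:
  assumes "norm D \<noteq> D $ 2"
  shows "spin_proj D v = (fst (spin_proj D v) / of_real (norm D - D $ 2) * fst (spinor D),
                     fst (spin_proj D v) / of_real (norm D - D $ 2) * snd (spinor D))"
proof -
  have nz: "complex_of_real (norm D - D $ 2) \<noteq> 0"
    using assms by (metis of_real_eq_0_iff right_minus_eq)
  have "fpart D * (of_real (norm D - D $ 2) * fst v + cnj (fpart D) * snd v) =
    (fpart D * fst v + of_real (norm D + D $ 2) * snd v) * of_real (norm D - D $ 2)"
    using spin_proj_det [of D] by algebra
  then show ?thesis
    using nz spin_proj_det [of D] by (simp add: spin_proj_def spinor_def field_simps del: of_real_diff of_real_add)
qed

lemma spin_proj_spinor: "spin_proj D (spinor D) = (of_real (2 * norm D) * fst (spinor D), of_real (2 * norm D) * snd (spinor D))"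
  using spin_proj_det [of D] by (auto simp: spin_proj_def spinor_def algebra_simps)

text \<open>\<open>spinor E\<close> is an eigenvector of \<open>spin_proj E\<close>, so
  \<open>spin_proj D\<close> does not annihilate it. Its image is a multiple of
  \<open>spinor D\<close>, and \<open>spin_prod\<close> is the coefficient up to a nonzero
  factor.\<close>

lemma spin_prod_nonzero:
  assumes "\<not> antiparallel E D" and "norm D \<noteq> D $ 2" and "norm E \<noteq> E $ 2"
  shows "spin_prod D E \<noteq> 0"
proof
  assume "spin_prod D E = 0"
  then have 1: "spin_proj D (spinor E) = 0"
    using spin_proj_eq_spinor [OF assms(2), of "spinor E"] by (simp add: spin_prod_def zero_prod_def)
  have "E \<noteq> 0"
    using assms(3) by auto
  have "spin_proj E (spinor E) \<noteq> 0"
    using assms(3) spinor_eq_0_iff [of E] \<open>E \<noteq> 0\<close> by (auto simp: spin_proj_spinor zero_prod_def prod_eq_iff)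
  then have "spin_proj D (spin_proj E (spinor E)) \<noteq> 0"
    by (rule spin_proj_nonzero [OF assms(1)])
  moreover have "spin_proj D (spin_proj E (spinor E)) = (of_real (2 * norm E) * fst (spin_proj D (spinor E)), of_real (2 * norm E) * snd (spin_proj D (spinor E)))"
    unfolding spin_proj_spinor by (simp add: spin_proj_def algebra_simps)
  ultimately show False
    using 1 by (simp add: zero_prod_def)
qed

lemma fst_hol_vec_Suc:
  assumes "norm (D k) \<noteq> D k $ 2" and "k > 0"
  shows "fst (hol_vec D (Suc k)) =
    spin_prod (D (Suc k)) (D k) * fst (hol_vec D k) / of_real (norm (D k) - D k $ 2)"
proof -
  obtain j where j: "k = Suc j"
    using assms(2) gr0_implies_Suc by blast
  define c where "c = fst (hol_vec D k) / of_real (norm (D k) - D k $ 2)"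
  have "hol_vec D k = (c * fst (spinor (D k)), c * snd (spinor (D k)))"
    using spin_proj_eq_spinor [OF assms(1), of "hol_vec D j"] by (simp add: j c_def)
  then have "fst (hol_vec D (Suc k)) = fst (spin_proj (D (Suc k)) (c * fst (spinor (D k)), c * snd (spinor (D k))))"
    by simp
  also have "\<dots> = c * spin_prod (D (Suc k)) (D k)"
    by (simp add: spin_proj_def spin_prod_def algebra_simps)
  finally show ?thesis
    by (simp add: c_def)
qed

lemma hol_eq:
  assumes "norm (D k) \<noteq> D k $ 2" and "k > 0"
  shows "hol D k = fst (hol_vec D k) / of_real (norm (D k) - D k $ 2)
     * (of_real (norm (D k) - D k $ 2) - \<i> * fpart (D k))"
proof -
  obtain j where j: "k = Suc j"
    using assms(2) gr0_implies_Suc by blast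
  define c where "c = fst (hol_vec D k) / of_real (norm (D k) - D k $ 2)"
  have "hol_vec D k = (c * fst (spinor (D k)), c * snd (spinor (D k)))"
    using spin_proj_eq_spinor [OF assms(1), of "hol_vec D j"] by (simp add: j c_def)
  then have "hol D k = c * fst (spinor (D k)) - \<i> * (c * snd (spinor (D k)))"
    by (simp add: hol_def)
  also have "\<dots> = c * (of_real (norm (D k) - D k $ 2) - \<i> * fpart (D k))"
    by (simp add: spinor_def algebra_simps)
  finally show ?thesis
    unfolding c_def .
qed

lemma fst_hol_vec_1: "fst (hol_vec D (Suc 0)) = of_real (norm (D 1) - D 1 $ 2) + \<i> * cnj (fpart (D 1))"
  by (simp add: spin_proj_def)

lemma has_wind_divide_pos:
  fixes r :: "real \<Rightarrow> real"
  assumes "has_wind f n" and "continuous_on UNIV r" and "\<And>u. r (u + 1) = r u" and "\<And>u. r u > 0"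
  shows "has_wind (\<lambda>u. f u / of_real (r u)) n"
proof -
  have "has_wind (\<lambda>u. of_real (1 / r u)) 0"
    using assms(2-4) by (intro has_wind_Re_pos) (auto intro!: continuous_intros simp: less_imp_neq [symmetric])
  from has_wind_mult [OF assms(1) this] show ?thesis
    by simp
qed

text \<open>By \<open>pole\<close> the gauge is nonzero along the whole chain. In it the holonomy
  is, up to positive factors, the product of the Hermitian products of neighbouring spinors, with
  \<open>(1, \<i>)\<close> at both ends, and winding numbers add.\<close>

lemma has_wind_hol:
  fixes D :: "real \<Rightarrow> nat \<Rightarrow> real ^ 3"
  assumes cont: "\<And>i. continuous_on UNIV (\<lambda>u. D u i)"
    and per: "\<And>u i. D (u + 1) i = D u i"
    and pole: "\<And>u i. 1 \<le> i \<Longrightarrow> i \<le> k \<Longrightarrow> norm (D u i) \<noteq> D u i $ 2"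
    and first: "has_wind (\<lambda>u. of_real (norm (D u 1) - D u 1 $ 2) + \<i> * cnj (fpart (D u 1))) n0"
    and step: "\<And>i. 1 \<le> i \<Longrightarrow> i < k \<Longrightarrow> has_wind (\<lambda>u. spin_prod (D u (Suc i)) (D u i)) (n i)"
    and last: "has_wind (\<lambda>u. of_real (norm (D u k) - D u k $ 2) - \<i> * fpart (D u k)) n1"
    and "k > 0"
  shows "has_wind (\<lambda>u. hol (D u) k) (n0 + (\<Sum>i = 1..<k. n i) + n1)"
proof -
  have pos: "norm (D u i) - D u i $ 2 > 0" if "1 \<le> i" "i \<le> k" for u i
    using pole [OF that, of u] abs_component_le_norm [of "D u i"] by linarith
  have contr: "continuous_on UNIV (\<lambda>u. norm (D u i) - D u i $ 2)" for i
    by (intro continuous_intros cont)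
  have "has_wind (\<lambda>u. fst (hol_vec (D u) (Suc i))) (n0 + (\<Sum>i = 1..<Suc i. n i))" if "Suc i \<le> k" for i
    using that
  proof (induction i)
    case 0
    then show ?case
      using first unfolding fst_hol_vec_1 by simp
  next
    case (Suc i)
    have eq: "fst (hol_vec (D u) (Suc (Suc i))) = spin_prod (D u (Suc (Suc i))) (D u (Suc i)) *
        fst (hol_vec (D u) (Suc i)) / of_real (norm (D u (Suc i)) - D u (Suc i) $ 2)" for u
      using Suc.prems pole [of "Suc i" u] by (intro fst_hol_vec_Suc) auto
    have "has_wind (\<lambda>u. fst (hol_vec (D u) (Suc (Suc i)))) (n (Suc i) + (n0 + (\<Sum>i = 1..<Suc i. n i)))"
      unfolding eq using Suc.prems
      by (intro has_wind_divide_pos has_wind_mult step Suc.IH contr pos) (auto simp: per)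
    then show ?case
      by (simp add: algebra_simps)
  qed
  from this [of "k - 1"] have "has_wind (\<lambda>u. fst (hol_vec (D u) k)) (n0 + (\<Sum>i = 1..<k. n i))"
    using \<open>k > 0\<close> by simp
  then have "has_wind (\<lambda>u. fst (hol_vec (D u) k) / of_real (norm (D u k) - D u k $ 2)) (n0 + (\<Sum>i = 1..<k. n i))"
    using \<open>k > 0\<close> by (intro has_wind_divide_pos contr pos) (auto simp: per)
  note first_part = this
  have eq: "hol (D u) k = fst (hol_vec (D u) k) / of_real (norm (D u k) - D u k $ 2)
     * (of_real (norm (D u k) - D u k $ 2) - \<i> * fpart (D u k))" for u
    using \<open>k > 0\<close> pole [of k u] by (intro hol_eq) auto
  show ?thesis
    unfolding eq by (rule has_wind_mult [OF first_part last])
qed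

section \<open>Chords of families of Legendrian loops\<close>

definition chord :: "(real \<Rightarrow> real ^ 3) \<Rightarrow> real \<Rightarrow> real \<Rightarrow> real ^ 3" where
  "chord \<gamma> u \<tau> = \<gamma> (u + \<tau>) - \<gamma> u"

lemma antiparallel_commute: "antiparallel D E \<longleftrightarrow> antiparallel E D"
  by (simp add: antiparallel_def inner_commute mult.commute)

text \<open>Equality in the triangle inequality. It excludes antiparallel chords that are closer to
  each other than a common lower bound of their lengths.\<close>

lemma antiparallel_norm_diff:
  assumes "antiparallel D E"
  shows "norm (D - E) = norm D + norm E"
proof -
  have "(norm (D - E))\<^sup>2 = (norm D + norm E)\<^sup>2"
    using assms by (simp add: antiparallel_def power2_norm_eq_inner power2_sum inner_diff
        inner_commute algebra_simps)
  then show ?thesis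
    by (simp add: power2_eq_iff_nonneg)
qed

text \<open>Divided by \<open>t\<close> and \<open>s\<close>, which have the same sign, both vectors
  differ from \<open>V\<close> by at most a quarter of its length. The inner product of the
  quotients is at least \<open>1 - 1/4 - 1/4 - 1/16\<close> times the square of
  \<open>norm V\<close>.\<close>

lemma not_antiparallel_near:
  assumes "norm (D - t *\<^sub>R V) \<le> \<epsilon> * \<bar>t\<bar>" and "norm (E - s *\<^sub>R V) \<le> \<epsilon> * \<bar>s\<bar>"
    and "t * s > 0" and "4 * \<epsilon> \<le> norm V" and "V \<noteq> 0"
  shows "\<not> antiparallel D E"
proof -
  have nz: "t \<noteq> 0" "s \<noteq> 0"
    using assms(3) by auto
  define a where "a = (1 / t) *\<^sub>R D - V"
  define b where "b = (1 / s) *\<^sub>R E - V"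
  have D: "D = t *\<^sub>R (V + a)" and E: "E = s *\<^sub>R (V + b)"
    using nz by (auto simp: a_def b_def)
  have "norm a \<le> \<epsilon>" "norm b \<le> \<epsilon>"
    using assms(1,2) nz unfolding D E by (auto simp: algebra_simps mult.commute)
  then have small: "norm a \<le> norm V / 4" "norm b \<le> norm V / 4"
    using assms(4) by auto
  have "\<bar>V \<bullet> c\<bar> \<le> norm V * (norm V / 4)" if "norm c \<le> norm V / 4" for c
    by (rule order_trans [OF Cauchy_Schwarz_ineq2 mult_left_mono [OF that]]) simp
  then have "\<bar>V \<bullet> a\<bar> \<le> norm V * (norm V / 4)" "\<bar>V \<bullet> b\<bar> \<le> norm V * (norm V / 4)"
    using small by blast+
  moreover have "\<bar>a \<bullet> b\<bar> \<le> (norm V / 4) * (norm V / 4)"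
    by (rule order_trans [OF Cauchy_Schwarz_ineq2 mult_mono [OF small]]) auto
  moreover have "(V + a) \<bullet> (V + b) = norm V * norm V + V \<bullet> a + V \<bullet> b + a \<bullet> b"
  proof -
    have "norm V * norm V = V \<bullet> V"
      by (metis power2_eq_square power2_norm_eq_inner)
    then show ?thesis
      by (simp add: inner_add_left inner_add_right inner_commute [of a V])
  qed
  moreover have "norm V * norm V > 0"
    using \<open>V \<noteq> 0\<close> by simp
  ultimately have "(V + a) \<bullet> (V + b) > 0"
    by linarith
  then have "(t * s) * ((V + a) \<bullet> (V + b)) > 0"
    using assms(3) by (rule mult_pos_pos [rotated])
  then have "D \<bullet> E > 0"
    unfolding D E by (simp add: mult_ac)
  then have "norm D * norm E + D \<bullet> E > 0"
    by (intro add_nonneg_pos) auto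
  then show ?thesis
    by (simp add: antiparallel_def)
qed

lemma antiparallel_e3D:
  assumes "antiparallel e3 D"
  shows "D $ 1 = 0" "D $ 2 = 0"
proof -
  have "D $ 3 = - norm D"
    using assms by (simp add: antiparallel_def norm_e3 inner_axis')
  then have "(D $ 1)\<^sup>2 + (D $ 2)\<^sup>2 = 0"
    using norm_squared_vec3 [of D] by simp
  then show "D $ 1 = 0" "D $ 2 = 0"
    by (simp_all add: sum_power2_eq_zero_iff)
qed

text \<open>If \<open>D\<close> were vertical, \<open>V $ 1\<close> and \<open>V $ 2\<close> would
  be at most \<open>\<epsilon>\<close> in modulus, and the contact condition would bound
  \<open>V $ 3\<close> by \<open>Y * \<epsilon>\<close>; but \<open>V\<close> is longer than that
  allows.\<close>

lemma not_antiparallel_e3_near: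
  assumes "norm (D - t *\<^sub>R V) \<le> \<epsilon> * \<bar>t\<bar>" and "t \<noteq> 0"
    and V: "V $ 3 = y * V $ 1" and "\<bar>y\<bar> \<le> Y" and "\<epsilon> * (2 + Y) < norm V"
  shows "\<not> antiparallel e3 D"
proof
  assume "antiparallel e3 D"
  then have D: "D $ 1 = 0" "D $ 2 = 0"
    by (rule antiparallel_e3D)+
  have "\<bar>V $ i\<bar> \<le> \<epsilon>" if "D $ i = 0" for i
  proof -
    have "\<bar>t\<bar> * \<bar>V $ i\<bar> \<le> \<epsilon> * \<bar>t\<bar>"
      using order_trans [OF component_le_norm_cart assms(1), of i] that by (simp add: abs_mult)
    then show ?thesis
      using \<open>t \<noteq> 0\<close> by (simp add: mult.commute)
  qed
  then have b: "\<bar>V $ 1\<bar> \<le> \<epsilon>" "\<bar>V $ 2\<bar> \<le> \<epsilon>"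
    using D by auto
  have "\<bar>V $ 3\<bar> \<le> Y * \<epsilon>"
    unfolding V abs_mult using b assms(4) by (intro mult_mono) auto
  moreover have "norm V \<le> \<bar>V $ 1\<bar> + \<bar>V $ 2\<bar> + \<bar>V $ 3\<bar>"
    using norm_le_l1_cart [of V] by (simp add: sum_3)
  ultimately show False
    using b assms(5) by (simp add: algebra_simps)
qed

text \<open>The regularity is what the two winding numbers use: loops and velocities are jointly
  continuous, and derivatives are taken in the loop parameter alone. Isotopies and changes of
  parametrisation are both treated as such families.\<close>

locale loop_family =
  fixes G G' :: "real \<Rightarrow> real \<Rightarrow> real ^ 3"
  assumes cont: "continuous_on ({0..1} \<times> UNIV) (\<lambda>p. G (fst p) (snd p))"
    and cont': "continuous_on ({0..1} \<times> UNIV) (\<lambda>p. G' (fst p) (snd p))"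
    and deriv: "s \<in> {0..1} \<Longrightarrow> (G s has_vector_derivative G' s t) (at t)"
    and inj: "s \<in> {0..1} \<Longrightarrow> G s t = G s r \<longleftrightarrow> t - r \<in> \<int>"
    and nz: "s \<in> {0..1} \<Longrightarrow> G' s t \<noteq> 0"
    and contact: "s \<in> {0..1} \<Longrightarrow> G' s t $ 3 = G s t $ 2 * G' s t $ 1"
begin

lemma periodic: "s \<in> {0..1} \<Longrightarrow> G s (t + 1) = G s t"
  using inj by auto

lemma periodic': "s \<in> {0..1} \<Longrightarrow> G' s (t + 1) = G' s t"
proof -
  assume s: "s \<in> {0..1}"
  have "((\<lambda>t. t + 1) has_vector_derivative 1) (at t)"
    by (auto intro!: derivative_eq_intros)
  from vector_diff_chain_at [OF this deriv [OF s]]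
  have "(G s has_vector_derivative G' s (t + 1)) (at t)"
    by (simp add: o_def periodic [OF s])
  then show ?thesis
    using deriv [OF s, of t] by (rule vector_derivative_unique_at)
qed

lemma chord_periodic: "s \<in> {0..1} \<Longrightarrow> chord (G s) (u + 1) \<tau> = chord (G s) u \<tau>"
  using periodic [of s "u + \<tau>"] periodic [of s u] by (simp add: chord_def algebra_simps)

lemma chord_frac: "s \<in> {0..1} \<Longrightarrow> chord (G s) u \<tau> = chord (G s) (frac u) \<tau>"
  using periodic_Ints [of "\<lambda>u. chord (G s) u \<tau>" u "frac u"] chord_periodic
  by (simp add: frac_def)

lemma chord_nonzero: "s \<in> {0..1} \<Longrightarrow> 0 < \<tau> \<Longrightarrow> \<tau> < 1 \<Longrightarrow> chord (G s) u \<tau> \<noteq> 0"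
proof -
  assume "s \<in> {0..1}" "0 < \<tau>" "\<tau> < 1"
  moreover have "\<tau> \<notin> \<int>"
    using \<open>0 < \<tau>\<close> \<open>\<tau> < 1\<close> by (auto elim!: Ints_cases)
  ultimately show ?thesis
    using inj [of s "u + \<tau>" u] by (simp add: chord_def)
qed

lemma continuous_on_chord:
  "continuous_on ({0..1} \<times> (UNIV :: (real \<times> real) set)) (\<lambda>p. chord (G (fst p)) (fst (snd p)) (snd (snd p)))"
proof -
  let ?S = "{0..1} \<times> (UNIV :: (real \<times> real) set)"
  have "continuous_on ?S (\<lambda>p. (\<lambda>q. G (fst q) (snd q)) (fst p, fst (snd p) + snd (snd p)))"
    by (rule continuous_on_compose2 [OF cont]) (auto intro!: continuous_intros)
  moreover have "continuous_on ?S (\<lambda>p. (\<lambda>q. G (fst q) (snd q)) (fst p, fst (snd p)))"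
    by (rule continuous_on_compose2 [OF cont]) (auto intro!: continuous_intros)
  ultimately show ?thesis
    unfolding chord_def by (auto intro!: continuous_intros)
qed

lemma velocity_bound: "\<exists>m>0. \<forall>s\<in>{0..1}. \<forall>u\<in>{0..1}. m \<le> norm (G' s u)"
proof -
  have "continuous_on ({0..1} \<times> {0..1}) (\<lambda>p. norm (G' (fst p) (snd p)))"
    by (intro continuous_intros continuous_on_subset [OF cont']) auto
  then obtain p where p: "p \<in> {0..1} \<times> {0..1}"
    "\<And>q. q \<in> {0..1} \<times> {0..1} \<Longrightarrow> norm (G' (fst p) (snd p)) \<le> norm (G' (fst q) (snd q))"
    using continuous_attains_inf [of "{0..1} \<times> {0..1}" "\<lambda>p. norm (G' (fst p) (snd p))"]
    by (auto simp: compact_Times)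
  show ?thesis
  proof (intro exI [of _ "norm (G' (fst p) (snd p))"] conjI ballI)
    show "norm (G' (fst p) (snd p)) > 0"
      using p(1) nz by auto
    show "norm (G' (fst p) (snd p)) \<le> norm (G' s u)" if "s \<in> {0..1}" "u \<in> {0..1}" for s u
      using p(2) [of "(s, u)"] that by auto
  qed
qed

lemma slope_bound: "\<exists>Y\<ge>0. \<forall>s\<in>{0..1}. \<forall>u\<in>{0..1}. \<bar>G s u $ 2\<bar> \<le> Y"
proof -
  have "continuous_on ({0..1} \<times> {0..1}) (\<lambda>p. \<bar>G (fst p) (snd p) $ 2\<bar>)"
    by (intro continuous_intros continuous_on_subset [OF cont]) auto
  then obtain p where p: "p \<in> {0..1} \<times> {0..1}"
    "\<And>q. q \<in> {0..1} \<times> {0..1} \<Longrightarrow> \<bar>G (fst q) (snd q) $ 2\<bar> \<le> \<bar>G (fst p) (snd p) $ 2\<bar>"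
    using continuous_attains_sup [of "{0..1} \<times> {0..1}" "\<lambda>p. \<bar>G (fst p) (snd p) $ 2\<bar>"]
    by (auto simp: compact_Times)
  then show ?thesis
    by (intro exI [of _ "\<bar>G (fst p) (snd p) $ 2\<bar>"]) (force simp: mem_Times_iff)
qed

lemma linearisation:
  assumes "\<epsilon> > 0"
  shows "\<exists>\<eta>>0. \<forall>s\<in>{0..1}. \<forall>u\<in>{0..1}. \<forall>t. \<bar>t\<bar> < \<eta> \<longrightarrow> norm (G s (u + t) - G s u - t *\<^sub>R G' s u) \<le> \<epsilon> * \<bar>t\<bar>"
proof -
  \<comment> \<open>The second interval contains \<open>u + t\<close> for \<open>u\<close> in
    \<open>{0..1}\<close> and \<open>t\<close> of modulus below 1.\<close>
  let ?K = "{0..1} \<times> {-1..2::real}"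
  have "uniformly_continuous_on ?K (\<lambda>p. G' (fst p) (snd p))"
    by (intro compact_uniformly_continuous compact_Times continuous_on_subset [OF cont']) auto
  then obtain d where d: "d > 0" "\<And>p q. p \<in> ?K \<Longrightarrow> q \<in> ?K \<Longrightarrow> dist p q < d \<Longrightarrow>
      dist (G' (fst p) (snd p)) (G' (fst q) (snd q)) < \<epsilon>"
    using assms unfolding uniformly_continuous_on_def by meson
  show ?thesis
  proof (intro exI [of _ "min d 1"] conjI ballI allI impI)
    fix s u t :: real assume s: "s \<in> {0..1}" and u: "u \<in> {0..1}" and t: "\<bar>t\<bar> < min d 1"
    have "norm (G s (u + t) - G s u - (u + t - u) *\<^sub>R G' s u) \<le> norm (u + t - u) * \<epsilon>"
    proof (rule vector_differentiable_bound_linearization)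
      show "closed_segment u (u + t) \<subseteq> closed_segment u (u + t)" "u \<in> closed_segment u (u + t)"
        by auto
      show "(G s has_vector_derivative G' s x) (at x within closed_segment u (u + t))" for x
        using deriv [OF s] has_vector_derivative_at_within by blast
      show "norm (G' s x - G' s u) \<le> \<epsilon>" if "x \<in> closed_segment u (u + t)" for x
      proof -
        have "\<bar>x - u\<bar> \<le> \<bar>t\<bar>"
          using that by (auto simp: closed_segment_eq_real_ivl split: if_splits)
        then show ?thesis
          using d(2) [of "(s, x)" "(s, u)"] s u t by (auto simp: dist_Pair_Pair dist_real_def dist_norm less_imp_le)
      qed
    qed
    then show "norm (G s (u + t) - G s u - t *\<^sub>R G' s u) \<le> \<epsilon> * \<bar>t\<bar>"
      by (simp add: mult.commute)
  qed (use d in auto)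
qed

text \<open>For small \<open>\<tau>\<close> the chord is almost \<open>\<tau>\<close> times the
  velocity, for \<open>\<tau>\<close> near 1 almost \<open>\<tau> - 1\<close> times the velocity. In
  between, compactness bounds the length of the chords from below and makes neighbouring ones closer
  than that bound.\<close>

lemma chords_not_antiparallel:
  "\<exists>\<eta>>0. \<forall>s\<in>{0..1}. \<forall>u \<tau>. 0 < \<tau> \<and> \<tau> < 1 \<longrightarrow>
     (\<tau> < \<eta> \<or> 1 - \<eta> < \<tau> \<longrightarrow> \<not> antiparallel e3 (chord (G s) u \<tau>)) \<and>
     (\<forall>\<sigma>. 0 < \<sigma> \<and> \<sigma> < 1 \<and> \<bar>\<sigma> - \<tau>\<bar> < \<eta> \<longrightarrow> \<not> antiparallel (chord (G s) u \<sigma>) (chord (G s) u \<tau>))"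
proof -
  obtain m where m: "m > 0" "\<And>s u. s \<in> {0..1} \<Longrightarrow> u \<in> {0..1} \<Longrightarrow> m \<le> norm (G' s u)"
    using velocity_bound by blast
  obtain Y where Y: "Y \<ge> 0" "\<And>s u. s \<in> {0..1} \<Longrightarrow> u \<in> {0..1} \<Longrightarrow> \<bar>G s u $ 2\<bar> \<le> Y"
    using slope_bound by blast
  \<comment> \<open>The denominator serves two purposes: \<open>4 * \<epsilon> \<le> m\<close> for
    pairs of nearly tangent chords, and \<open>\<epsilon> * (2 + Y) < m\<close> for a nearly tangent
    chord and the vertical vector.\<close>
  define \<epsilon> where "\<epsilon> = m / (4 + Y)"
  have "\<epsilon> > 0"
    using m Y by (simp add: \<epsilon>_def)
  have \<epsilon>: "4 * \<epsilon> \<le> m" "\<epsilon> * (2 + Y) < m"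
    using m Y by (auto simp: \<epsilon>_def field_simps)
  obtain \<eta> where \<eta>: "\<eta> > 0" "\<And>s u t. s \<in> {0..1} \<Longrightarrow> u \<in> {0..1} \<Longrightarrow> \<bar>t\<bar> < \<eta> \<Longrightarrow>
      norm (G s (u + t) - G s u - t *\<^sub>R G' s u) \<le> \<epsilon> * \<bar>t\<bar>"
    using linearisation [OF \<open>\<epsilon> > 0\<close>] by blast
  have low: "norm (chord (G s) u \<tau> - \<tau> *\<^sub>R G' s u) \<le> \<epsilon> * \<bar>\<tau>\<bar>"
    if "s \<in> {0..1}" "u \<in> {0..1}" "\<bar>\<tau>\<bar> < \<eta>" for s u \<tau>
    using \<eta>(2) [OF that] by (simp add: chord_def)
  have high: "norm (chord (G s) u \<tau> - (\<tau> - 1) *\<^sub>R G' s u) \<le> \<epsilon> * \<bar>\<tau> - 1\<bar>"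
    if "s \<in> {0..1}" "u \<in> {0..1}" "\<bar>\<tau> - 1\<bar> < \<eta>" for s u \<tau>
    using low [OF that] periodic [OF that(1), of "u + (\<tau> - 1)"] by (simp add: chord_def)
  let ?K = "{0..1::real} \<times> {0..1::real} \<times> {\<eta>/2..1 - \<eta>/2}"
  let ?f = "\<lambda>p. chord (G (fst p)) (fst (snd p)) (snd (snd p))"
  have K: "compact ?K"
    by (intro compact_Times compact_Icc)
  have contK: "continuous_on ?K ?f"
    by (rule continuous_on_subset [OF continuous_on_chord]) auto
  have "\<exists>\<mu>>0. \<forall>p\<in>?K. \<mu> \<le> norm (?f p)"
  proof (cases "?K = {}")
    case False
    then obtain p where p: "p \<in> ?K" "\<And>q. q \<in> ?K \<Longrightarrow> norm (?f p) \<le> norm (?f q)"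
      using continuous_attains_inf [OF K False continuous_on_norm [OF contK]] by auto
    have "norm (?f p) > 0"
      using p(1) chord_nonzero [of "fst p" "snd (snd p)"] \<eta>(1) by auto
    with p(2) show ?thesis by blast
  qed (use zero_less_one in blast)
  then obtain \<mu> where \<mu>: "\<mu> > 0" "\<And>p. p \<in> ?K \<Longrightarrow> \<mu> \<le> norm (?f p)"
    by blast
  have "uniformly_continuous_on ?K ?f"
    by (intro compact_uniformly_continuous K contK)
  then obtain d where d: "d > 0" "\<And>p q. p \<in> ?K \<Longrightarrow> q \<in> ?K \<Longrightarrow> dist p q < d \<Longrightarrow> dist (?f p) (?f q) < \<mu>"
    using \<mu>(1) unfolding uniformly_continuous_on_def by meson
  \<comment> \<open>Half of \<open>\<eta>\<close>, so that two parameters this close are both below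
    \<open>\<eta>\<close>, or both above \<open>1 - \<eta>\<close>, or both in the compact middle
    range.\<close>
  define \<delta> where "\<delta> = min (\<eta> / 2) d"
  have e3: "\<not> antiparallel e3 (chord (G s) u \<tau>)"
    if s: "s \<in> {0..1}" and u: "u \<in> {0..1}" and \<tau>: "0 < \<tau>" "\<tau> < 1" "\<tau> < \<delta> \<or> 1 - \<delta> < \<tau>" for s u \<tau>
    using \<tau>(3)
  proof
    assume "\<tau> < \<delta>"
    then show ?thesis
      using not_antiparallel_e3_near [OF low [OF s u], of \<tau> "G s u $ 2" Y] contact [OF s] Y(2) [OF s u]
        m(2) [OF s u] \<epsilon> \<tau> by (auto simp: \<delta>_def)
  next
    assume "1 - \<delta> < \<tau>"
    then show ?thesis
      using not_antiparallel_e3_near [OF high [OF s u], of \<tau> "G s u $ 2" Y] contact [OF s] Y(2) [OF s u]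
        m(2) [OF s u] \<epsilon> \<tau> by (auto simp: \<delta>_def)
  qed
  have pair: "\<not> antiparallel (chord (G s) u \<sigma>) (chord (G s) u \<tau>)"
    if s: "s \<in> {0..1}" and u: "u \<in> {0..1}" and \<tau>: "0 < \<tau>" "\<tau> < 1" and \<sigma>: "0 < \<sigma>" "\<sigma> < 1"
      and close: "\<bar>\<sigma> - \<tau>\<bar> < \<delta>" for s u \<sigma> \<tau>
  proof -
    have V: "4 * \<epsilon> \<le> norm (G' s u)"
      using m(2) [OF s u] \<epsilon> by simp
    have c: "\<bar>\<sigma> - \<tau>\<bar> < \<eta> / 2" "\<bar>\<sigma> - \<tau>\<bar> < d"
      using close by (auto simp: \<delta>_def)
    consider "\<sigma> < \<eta>" "\<tau> < \<eta>" | "1 - \<eta> < \<sigma>" "1 - \<eta> < \<tau>"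
      | "\<eta> / 2 \<le> \<sigma>" "\<sigma> \<le> 1 - \<eta> / 2" "\<eta> / 2 \<le> \<tau>" "\<tau> \<le> 1 - \<eta> / 2"
      using c by linarith
    then show ?thesis
    proof cases
      case 1
      then show ?thesis
        using \<sigma> \<tau> by (intro not_antiparallel_near [OF low low _ V nz]) (use s u in auto)
    next
      case 2
      then show ?thesis
        using \<sigma> \<tau> by (intro not_antiparallel_near [OF high high _ V nz]) (use s u in \<open>auto simp: mult_neg_neg\<close>)
    next
      case 3
      then have K: "(s, u, \<sigma>) \<in> ?K" "(s, u, \<tau>) \<in> ?K"
        using s u by auto
      have "dist (chord (G s) u \<sigma>) (chord (G s) u \<tau>) < \<mu>"
        using d(2) [OF K] c(2) by (simp add: dist_Pair_Pair dist_real_def)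
      then show ?thesis
        using antiparallel_norm_diff [of "chord (G s) u \<sigma>" "chord (G s) u \<tau>"] \<mu>(2) [OF K(1)] \<mu>(2) [OF K(2)] \<mu>(1)
        by (auto simp: dist_norm)
    qed
  qed
  show ?thesis
  proof (intro exI [of _ \<delta>] conjI ballI allI impI)
    show "\<delta> > 0"
      using \<eta>(1) d(1) by (simp add: \<delta>_def)
    fix s u \<tau> :: real assume s: "s \<in> {0..1}" and \<tau>: "0 < \<tau> \<and> \<tau> < 1"
    have f: "frac u \<in> {0..1}"
      using frac_lt_1 [of u] by simp
    show "\<not> antiparallel e3 (chord (G s) u \<tau>)" if "\<tau> < \<delta> \<or> 1 - \<delta> < \<tau>"
      using e3 [OF s f, of \<tau>] \<tau> that chord_frac [OF s, of u] by simp
    show "\<not> antiparallel (chord (G s) u \<sigma>) (chord (G s) u \<tau>)" if "0 < \<sigma> \<and> \<sigma> < 1 \<and> \<bar>\<sigma> - \<tau>\<bar> < \<delta>" for \<sigma>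
      using pair [OF s f, of \<tau> \<sigma>] \<tau> that chord_frac [OF s, of u] by simp
  qed
qed

end

text \<open>The chain consists of the chords at the \<open>N - 1\<close> interior grid points; in
  place of the vanishing chords at \<open>0\<close> and \<open>1\<close> it has the vertical vector
  built into \<open>hol\<close>.\<close>

definition knot_hol :: "(real \<Rightarrow> real ^ 3) \<Rightarrow> nat \<Rightarrow> real \<Rightarrow> complex" where
  "knot_hol \<gamma> N u = hol (\<lambda>i. chord \<gamma> u (real i / real N)) (N - 1)"

definition xy_velocity :: "(real \<Rightarrow> real ^ 3) \<Rightarrow> real \<Rightarrow> complex" where
  "xy_velocity \<gamma>' u = Complex (\<gamma>' u $ 1) (\<gamma>' u $ 2)"

section \<open>Homotopy invariance of the two winding numbers\<close>

context loop_family
begin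

lemma xy_velocity_nonzero: "s \<in> {0..1} \<Longrightarrow> xy_velocity (G' s) u \<noteq> 0"
proof
  assume s: "s \<in> {0..1}" "xy_velocity (G' s) u = 0"
  then have "G' s u $ 1 = 0" "G' s u $ 2 = 0" "G' s u $ 3 = 0"
    using contact [of s u] by (auto simp: xy_velocity_def complex_eq_iff)
  then have "G' s u = 0"
    by (simp add: vec_eq_iff forall_3)
  then show False
    using nz s by blast
qed

lemma has_wind_xy_velocity:
  assumes "has_wind (\<lambda>u. (xy_velocity (G' 0) u)\<^sup>2) n"
  shows "has_wind (\<lambda>u. (xy_velocity (G' 1) u)\<^sup>2) n"
proof -
  let ?F = "\<lambda>p. (xy_velocity (G' (fst p)) (snd p))\<^sup>2"
  have "has_wind (\<lambda>u. ?F (1, u)) n"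
  proof (rule has_wind_homotopic [of 0 1 ?F])
    show "continuous_on ({0..1} \<times> UNIV) ?F"
      unfolding xy_velocity_def Complex_eq by (intro continuous_intros cont')
    show "?F (s, u + 1) = ?F (s, u)" if "s \<in> {0..1}" for s u
      using periodic' [OF that] by (simp add: xy_velocity_def)
  qed (use assms xy_velocity_nonzero in auto)
  then show ?thesis by simp
qed

lemma has_wind_knot_hol:
  "\<exists>\<eta>>0. \<forall>N n. 1 / real N < \<eta> \<and> 2 \<le> N \<and> has_wind (knot_hol (G 0) N) n \<longrightarrow> has_wind (knot_hol (G 1) N) n"
proof -
  obtain \<eta> where \<eta>: "\<eta> > 0"
    "\<And>s u \<tau>. s \<in> {0..1} \<Longrightarrow> 0 < \<tau> \<Longrightarrow> \<tau> < 1 \<Longrightarrow> \<tau> < \<eta> \<or> 1 - \<eta> < \<tau> \<Longrightarrow> \<not> antiparallel e3 (chord (G s) u \<tau>)"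
    "\<And>s u \<tau> \<sigma>. s \<in> {0..1} \<Longrightarrow> 0 < \<tau> \<Longrightarrow> \<tau> < 1 \<Longrightarrow> 0 < \<sigma> \<Longrightarrow> \<sigma> < 1 \<Longrightarrow> \<bar>\<sigma> - \<tau>\<bar> < \<eta> \<Longrightarrow>
       \<not> antiparallel (chord (G s) u \<sigma>) (chord (G s) u \<tau>)"
    using chords_not_antiparallel by blast
  show ?thesis
  proof (intro exI [of _ \<eta>] conjI allI impI)
    fix N n assume *: "1 / real N < \<eta> \<and> 2 \<le> N \<and> has_wind (knot_hol (G 0) N) n"
    let ?F = "\<lambda>p. knot_hol (G (fst p)) N (snd p)"
    have "has_wind (\<lambda>u. ?F (1, u)) n"
    proof (rule has_wind_homotopic [of 0 1 ?F])
      show "continuous_on ({0..1} \<times> UNIV) ?F"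
        unfolding knot_hol_def
      proof (rule continuous_on_hol)
        fix i :: nat
        have "continuous_on ({0..1} \<times> UNIV) (\<lambda>p :: real \<times> real. (\<lambda>p. chord (G (fst p)) (fst (snd p)) (snd (snd p)))
            (fst p, snd p, real i / real N))"
          by (rule continuous_on_compose2 [OF continuous_on_chord]) (auto intro!: continuous_intros)
        then show "continuous_on ({0..1} \<times> UNIV) (\<lambda>p. chord (G (fst p)) (snd p) (real i / real N))"
          by simp
      qed
      show "?F (s, u + 1) = ?F (s, u)" if "s \<in> {0..1}" for s u
        using chord_periodic [OF that] by (simp add: knot_hol_def)
      show "?F (s, u) \<noteq> 0" if s: "s \<in> {0..1}" for s u
        unfolding knot_hol_def fst_conv snd_conv
      proof (rule hol_nonzero)
        show "\<not> antiparallel e3 (chord (G s) u (real 1 / real N))"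
          using * s by (intro \<eta>(2)) auto
        have "\<not> antiparallel e3 (chord (G s) u (real (N - 1) / real N))"
          using * s by (intro \<eta>(2)) (auto simp: field_simps of_nat_diff)
        then show "\<not> antiparallel (chord (G s) u (real (N - 1) / real N)) e3"
          by (simp add: antiparallel_commute)
        fix i assume i: "1 \<le> i" "i < N - 1"
        have "real (Suc i) < real N"
          using i by linarith
        moreover have "\<bar>real i / real N - real (Suc i) / real N\<bar> < \<eta>"
          using * by (simp add: diff_divide_distrib [symmetric])
        ultimately show "\<not> antiparallel (chord (G s) u (real i / real N)) (chord (G s) u (real (Suc i) / real N))"
          using i * s by (intro \<eta>(3)) auto
      qed (use * in auto)
    qed (use * in auto)
    then show "has_wind (knot_hol (G 1) N) n"
      by simp
  qed (rule \<eta>(1))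
qed

end

section \<open>Cusps of a Legendrian loop\<close>

text \<open>A bijection that commutes with the unit translation descends to the circle.
  \<open>{0..<1}\<close> is a fundamental domain, and \<open>frac\<close> brings the image back into
  it.\<close>

lemma card_periodic_bij:
  fixes h :: "real \<Rightarrow> real"
  assumes bij: "bij_betw h W C" and h: "\<And>u. u \<in> W \<Longrightarrow> h (u + 1) = h u + 1"
    and W: "\<And>u. u + 1 \<in> W \<longleftrightarrow> u \<in> W" and C: "\<And>c. c + 1 \<in> C \<longleftrightarrow> c \<in> C"
  shows "card (W \<inter> {0..<1}) = card (C \<inter> {0..<1})"
proof -
  have Wk: "u + of_int k \<in> W \<longleftrightarrow> u \<in> W" for u k
    using periodic_of_int [of "\<lambda>u. u \<in> W"] W by simp
  have Ck: "c + of_int k \<in> C \<longleftrightarrow> c \<in> C" for c k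
    using periodic_of_int [of "\<lambda>c. c \<in> C"] C by simp
  have hk: "h (u + of_int k) = h u + of_int k" if "u \<in> W" for u k
  proof (induction k rule: int_induct [of _ 0])
    case (step1 i)
    then show ?case
      using h [of "u + of_int i"] Wk [of u i] that by (simp add: add.assoc)
  next
    case (step2 i)
    then show ?case
      using h [of "u + of_int (i - 1)"] Wk [of u "i - 1"] that by (simp add: algebra_simps)
  qed auto
  have "bij_betw (\<lambda>u. frac (h u)) (W \<inter> {0..<1}) (C \<inter> {0..<1})"
  proof (rule bij_betwI')
    fix u v assume u: "u \<in> W \<inter> {0..<1}" and v: "v \<in> W \<inter> {0..<1}"
    show "frac (h u) = frac (h v) \<longleftrightarrow> u = v"
    proof
      assume "frac (h u) = frac (h v)"
      moreover define k where "k = \<lfloor>h u\<rfloor> - \<lfloor>h v\<rfloor>"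
      ultimately have "h u = h v + of_int k"
        by (simp add: frac_def)
      also have "\<dots> = h (v + of_int k)"
        using v by (simp only: hk Int_iff)
      finally have "h u = h (v + of_int k)" .
      moreover have "inj_on h W"
        using bij by (rule bij_betw_imp_inj_on)
      moreover have "u \<in> W" "v + of_int k \<in> W"
        using u v Wk by blast+
      ultimately have uv: "u = v + of_int k"
        unfolding inj_on_def by blast
      have "k = 0"
      proof -
        have "0 \<le> u" "u < 1" "0 \<le> v" "v < 1"
          using u v by auto
        then have "\<bar>real_of_int k\<bar> < 1"
          using uv by linarith
        then show ?thesis
          by linarith
      qed
      with uv show "u = v"
        by simp
    qed auto
  next
    fix u assume u: "u \<in> W \<inter> {0..<1}"
    then have "h u \<in> C"
      using bij by (auto simp: bij_betw_def)
    then have "frac (h u) \<in> C"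
      using Ck [of "frac (h u)" "\<lfloor>h u\<rfloor>"] by (simp add: frac_def)
    then show "frac (h u) \<in> C \<inter> {0..<1}"
      by (simp add: frac_lt_1)
  next
    fix c assume c: "c \<in> C \<inter> {0..<1}"
    then obtain u where u: "u \<in> W" "h u = c"
      using bij by (auto simp: bij_betw_def)
    have f: "frac u \<in> W"
      using u(1) Wk [of "frac u" "\<lfloor>u\<rfloor>"] by (simp add: frac_def)
    have "h (frac u) + of_int \<lfloor>u\<rfloor> = c"
      using hk [OF f, of "\<lfloor>u\<rfloor>"] u(2) by (simp add: frac_def)
    then have "frac (h (frac u) + of_int \<lfloor>u\<rfloor>) = c"
      using c by (simp add: frac_eq)
    then have "c = frac (h (frac u))"
      by (simp add: frac_def)
    then show "\<exists>u\<in>W \<inter> {0..<1}. c = frac (h u)"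
      using f frac_lt_1 [of u] by auto
  qed
  then show ?thesis
    by (rule bij_betw_same_card)
qed

lemma vector_derivative_front:
  assumes "(\<gamma> has_vector_derivative v) (at t)"
  shows "vector_derivative (front \<gamma>) (at t) = (v $ 1, v $ 3)"
proof (rule vector_derivative_at)
  show "(front \<gamma> has_vector_derivative (v $ 1, v $ 3)) (at t)"
    unfolding front_def
    by (intro has_vector_derivative_Pair bounded_linear.has_vector_derivative [OF bounded_linear_vec_nth] assms)
qed

locale generic_loop =
  fixes \<gamma> \<gamma>' \<gamma>'' :: "real \<Rightarrow> real ^ 3"
  assumes has_derivative1: "\<And>t. (\<gamma> has_vector_derivative \<gamma>' t) (at t)"
    and has_derivative2: "\<And>t. (\<gamma>' has_vector_derivative \<gamma>'' t) (at t)"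
    and continuous2: "continuous_on UNIV \<gamma>''"
    and closed: "\<And>s t. \<gamma> s = \<gamma> t \<longleftrightarrow> s - t \<in> \<int>"
    and immersed: "\<And>t. \<gamma>' t \<noteq> 0"
    and legendrian: "\<And>t. \<gamma>' t $ 3 = \<gamma> t $ 2 * \<gamma>' t $ 1"
    and cusp_nondeg: "\<And>t. \<gamma>' t $ 1 = 0 \<Longrightarrow> \<gamma>'' t $ 1 \<noteq> 0"
    and finite_cusps: "finite {t \<in> {0..<1}. \<gamma>' t $ 1 = 0}"
begin

lemma continuous0: "continuous_on S \<gamma>"
  using has_derivative1 by (meson continuous_at_imp_continuous_on has_vector_derivative_continuous)

lemma continuous1: "continuous_on S \<gamma>'"
  using has_derivative2 by (meson continuous_at_imp_continuous_on has_vector_derivative_continuous)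

text \<open>A single loop as a constant family, which makes the results on periodicity and on chords
  available for it.\<close>

sublocale loop_family "\<lambda>_. \<gamma>" "\<lambda>_. \<gamma>'"
proof
  show "continuous_on ({0..1} \<times> UNIV) (\<lambda>p::real \<times> real. \<gamma> (snd p))"
    by (rule continuous_on_compose2 [OF continuous0 [of UNIV]]) (auto intro!: continuous_intros)
  show "continuous_on ({0..1} \<times> UNIV) (\<lambda>p::real \<times> real. \<gamma>' (snd p))"
    by (rule continuous_on_compose2 [OF continuous1 [of UNIV]]) (auto intro!: continuous_intros)
qed (use has_derivative1 closed immersed legendrian in auto)

lemma period: "\<gamma> (t + 1) = \<gamma> t"
  using closed by simp

lemma period': "\<gamma>' (t + 1) = \<gamma>' t"
  using periodic' [of 0] by simp

lemma period'': "\<gamma>'' (t + 1) = \<gamma>'' t"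
proof -
  have "((\<lambda>t. t + 1) has_vector_derivative 1) (at t)"
    by (auto intro!: derivative_eq_intros)
  from vector_diff_chain_at [OF this has_derivative2]
  have "(\<gamma>' has_vector_derivative \<gamma>'' (t + 1)) (at t)"
    by (simp add: o_def period')
  then show ?thesis
    using has_derivative2 [of t] by (rule vector_derivative_unique_at)
qed

lemma DERIV_nth: "((\<lambda>t. \<gamma> t $ i) has_real_derivative \<gamma>' t $ i) (at t)"
  using bounded_linear.has_vector_derivative [OF bounded_linear_vec_nth has_derivative1]
  by (simp add: has_real_derivative_iff_has_vector_derivative)

lemma DERIV_nth': "((\<lambda>t. \<gamma>' t $ i) has_real_derivative \<gamma>'' t $ i) (at t)"
  using bounded_linear.has_vector_derivative [OF bounded_linear_vec_nth has_derivative2]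
  by (simp add: has_real_derivative_iff_has_vector_derivative)

lemma cusp_slope_change: "\<gamma>' t $ 1 = 0 \<Longrightarrow> \<gamma>' t $ 2 \<noteq> 0"
  using xy_velocity_nonzero [of 0 t] by (auto simp: xy_velocity_def complex_eq_iff)

text \<open>The products with the values at \<open>c\<close> express constancy of sign, so that left
  and right, up and down cusps need not be distinguished; the estimates near a cusp are scaled in
  the same way.\<close>

definition cusp_nbhd :: "real \<Rightarrow> real \<Rightarrow> bool" where
  "cusp_nbhd c e \<longleftrightarrow> e > 0 \<and> (\<forall>t. \<bar>t - c\<bar> < e \<longrightarrow> \<gamma>'' c $ 1 * \<gamma>'' t $ 1 > 0 \<and> \<gamma>' c $ 2 * \<gamma>' t $ 2 > 0)"

lemma cusp_nbhd_ex:
  assumes "\<gamma>' c $ 1 = 0"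
  shows "\<exists>e. cusp_nbhd c e"
proof -
  have nbhd: "\<exists>e>0. \<forall>t. \<bar>t - c\<bar> < e \<longrightarrow> f c * f t > 0" if "continuous_on UNIV f" "f c \<noteq> 0" for f :: "real \<Rightarrow> real"
  proof -
    have "isCont (\<lambda>t. f c * f t) c"
      using that(1) by (auto simp: continuous_on_eq_continuous_at intro!: continuous_intros)
    moreover have "f c * f c > 0"
      using that(2) by (metis not_real_square_gt_zero)
    ultimately obtain e where "e > 0" "\<And>t. \<bar>t - c\<bar> < e \<Longrightarrow> \<bar>f c * f t - f c * f c\<bar> < f c * f c"
      unfolding continuous_at_eps_delta dist_real_def by metis
    then show ?thesis
      by (intro exI [of _ e]) (auto simp: abs_less_iff)
  qed
  obtain e1 where e1: "e1 > 0" "\<And>t. \<bar>t - c\<bar> < e1 \<Longrightarrow> \<gamma>'' c $ 1 * \<gamma>'' t $ 1 > 0"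
    using nbhd [of "\<lambda>t. \<gamma>'' t $ 1"] cusp_nondeg [OF assms] continuous2 by (auto intro!: continuous_intros)
  obtain e2 where e2: "e2 > 0" "\<And>t. \<bar>t - c\<bar> < e2 \<Longrightarrow> \<gamma>' c $ 2 * \<gamma>' t $ 2 > 0"
    using nbhd [of "\<lambda>t. \<gamma>' t $ 2"] cusp_slope_change [OF assms] continuous1 by (auto intro!: continuous_intros)
  show ?thesis
    using e1 e2 by (intro exI [of _ "min e1 e2"]) (auto simp: cusp_nbhd_def)
qed

lemma cusp_nbhd_mono: "cusp_nbhd c e \<Longrightarrow> 0 < d \<Longrightarrow> d \<le> e \<Longrightarrow> cusp_nbhd c d"
  by (auto simp: cusp_nbhd_def)

lemma cusp_nbhd_shift: "cusp_nbhd (c + 1) e \<longleftrightarrow> cusp_nbhd c e"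
proof -
  have "(\<forall>t. P t) \<longleftrightarrow> (\<forall>t. P (t + 1))" for P :: "real \<Rightarrow> bool"
    by (metis diff_add_cancel)
  from this [of "\<lambda>t. \<bar>t - (c + 1)\<bar> < e \<longrightarrow> \<gamma>'' (c + 1) $ 1 * \<gamma>'' t $ 1 > 0 \<and> \<gamma>' (c + 1) $ 2 * \<gamma>' t $ 2 > 0"]
  show ?thesis
    by (simp add: cusp_nbhd_def period' period'')
qed

lemma cusp_nbhd_uniform: "\<exists>e. e > 0 \<and> (\<forall>c. \<gamma>' c $ 1 = 0 \<longrightarrow> cusp_nbhd c e)"
proof -
  let ?C = "{t \<in> {0..<1}. \<gamma>' t $ 1 = 0}"
  obtain E where E: "\<And>c. \<gamma>' c $ 1 = 0 \<Longrightarrow> cusp_nbhd c (E c)"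
    using cusp_nbhd_ex by metis
  define e where "e = Min (insert 1 (E ` ?C))"
  have "e > 0"
    using finite_cusps E by (auto simp: e_def cusp_nbhd_def)
  have "cusp_nbhd c e" if c: "\<gamma>' c $ 1 = 0" for c
  proof -
    have "\<gamma>' (frac c) $ 1 = 0"
      using c periodic_Ints [of \<gamma>' c "frac c"] period' by (simp add: frac_def)
    then have "frac c \<in> ?C"
      by (simp add: frac_lt_1)
    then have "cusp_nbhd (frac c) e"
    proof (intro cusp_nbhd_mono [OF E])
      show "e \<le> E (frac c)"
        unfolding e_def using finite_cusps \<open>frac c \<in> ?C\<close> by (intro Min_le) auto
    qed (use \<open>e > 0\<close> \<open>frac c \<in> ?C\<close> in auto)
    then show ?thesis
      using periodic_Ints [of "\<lambda>c. cusp_nbhd c e" c "frac c"] cusp_nbhd_shift by (simp add: frac_def)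
  qed
  with \<open>e > 0\<close> show ?thesis by blast
qed

context
  fixes c e
  assumes c: "\<gamma>' c $ 1 = 0" and nb: "cusp_nbhd c e"
begin

private lemma nb': "\<bar>t - c\<bar> < e \<Longrightarrow> \<gamma>'' c $ 1 * \<gamma>'' t $ 1 > 0 \<and> \<gamma>' c $ 2 * \<gamma>' t $ 2 > 0"
  using nb by (simp add: cusp_nbhd_def)

lemma near_cusp_x':
  assumes "r < s" "c - e < r" "s < c + e"
  shows "\<gamma>'' c $ 1 * \<gamma>' r $ 1 < \<gamma>'' c $ 1 * \<gamma>' s $ 1"
proof (rule DERIV_pos_imp_increasing [OF assms(1)])
  fix t assume "r \<le> t" "t \<le> s"
  then show "\<exists>y. ((\<lambda>t. \<gamma>'' c $ 1 * \<gamma>' t $ 1) has_real_derivative y) (at t) \<and> y > 0"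
    using nb' [of t] assms by (intro exI [of _ "\<gamma>'' c $ 1 * \<gamma>'' t $ 1"]) (auto intro!: DERIV_cmult DERIV_nth')
qed

lemma near_cusp_x'_left: "c - e < t \<Longrightarrow> t < c \<Longrightarrow> \<gamma>'' c $ 1 * \<gamma>' t $ 1 < 0"
  using near_cusp_x' [of t c] nb c by (simp add: cusp_nbhd_def)

lemma near_cusp_x'_right: "c < t \<Longrightarrow> t < c + e \<Longrightarrow> \<gamma>'' c $ 1 * \<gamma>' t $ 1 > 0"
  using near_cusp_x' [of c t] nb c by (simp add: cusp_nbhd_def)

lemma near_cusp_y:
  assumes "r < s" "c - e < r" "s < c + e"
  shows "\<gamma>' c $ 2 * \<gamma> r $ 2 < \<gamma>' c $ 2 * \<gamma> s $ 2"
proof (rule DERIV_pos_imp_increasing [OF assms(1)])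
  fix t assume "r \<le> t" "t \<le> s"
  then show "\<exists>y. ((\<lambda>t. \<gamma>' c $ 2 * \<gamma> t $ 2) has_real_derivative y) (at t) \<and> y > 0"
    using nb' [of t] assms by (intro exI [of _ "\<gamma>' c $ 2 * \<gamma>' t $ 2"]) (auto intro!: DERIV_cmult DERIV_nth)
qed

lemma near_cusp_x_right:
  assumes "r < s" "c \<le> r" "s < c + e"
  shows "\<gamma>'' c $ 1 * \<gamma> r $ 1 < \<gamma>'' c $ 1 * \<gamma> s $ 1"
proof (rule DERIV_pos_imp_increasing_open [OF assms(1)])
  fix t assume "r < t" "t < s"
  then show "\<exists>y. ((\<lambda>t. \<gamma>'' c $ 1 * \<gamma> t $ 1) has_real_derivative y) (at t) \<and> y > 0"
    using near_cusp_x'_right [of t] assms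
    by (intro exI [of _ "\<gamma>'' c $ 1 * \<gamma>' t $ 1"]) (auto intro!: DERIV_cmult DERIV_nth)
qed (intro continuous_intros continuous0)

lemma near_cusp_x_left:
  assumes "r < s" "c - e < r" "s \<le> c"
  shows "\<gamma>'' c $ 1 * \<gamma> s $ 1 < \<gamma>'' c $ 1 * \<gamma> r $ 1"
proof (rule DERIV_neg_imp_decreasing_open [OF assms(1)])
  fix t assume "r < t" "t < s"
  then show "\<exists>y. ((\<lambda>t. \<gamma>'' c $ 1 * \<gamma> t $ 1) has_real_derivative y) (at t) \<and> y < 0"
    using near_cusp_x'_left [of t] assms
    by (intro exI [of _ "\<gamma>'' c $ 1 * \<gamma>' t $ 1"]) (auto intro!: DERIV_cmult DERIV_nth)
qed (intro continuous_intros continuous0)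

text \<open>The shear \<open>z - y(c) x\<close> makes the tangent at the cusp horizontal, so that it becomes monotone.\<close>

lemma near_cusp_z:
  assumes "r < c" "c < s" "c - e < r" "s < c + e" "\<gamma> r $ 1 = \<gamma> s $ 1"
  shows "\<gamma>'' c $ 1 * \<gamma>' c $ 2 * \<gamma> r $ 3 < \<gamma>'' c $ 1 * \<gamma>' c $ 2 * \<gamma> s $ 3"
proof -
  let ?k = "\<gamma>'' c $ 1 * \<gamma>' c $ 2"
  let ?f = "\<lambda>t. ?k * (\<gamma> t $ 3 - \<gamma> c $ 2 * \<gamma> t $ 1)"
  have deriv: "(?f has_real_derivative (\<gamma>'' c $ 1 * \<gamma>' t $ 1) * (\<gamma>' c $ 2 * \<gamma> t $ 2 - \<gamma>' c $ 2 * \<gamma> c $ 2)) (at t)" for t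
    by (rule derivative_eq_intros DERIV_nth refl)+ (simp add: legendrian algebra_simps)
  have cont: "continuous_on S ?f" for S
    by (intro continuous_intros continuous0)
  have "?f r < ?f c"
  proof (rule DERIV_pos_imp_increasing_open [OF assms(1) _ cont])
    fix t assume t: "r < t" "t < c"
    show "\<exists>y. (?f has_real_derivative y) (at t) \<and> y > 0"
      by (rule exI, rule conjI, rule deriv, rule mult_neg_neg)
        (use t assms near_cusp_x'_left [of t] near_cusp_y [of t c] in auto)
  qed
  also have "?f c < ?f s"
  proof (rule DERIV_pos_imp_increasing_open [OF assms(2) _ cont])
    fix t assume t: "c < t" "t < s"
    show "\<exists>y. (?f has_real_derivative y) (at t) \<and> y > 0"
      by (rule exI, rule conjI, rule deriv, rule mult_pos_pos)
        (use t assms near_cusp_x'_right [of t] near_cusp_y [of c t] in auto)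
  qed
  finally show ?thesis
    using assms(5) by (simp add: algebra_simps)
qed

text \<open>The cusp is a strict local extremum of \<open>x\<close>, so the chord ending at it and
  the chord starting at it have horizontal displacements of opposite sign.\<close>

lemma near_cusp_chord_ex:
  assumes "0 < \<delta>" "\<delta> < e"
  shows "\<exists>u. c - \<delta> < u \<and> u < c \<and> \<gamma> (u + \<delta>) $ 1 = \<gamma> u $ 1"
proof -
  let ?f = "\<lambda>u. \<gamma>'' c $ 1 * (\<gamma> (u + \<delta>) $ 1 - \<gamma> u $ 1)"
  have "?f (c - \<delta>) < 0" "?f c > 0"
    using near_cusp_x_left [of "c - \<delta>" c] near_cusp_x_right [of c "c + \<delta>"] assms
    by (auto simp: right_diff_distrib)
  moreover have "continuous_on {c - \<delta>..c} ?f"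
    by (intro continuous_intros continuous_on_compose2 [OF continuous0 [of UNIV]]) auto
  ultimately obtain u where u: "c - \<delta> \<le> u" "u \<le> c" "?f u = 0"
    using IVT' [of ?f "c - \<delta>" 0 c] assms by auto
  then have "u \<noteq> c" "u \<noteq> c - \<delta>"
    using \<open>?f (c - \<delta>) < 0\<close> \<open>?f c > 0\<close> by auto
  with u show ?thesis
    using cusp_nondeg [OF c] by (intro exI [of _ u]) auto
qed

text \<open>The two ends move on different branches of the cusp, on which \<open>x\<close> is
  monotone in opposite directions; in the difference the two changes add up.\<close>

lemma near_cusp_chord_mono:
  assumes "\<delta> < e" "c - \<delta> \<le> u" "u < v" "v \<le> c"
  shows "\<gamma>'' c $ 1 * (\<gamma> (u + \<delta>) $ 1 - \<gamma> u $ 1) < \<gamma>'' c $ 1 * (\<gamma> (v + \<delta>) $ 1 - \<gamma> v $ 1)"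
  using near_cusp_x_left [of u v] near_cusp_x_right [of "u + \<delta>" "v + \<delta>"] assms
  by (simp add: right_diff_distrib)

end

lemma cusp_iff: "cusp \<gamma> t \<longleftrightarrow> \<gamma>' t $ 1 = 0"
  using vector_derivative_front [OF has_derivative1, of t] legendrian [of t]
  by (auto simp: cusp_def zero_prod_def)

lemma up_down_cusp_iff:
  "up_cusp \<gamma> t \<longleftrightarrow> \<gamma>' t $ 1 = 0 \<and> \<gamma>'' t $ 1 * \<gamma>' t $ 2 > 0"
  "down_cusp \<gamma> t \<longleftrightarrow> \<gamma>' t $ 1 = 0 \<and> \<gamma>'' t $ 1 * \<gamma>' t $ 2 < 0"
proof -
  let ?k = "\<gamma>'' t $ 1 * \<gamma>' t $ 2"
  have *: "(up_cusp \<gamma> t \<longleftrightarrow> ?k > 0) \<and> (down_cusp \<gamma> t \<longleftrightarrow> ?k < 0)" if c: "\<gamma>' t $ 1 = 0"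
  proof -
    obtain e where e: "cusp_nbhd t e"
      using cusp_nbhd_ex [OF c] by blast
    have "?k \<noteq> 0"
      using cusp_nondeg [OF c] cusp_slope_change [OF c] by simp
    have "e > 0"
      using e by (simp add: cusp_nbhd_def)
    \<comment> \<open>The definitions of up and down cusps quantify universally over points of the
      two branches above the same \<open>x\<close>. Such pairs exist arbitrarily close to the cusp,
      so neither definition holds vacuously and they exclude each other.\<close>
    have pair: "\<exists>r s. t - \<epsilon> < r \<and> r < t \<and> t < s \<and> s < t + \<epsilon> \<and> \<gamma> r $ 1 = \<gamma> s $ 1 \<and> ?k * \<gamma> r $ 3 < ?k * \<gamma> s $ 3"
      if "\<epsilon> > 0" for \<epsilon>
    proof -
      define \<delta> where "\<delta> = min \<epsilon> e / 2"
      have \<delta>: "0 < \<delta>" "\<delta> < e" "\<delta> < \<epsilon>"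
        using that \<open>e > 0\<close> by (auto simp: \<delta>_def)
      obtain u where u: "t - \<delta> < u" "u < t" "\<gamma> (u + \<delta>) $ 1 = \<gamma> u $ 1"
        using near_cusp_chord_ex [OF c e \<delta>(1,2)] by blast
      then show ?thesis
        using near_cusp_z [OF c e, of u "u + \<delta>"] \<delta> by (intro exI [of _ u] exI [of _ "u + \<delta>"]) auto
    qed
    have all: "?k * \<gamma> r $ 3 < ?k * \<gamma> s $ 3"
      if "t - e < r \<and> r < t \<and> t < s \<and> s < t + e \<and> \<gamma> r $ 1 = \<gamma> s $ 1" for r s
      using near_cusp_z [OF c e, of r s] that by auto
    show ?thesis
    proof (cases "?k > 0")
      case True
      then have "\<gamma> r $ 3 < \<gamma> s $ 3"
        if "t - e < r \<and> r < t \<and> t < s \<and> s < t + e \<and> \<gamma> r $ 1 = \<gamma> s $ 1" for r s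
        using all [OF that] by (simp add: mult_less_cancel_left_pos)
      then have "up_cusp \<gamma> t"
        using c \<open>e > 0\<close> unfolding up_cusp_def cusp_iff by blast
      moreover have "\<not> down_cusp \<gamma> t"
      proof
        assume "down_cusp \<gamma> t"
        then obtain \<epsilon> where "\<epsilon> > 0" "\<And>r s. t - \<epsilon> < r \<and> r < t \<and> t < s \<and> s < t + \<epsilon> \<and> \<gamma> r $ 1 = \<gamma> s $ 1 \<Longrightarrow> \<gamma> r $ 3 > \<gamma> s $ 3"
          unfolding down_cusp_def by blast
        then show False
          using pair [of \<epsilon>] True by (metis mult_less_cancel_left_pos not_less_iff_gr_or_eq)
      qed
      ultimately show ?thesis
        using True by simp
    next
      case False
      then have neg: "?k < 0"
        using \<open>?k \<noteq> 0\<close> by linarith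
      then have "\<gamma> r $ 3 > \<gamma> s $ 3"
        if "t - e < r \<and> r < t \<and> t < s \<and> s < t + e \<and> \<gamma> r $ 1 = \<gamma> s $ 1" for r s
        using all [OF that] by (simp add: mult_less_cancel_left_neg)
      then have "down_cusp \<gamma> t"
        using c \<open>e > 0\<close> unfolding down_cusp_def cusp_iff by blast
      moreover have "\<not> up_cusp \<gamma> t"
      proof
        assume "up_cusp \<gamma> t"
        then obtain \<epsilon> where "\<epsilon> > 0" "\<And>r s. t - \<epsilon> < r \<and> r < t \<and> t < s \<and> s < t + \<epsilon> \<and> \<gamma> r $ 1 = \<gamma> s $ 1 \<Longrightarrow> \<gamma> r $ 3 < \<gamma> s $ 3"
          unfolding up_cusp_def by blast
        then show False
          using pair [of \<epsilon>] neg by (metis mult_less_cancel_left_neg not_less_iff_gr_or_eq)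
      qed
      ultimately show ?thesis
        using neg by simp
    qed
  qed
  have "\<gamma>' t $ 1 = 0" if "up_cusp \<gamma> t \<or> down_cusp \<gamma> t"
    using that by (auto simp: up_cusp_def down_cusp_def cusp_iff)
  with * show "up_cusp \<gamma> t \<longleftrightarrow> \<gamma>' t $ 1 = 0 \<and> \<gamma>'' t $ 1 * \<gamma>' t $ 2 > 0"
    "down_cusp \<gamma> t \<longleftrightarrow> \<gamma>' t $ 1 = 0 \<and> \<gamma>'' t $ 1 * \<gamma>' t $ 2 < 0"
    by blast+
qed

end

lemma Re_Complex_square: "Re ((Complex a b)\<^sup>2) = a\<^sup>2 - b\<^sup>2" "Im ((Complex a b)\<^sup>2) = 2 * a * b"
  by (simp_all add: power2_eq_square)

lemma sum_of_signs:
  assumes "finite A" and "\<And>x. x \<in> A \<Longrightarrow> P x \<noteq> Q x"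
  shows "(\<Sum>x\<in>A. if P x then 1 else -1 :: int) = int (card {x \<in> A. P x}) - int (card {x \<in> A. Q x})"
proof -
  have "A - {x \<in> A. P x} = {x \<in> A. Q x}" "A \<inter> {x. P x} = {x \<in> A. P x}" "A \<inter> - {x. P x} = {x \<in> A. Q x}"
    using assms(2) by auto
  then show ?thesis
    using assms(1) by (simp add: sum.If_cases)
qed

text \<open>The square of \<open>norm D\<close> is \<open>Y^2 + Z^2\<close>, that of
  \<open>Y - Z\<close> has the additional term \<open>- 2 Y Z\<close>. This locates the visits to
  the negative real axis of the two end factors of the chain.\<close>

lemma norm_le_difference_iff:
  fixes D :: "real ^ 3"
  assumes "D $ 1 = 0" and "D $ 2 \<noteq> 0" and "D $ 3 \<noteq> 0" and "\<kappa> = 1 \<or> \<kappa> = - (1::real)"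
  shows "norm D \<le> \<kappa> * (D $ 2 - D $ 3) \<longleftrightarrow> \<kappa> * D $ 2 > 0 \<and> \<kappa> * D $ 3 < 0"
    and "norm D \<noteq> \<kappa> * (D $ 2 - D $ 3)"
proof -
  define Y where "Y = \<kappa> * D $ 2"
  define Z where "Z = \<kappa> * D $ 3"
  have YZ: "\<kappa> * (D $ 2 - D $ 3) = Y - Z" "Y \<noteq> 0" "Z \<noteq> 0"
    using assms by (auto simp: Y_def Z_def algebra_simps)
  have n: "(norm D)\<^sup>2 = Y\<^sup>2 + Z\<^sup>2"
    using assms norm_squared_vec3 [of D] by (auto simp: Y_def Z_def power_mult_distrib)
  have "\<bar>Y\<bar> < norm D" "\<bar>Z\<bar> < norm D"
    using n YZ by (auto intro!: power2_less_imp_less [of _ "norm D"])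
  moreover have "norm D < Y - Z" if "Y > 0" "Z < 0"
  proof (rule power2_less_imp_less)
    show "(norm D)\<^sup>2 < (Y - Z)\<^sup>2"
      using n mult_pos_neg [OF that] by (simp add: power2_eq_square algebra_simps)
  qed (use that in auto)
  ultimately show "norm D \<le> \<kappa> * (D $ 2 - D $ 3) \<longleftrightarrow> \<kappa> * D $ 2 > 0 \<and> \<kappa> * D $ 3 < 0"
    "norm D \<noteq> \<kappa> * (D $ 2 - D $ 3)"
    unfolding YZ(1) Y_def [symmetric] Z_def [symmetric] using YZ(2,3) by (auto simp: not_less less_le) 
qed

section \<open>Cusps as crossings of the negative real axis\<close>

context generic_loop
begin

text \<open>The imaginary part of the square is \<open>2 x' y'\<close>, so the negative real axis is
  met exactly where \<open>x' = 0\<close>. There \<open>x' y'\<close> passes through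
  \<open>0\<close> in the direction given by the sign of \<open>x'' y'\<close>, which makes down
  cusps the counterclockwise crossings.\<close>

lemma wind_xy_velocity:
  assumes "has_wind (\<lambda>u. (xy_velocity \<gamma>' u)\<^sup>2) n"
  shows "n = int (card {t \<in> {0..<1}. down_cusp \<gamma> t}) - int (card {t \<in> {0..<1}. up_cusp \<gamma> t})"
proof -
  let ?f = "\<lambda>u. (xy_velocity \<gamma>' u)\<^sup>2"
  let ?\<sigma> = "\<lambda>u. if \<gamma>'' u $ 1 * \<gamma>' u $ 2 < 0 then 1 else -1 :: int"
  have Re_Im: "Re (?f u) = (\<gamma>' u $ 1)\<^sup>2 - (\<gamma>' u $ 2)\<^sup>2" "Im (?f u) = 2 * \<gamma>' u $ 1 * \<gamma>' u $ 2" for u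
    by (simp_all add: xy_velocity_def Re_Complex_square)
  have iff: "?f u \<in> \<real>\<^sub>\<le>\<^sub>0 \<longleftrightarrow> \<gamma>' u $ 1 = 0" for u
    unfolding complex_nonpos_Reals_iff Re_Im by auto
  have nz: "\<gamma>'' u $ 1 * \<gamma>' u $ 2 \<noteq> 0" if "\<gamma>' u $ 1 = 0" for u
    using cusp_nondeg [OF that] cusp_slope_change [OF that] by simp
  have "n = (\<Sum>u\<in>{u \<in> {0..<1}. ?f u \<in> \<real>\<^sub>\<le>\<^sub>0}. ?\<sigma> u)"
  proof (rule has_wind_crossings [OF assms], intro conjI)
    fix u assume "?f u \<in> \<real>\<^sub>\<le>\<^sub>0"
    then have u: "\<gamma>' u $ 1 = 0"
      by (simp add: iff)
    obtain e where e: "cusp_nbhd u e"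
      using cusp_nbhd_ex [OF u] by blast
    have "of_int (?\<sigma> u) * Im (?f r) > 0 \<and> of_int (?\<sigma> u) * Im (?f s) < 0"
      if "u - e < r \<and> r < u \<and> u < s \<and> s < u + e" for r s
    proof -
      have "\<gamma>'' u $ 1 * \<gamma>' r $ 1 < 0" "\<gamma>' u $ 2 * \<gamma>' r $ 2 > 0" "\<gamma>'' u $ 1 * \<gamma>' s $ 1 > 0" "\<gamma>' u $ 2 * \<gamma>' s $ 2 > 0"
        using near_cusp_x'_left [OF u e, of r] near_cusp_x'_right [OF u e, of s] e that by (auto simp: cusp_nbhd_def)
      then have "(\<gamma>'' u $ 1 * \<gamma>' r $ 1) * (\<gamma>' u $ 2 * \<gamma>' r $ 2) < 0"
          "(\<gamma>'' u $ 1 * \<gamma>' s $ 1) * (\<gamma>' u $ 2 * \<gamma>' s $ 2) > 0"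
        by (blast intro: mult_neg_pos mult_pos_pos)+
      then have signs: "(\<gamma>'' u $ 1 * \<gamma>' u $ 2) * (\<gamma>' r $ 1 * \<gamma>' r $ 2) < 0"
          "(\<gamma>'' u $ 1 * \<gamma>' u $ 2) * (\<gamma>' s $ 1 * \<gamma>' s $ 2) > 0"
        by (simp_all only: mult_ac)
      show ?thesis
      proof (cases "\<gamma>'' u $ 1 * \<gamma>' u $ 2 < 0")
        case True
        then have "\<gamma>' r $ 1 * \<gamma>' r $ 2 > 0" "\<gamma>' s $ 1 * \<gamma>' s $ 2 < 0"
          using signs by (simp_all only: mult_less_0_iff [of "\<gamma>'' u $ 1 * \<gamma>' u $ 2"]
              zero_less_mult_iff [of "\<gamma>'' u $ 1 * \<gamma>' u $ 2"]) linarith+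
        then show ?thesis
          unfolding Re_Im using True by (simp add: mult.assoc)
      next
        case False
        then have "\<gamma>' r $ 1 * \<gamma>' r $ 2 < 0" "\<gamma>' s $ 1 * \<gamma>' s $ 2 > 0"
          using signs by (simp_all only: mult_less_0_iff [of "\<gamma>'' u $ 1 * \<gamma>' u $ 2"]
              zero_less_mult_iff [of "\<gamma>'' u $ 1 * \<gamma>' u $ 2"]) blast+
        then show ?thesis
          unfolding Re_Im using False by (simp add: mult.assoc)
      qed
    qed
    then show "\<exists>e>0. \<forall>r s. u - e < r \<and> r < u \<and> u < s \<and> s < u + e \<longrightarrow>
           of_int (?\<sigma> u) * Im (?f r) > 0 \<and> of_int (?\<sigma> u) * Im (?f s) < 0"
      using e unfolding cusp_nbhd_def by blast
  qed auto
  also have "\<dots> = (\<Sum>u\<in>{u \<in> {0..<1}. \<gamma>' u $ 1 = 0}. ?\<sigma> u)"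
    unfolding iff ..
  also have "\<dots> = int (card {u \<in> {u \<in> {0..<1}. \<gamma>' u $ 1 = 0}. \<gamma>'' u $ 1 * \<gamma>' u $ 2 < 0})
      - int (card {u \<in> {u \<in> {0..<1}. \<gamma>' u $ 1 = 0}. \<gamma>'' u $ 1 * \<gamma>' u $ 2 > 0})"
  proof (rule sum_of_signs [OF finite_cusps])
    fix u assume "u \<in> {u \<in> {0..<1}. \<gamma>' u $ 1 = 0}"
    then show "(\<gamma>'' u $ 1 * \<gamma>' u $ 2 < 0) \<noteq> (\<gamma>'' u $ 1 * \<gamma>' u $ 2 > 0)"
      using nz [of u] by (simp only: mem_Collect_eq) linarith
  qed
  finally show ?thesis
    unfolding up_down_cusp_iff by (simp only: mem_Collect_eq conj_assoc)
qed

text \<open>The indicator of \<open>x' > 0\<close> is periodic. It rises at left cusps, where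
  \<open>x'' > 0\<close>, and falls at right cusps, where \<open>x'' < 0\<close>.\<close>

lemma card_left_right_cusps:
  "card {t \<in> {0..<1}. \<gamma>' t $ 1 = 0 \<and> \<gamma>'' t $ 1 > 0} = card {t \<in> {0..<1}. \<gamma>' t $ 1 = 0 \<and> \<gamma>'' t $ 1 < 0}"
proof -
  let ?k = "\<lambda>u. if \<gamma>' u $ 1 > 0 then 1 else 0 :: int"
  let ?j = "\<lambda>u. if \<gamma>' u $ 1 = 0 then if \<gamma>'' u $ 1 > 0 then 1 else -1 else 0 :: int"
  have set: "{u \<in> {0..<1}. ?j u \<noteq> 0} = {u \<in> {0..<1}. \<gamma>' u $ 1 = 0}"
    by auto
  have "0 = (\<Sum>u\<in>{u \<in> {0..<1}. ?j u \<noteq> 0}. ?j u)"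
  proof (rule periodic_jump_sum [of ?k])
    show "?k (u + 1) = ?k u + 0" for u
      by (simp add: period')
    fix u
    show "\<exists>e>0. \<forall>r s. u - e < r \<and> r < u \<and> u < s \<and> s < u + e \<longrightarrow> ?k s = ?k r + ?j u"
    proof (cases "\<gamma>' u $ 1 = 0")
      case True
      then obtain e where e: "cusp_nbhd u e"
        using cusp_nbhd_ex by blast
      have "?k s = ?k r + ?j u" if "u - e < r \<and> r < u \<and> u < s \<and> s < u + e" for r s
        using near_cusp_x'_left [OF True e, of r] near_cusp_x'_right [OF True e, of s] that True
        by (auto simp: mult_less_0_iff zero_less_mult_iff)
      then show ?thesis
        using e unfolding cusp_nbhd_def by blast
    next
      case False
      have "isCont (\<lambda>t. \<gamma>' t $ 1) u"
        using DERIV_nth' by (rule DERIV_isCont)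
      then obtain e where e: "e > 0" "\<And>v. \<bar>v - u\<bar> < e \<Longrightarrow> \<bar>\<gamma>' v $ 1 - \<gamma>' u $ 1\<bar> < \<bar>\<gamma>' u $ 1\<bar>"
        using False unfolding continuous_at_eps_delta dist_real_def by (metis zero_less_abs_iff)
      have near: "?k v = ?k u" if "\<bar>v - u\<bar> < e" for v
        using e(2) [OF that] by auto
      have "?k s = ?k r + ?j u" if "u - e < r \<and> r < u \<and> u < s \<and> s < u + e" for r s
      proof -
        have "\<bar>r - u\<bar> < e" "\<bar>s - u\<bar> < e"
          using that by linarith+
        then show ?thesis
          using near [of r] near [of s] False by simp
      qed
      then show ?thesis
        using e(1) by blast
    qed
  qed
  also have "\<dots> = (\<Sum>u\<in>{u \<in> {0..<1}. \<gamma>' u $ 1 = 0}. if \<gamma>'' u $ 1 > 0 then 1 else -1)"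
    unfolding set by (rule sum.cong) auto
  also have "\<dots> = int (card {u \<in> {u \<in> {0..<1}. \<gamma>' u $ 1 = 0}. \<gamma>'' u $ 1 > 0})
      - int (card {u \<in> {u \<in> {0..<1}. \<gamma>' u $ 1 = 0}. \<gamma>'' u $ 1 < 0})"
  proof (rule sum_of_signs [OF finite_cusps])
    fix u assume "u \<in> {u \<in> {0..<1}. \<gamma>' u $ 1 = 0}"
    then show "(\<gamma>'' u $ 1 > 0) \<noteq> (\<gamma>'' u $ 1 < 0)"
      using cusp_nondeg [of u] by (simp only: mem_Collect_eq) linarith
  qed
  finally show ?thesis
    by (simp only: mem_Collect_eq conj_assoc)
qed

context
  fixes e \<delta>
  assumes e: "\<And>c. \<gamma>' c $ 1 = 0 \<Longrightarrow> cusp_nbhd c e" and \<delta>: "0 < \<delta>" "\<delta> < e"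
begin

lemma vertical_chord_imp_cusp:
  assumes "chord \<gamma> u \<delta> $ 1 = 0"
  obtains c where "\<gamma>' c $ 1 = 0" "u < c" "c < u + \<delta>"
proof -
  have "\<exists>z>u. z < u + \<delta> \<and> \<gamma>' z $ 1 = 0"
  proof (rule Rolle_deriv [of u "u + \<delta>" "\<lambda>t. \<gamma> t $ 1" "\<lambda>t h. \<gamma>' t $ 1 * h", THEN exE])
    show "continuous_on {u..u + \<delta>} (\<lambda>t. \<gamma> t $ 1)"
      by (intro continuous_intros continuous0)
    show "((\<lambda>t. \<gamma> t $ 1) has_derivative (\<lambda>h. \<gamma>' t $ 1 * h)) (at t)" for t
      using DERIV_nth [of 1 t] by (simp add: has_field_derivative_def)
    fix z assume "u < z \<and> z < u + \<delta> \<and> (\<lambda>h. \<gamma>' z $ 1 * h) = (\<lambda>v. 0)"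
    then show ?thesis
      by (metis mult.right_neutral)
  qed (use assms \<delta> in \<open>auto simp: chord_def\<close>)
  then show thesis
    using that by blast
qed

text \<open>Within \<open>e\<close> of a cusp \<open>x'\<close> is strictly monotone and has no
  second zero.\<close>

lemma cusp_unique:
  assumes "\<gamma>' c $ 1 = 0" "\<gamma>' d $ 1 = 0" "\<bar>c - d\<bar> < e"
  shows "c = d"
  using near_cusp_x' [OF assms(1) e [OF assms(1)], of c d] near_cusp_x' [OF assms(1) e [OF assms(1)], of d c] assms
  by (cases c d rule: linorder_cases) auto

lemma vertical_chord_signs:
  assumes "chord \<gamma> u \<delta> $ 1 = 0" and c: "\<gamma>' c $ 1 = 0" "u < c" "c < u + \<delta>"
  shows "\<gamma>' c $ 2 * chord \<gamma> u \<delta> $ 2 > 0" and "\<gamma>'' c $ 1 * \<gamma>' c $ 2 * chord \<gamma> u \<delta> $ 3 > 0"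
  using near_cusp_y [OF c(1) e [OF c(1)], of u "u + \<delta>"] near_cusp_z [OF c(1) e [OF c(1)], of u "u + \<delta>"] assms \<delta>
  by (auto simp: chord_def algebra_simps)

text \<open>The sign \<open>\<kappa> = 1\<close> belongs to the first chord of a chain, \<open>\<kappa> = -1\<close> to the last one, which is a reversed short chord.\<close>

lemma has_wind_end:
  assumes \<kappa>: "\<kappa> = 1 \<or> \<kappa> = - (1::real)"
  shows "has_wind (\<lambda>u. Complex (norm (chord \<gamma> u \<delta>) - \<kappa> * (chord \<gamma> u \<delta> $ 2 - chord \<gamma> u \<delta> $ 3)) (chord \<gamma> u \<delta> $ 1))
     (int (card {c \<in> {0..<1}. \<gamma>' c $ 1 = 0 \<and> \<gamma>'' c $ 1 < 0 \<and> \<kappa> * \<gamma>' c $ 2 > 0}))"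
proof -
  let ?D = "\<lambda>u. chord \<gamma> u \<delta>"
  define f where "f u = Complex (norm (?D u) - \<kappa> * (?D u $ 2 - ?D u $ 3)) (?D u $ 1)" for u
  define C where "C = {c. \<gamma>' c $ 1 = 0 \<and> \<gamma>'' c $ 1 < 0 \<and> \<kappa> * \<gamma>' c $ 2 > 0}"
  define W where "W = {u. f u \<in> \<real>\<^sub>\<le>\<^sub>0}"
  have nz: "?D u $ 2 \<noteq> 0" "?D u $ 3 \<noteq> 0" if "?D u $ 1 = 0" for u
    using vertical_chord_imp_cusp [OF that] vertical_chord_signs [OF that] by (metis less_irrefl mult_zero_right)+
  have W_iff: "u \<in> W \<longleftrightarrow> ?D u $ 1 = 0 \<and> \<kappa> * ?D u $ 2 > 0 \<and> \<kappa> * ?D u $ 3 < 0" for u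
    using norm_le_difference_iff(1) [of "?D u" \<kappa>] nz [of u] \<kappa>
    by (auto simp: W_def f_def complex_nonpos_Reals_iff)
  have f_nz: "f u \<noteq> 0" for u
    using norm_le_difference_iff(2) [of "?D u" \<kappa>] nz [of u] \<kappa> by (auto simp: f_def complex_eq_iff)
  \<comment> \<open>At a vertical chord the y- and z-components have the signs of \<open>y'\<close>
    and \<open>x'' y'\<close> at the enclosed cusp. The two conditions on the chord therefore become
    \<open>\<kappa> y' > 0\<close> and \<open>x'' < 0\<close>, and the cusp is a right cusp.\<close>
  have W_C: "u \<in> W \<longleftrightarrow> c \<in> C" if "?D u $ 1 = 0" "\<gamma>' c $ 1 = 0" "u < c" "c < u + \<delta>" for u c
    using vertical_chord_signs [OF that] that \<kappa> unfolding W_iff C_def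
    by (auto simp: zero_less_mult_iff mult_less_0_iff)
  have contD: "continuous_on UNIV ?D"
    unfolding chord_def by (intro continuous_intros continuous_on_compose2 [OF continuous0 [of UNIV]]) auto
  have perD: "?D (u + 1) = ?D u" for u
    using chord_periodic [of 0] by simp
  have "continuous_on UNIV f"
    unfolding f_def Complex_eq by (intro continuous_intros contD)
  moreover have "f (u + 1) = f u" for u
    by (simp add: f_def perD)
  ultimately obtain n where n: "has_wind f n"
    using has_wind_ex [of f] f_nz by metis
  \<comment> \<open>The cusp enclosed by a vertical chord based at \<open>u\<close>; this will match
    the visits \<open>W\<close> to the negative real axis with the cusps in
    \<open>C\<close>.\<close>
  define h where "h u = (THE c. \<gamma>' c $ 1 = 0 \<and> u < c \<and> c < u + \<delta>)" for u
  have h_eq: "h u = c" if "\<gamma>' c $ 1 = 0" "u < c" "c < u + \<delta>" for u c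
    unfolding h_def
  proof (rule the_equality)
    fix d assume d: "\<gamma>' d $ 1 = 0 \<and> u < d \<and> d < u + \<delta>"
    then have "\<bar>d - c\<bar> < e"
      using that \<delta> by linarith
    then show "d = c"
      using d that(1) cusp_unique by blast
  qed (use that in auto)
  have h: "\<gamma>' (h u) $ 1 = 0" "u < h u" "h u < u + \<delta>" if "u \<in> W" for u
  proof -
    have "?D u $ 1 = 0"
      using that W_iff by blast
    then obtain c where c: "\<gamma>' c $ 1 = 0" "u < c" "c < u + \<delta>"
      by (rule vertical_chord_imp_cusp)
    then have "h u = c"
      by (rule h_eq)
    with c show "\<gamma>' (h u) $ 1 = 0" "u < h u" "h u < u + \<delta>"
      by auto
  qed
  have hC: "h u \<in> C" if "u \<in> W" for u
    using W_C [of u "h u"] h [OF that] that W_iff by blast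
  have "n = (\<Sum>u\<in>{u \<in> {0..<1}. f u \<in> \<real>\<^sub>\<le>\<^sub>0}. 1)"
  proof (rule has_wind_crossings [OF n], intro conjI)
    fix u assume "f u \<in> \<real>\<^sub>\<le>\<^sub>0"
    then have u: "u \<in> W"
      by (simp add: W_def)
    define c where "c = h u"
    have c: "\<gamma>' c $ 1 = 0" "u < c" "c < u + \<delta>" "\<gamma>'' c $ 1 < 0" and X: "?D u $ 1 = 0"
      using h [OF u] hC [OF u] u W_iff by (auto simp: c_def C_def)
    show "\<exists>e>0. \<forall>r s. u - e < r \<and> r < u \<and> u < s \<and> s < u + e \<longrightarrow>
           of_int 1 * Im (f r) > 0 \<and> of_int 1 * Im (f s) < 0"
    \<comment> \<open>As long as the base point moves by less than this, the chord still encloses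
      \<open>c\<close>, and its horizontal displacement is monotone; it decreases because
      \<open>x'' < 0\<close> at \<open>c\<close>.\<close>
    proof (intro exI [of _ "min (c - u) (u - (c - \<delta>))"] conjI allI impI)
      fix r s assume *: "u - min (c - u) (u - (c - \<delta>)) < r \<and> r < u \<and> u < s \<and> s < u + min (c - u) (u - (c - \<delta>))"
      have "\<gamma>'' c $ 1 * ?D r $ 1 < \<gamma>'' c $ 1 * ?D u $ 1" "\<gamma>'' c $ 1 * ?D u $ 1 < \<gamma>'' c $ 1 * ?D s $ 1"
        using * near_cusp_chord_mono [OF c(1) e [OF c(1)], of \<delta> r u] near_cusp_chord_mono [OF c(1) e [OF c(1)], of \<delta> u s] \<delta> c
        by (auto simp: chord_def)
      then show "of_int 1 * Im (f r) > 0" "of_int 1 * Im (f s) < 0"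
        using c(4) X by (auto simp: f_def mult_less_0_iff zero_less_mult_iff)
    qed (use c in auto)
  qed auto
  also have "\<dots> = int (card (W \<inter> {0..<1}))"
    by (simp add: W_def Int_def conj_commute)
  also have "card (W \<inter> {0..<1}) = card (C \<inter> {0..<1})"
  proof (rule card_periodic_bij)
    show "bij_betw h W C"
    proof (rule bij_betwI')
      fix u v assume u: "u \<in> W" and v: "v \<in> W"
      show "h u = h v \<longleftrightarrow> u = v"
      proof
        assume eq: "h u = h v"
        have "?D u $ 1 = 0" "?D v $ 1 = 0"
          using u v W_iff by auto
        then show "u = v"
          using near_cusp_chord_mono [OF h(1) [OF u] e [OF h(1) [OF u]], of \<delta> u v]
            near_cusp_chord_mono [OF h(1) [OF u] e [OF h(1) [OF u]], of \<delta> v u] h(2,3) [OF u] h(2,3) [OF v] eq \<delta>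
          by (cases u v rule: linorder_cases) (auto simp: chord_def)
      qed auto
    next
      fix c assume c: "c \<in> C"
      then have c0: "\<gamma>' c $ 1 = 0"
        by (simp add: C_def)
      obtain u where u: "c - \<delta> < u" "u < c" "\<gamma> (u + \<delta>) $ 1 = \<gamma> u $ 1"
        using near_cusp_chord_ex [OF c0 e [OF c0] \<delta>] by blast
      then have "u \<in> W" "h u = c"
        using W_C [of u c] h_eq [of c u] c c0 by (auto simp: chord_def)
      then show "\<exists>u\<in>W. c = h u"
        by blast
    qed (rule hC)
    show "h (u + 1) = h u + 1" if "u \<in> W" for u
      using h [OF that] by (intro h_eq) (auto simp: period')
    show "u + 1 \<in> W \<longleftrightarrow> u \<in> W" for u
      by (simp add: W_iff perD)
    show "c + 1 \<in> C \<longleftrightarrow> c \<in> C" for c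
      by (simp add: C_def period' period'')
  qed
  also have "C \<inter> {0..<1} = {c \<in> {0..<1}. \<gamma>' c $ 1 = 0 \<and> \<gamma>'' c $ 1 < 0 \<and> \<kappa> * \<gamma>' c $ 2 > 0}"
    by (auto simp: C_def)
  finally show ?thesis
    using n unfolding f_def by simp
qed

end

end

section \<open>Crossings\<close>

lemma norm_eq_nth2_iff:
  fixes D :: "real ^ 3"
  assumes "D \<noteq> 0"
  shows "norm D = D $ 2 \<longleftrightarrow> D $ 1 = 0 \<and> D $ 3 = 0 \<and> D $ 2 > 0"
proof
  assume "norm D = D $ 2"
  then have "(D $ 1)\<^sup>2 + (D $ 3)\<^sup>2 = 0" "D $ 2 > 0"
    using norm_squared_vec3 [of D] assms by (auto simp: norm_eq_zero simp flip: zero_less_norm_iff)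
  then show "D $ 1 = 0 \<and> D $ 3 = 0 \<and> D $ 2 > 0"
    by (simp add: sum_power2_eq_zero_iff)
next
  assume *: "D $ 1 = 0 \<and> D $ 3 = 0 \<and> D $ 2 > 0"
  then have "(norm D)\<^sup>2 = (D $ 2)\<^sup>2"
    using norm_squared_vec3 [of D] by simp
  then show "norm D = D $ 2"
    using * by (simp add: power2_eq_iff_nonneg)
qed

lemma cnj_spin_prod: "cnj (spin_prod D E) = spin_prod E D"
  by (simp add: spin_prod_eq mult.commute)

lemma bounded_linear_fpart: "bounded_linear fpart"
proof -
  have "bounded_linear (\<lambda>D :: real ^ 3. complex_of_real (D $ 1) + \<i> * complex_of_real (D $ 3))"
    by (intro bounded_linear_add bounded_linear_const_mult bounded_linear_compose [OF bounded_linear_of_real]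
        bounded_linear_vec_nth)
  then show ?thesis
    by (simp add: fpart_def [abs_def] Complex_eq)
qed

text \<open>\<open>\<alpha>\<close> and \<open>\<beta>\<close> are the Wirtinger derivatives; the
  difference of the squares of their norms is the determinant \<open>Im (cnj L * M)\<close>.\<close>

lemma real_linear_complex_split:
  fixes L M :: complex
  assumes "Im (cnj L * M) > 0"
  shows "\<exists>\<alpha> \<beta>. norm \<beta> < norm \<alpha> \<and> (\<forall>h. of_real (Re h) * L + of_real (Im h) * M = \<alpha> * h + \<beta> * cnj h)"
proof (intro exI conjI allI)
  show "of_real (Re h) * L + of_real (Im h) * M = (L - \<i> * M) / 2 * h + (L + \<i> * M) / 2 * cnj h" for h
    by (simp add: complex_eq_iff field_simps)
  have "(norm (L + \<i> * M))\<^sup>2 < (norm (L - \<i> * M))\<^sup>2"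
    using assms unfolding cmod_power2 by (simp add: power2_eq_square algebra_simps)
  then have "norm (L + \<i> * M) < norm (L - \<i> * M)"
    by (rule power2_less_imp_less) simp
  then show "norm ((L + \<i> * M) / 2) < norm ((L - \<i> * M) / 2)"
    by (simp add: norm_divide)
qed

context generic_loop
begin

lemma pole_iff_over:
  assumes "0 < \<tau>" "\<tau> < 1"
  shows "norm (chord \<gamma> u \<tau>) = chord \<gamma> u \<tau> $ 2 \<longleftrightarrow> front_over \<gamma> u (u + \<tau>)"
  using norm_eq_nth2_iff [OF chord_nonzero [of 0 \<tau> u]] assms
  by (auto simp: chord_def front_over_def front_def)

lemma periodic_gamma: "s - t \<in> \<int> \<Longrightarrow> \<gamma> s = \<gamma> t"
  using closed by blast

lemma front_over_cong: "s - s' \<in> \<int> \<Longrightarrow> t - t' \<in> \<int> \<Longrightarrow> front_over \<gamma> s t \<longleftrightarrow> front_over \<gamma> s' t'"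
  by (simp add: front_over_def front_def periodic_gamma)

lemma front_over_frac: "front_over \<gamma> s t \<longleftrightarrow> (frac s, frac t) \<in> front_crossings \<gamma>"
  using front_over_cong [of s "frac s" t "frac t"] frac_lt_1 [of s] frac_lt_1 [of t]
  by (simp add: front_crossings_def frac_def)

text \<open>The parameter distance from the over-strand to the under-strand modulo 1. Together with
  \<open>fst p\<close> it locates the crossing on the annulus of all chords.\<close>

definition crossing_gap :: "real \<times> real \<Rightarrow> real" where
  "crossing_gap p = frac (snd p - fst p)"

lemma crossing_gap_frac: "0 < \<tau> \<Longrightarrow> \<tau> < 1 \<Longrightarrow> crossing_gap (frac u, frac (u + \<tau>)) = \<tau>"
proof -
  have "frac (u + \<tau>) - frac u - \<tau> = of_int (\<lfloor>u\<rfloor> - \<lfloor>u + \<tau>\<rfloor>)"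
    by (simp add: frac_def)
  then have "frac (u + \<tau>) - frac u - \<tau> \<in> \<int>"
    by (metis Ints_of_int)
  then show "0 < \<tau> \<Longrightarrow> \<tau> < 1 \<Longrightarrow> ?thesis"
    unfolding crossing_gap_def fst_conv snd_conv frac_unique_iff by simp
qed

lemma crossing_over:
  assumes "p \<in> front_crossings \<gamma>"
  shows "front_over \<gamma> (fst p) (fst p + crossing_gap p)"
proof -
  have "front_over \<gamma> (fst p) (snd p)"
    using assms by (auto simp: front_crossings_def)
  moreover have "fst p + crossing_gap p - snd p \<in> \<int>"
    by (simp add: crossing_gap_def frac_def)
  ultimately show ?thesis
    using front_over_cong [of "fst p" "fst p" "fst p + crossing_gap p" "snd p"] by simp
qed

lemma crossing_gap_bounds:
  assumes "p \<in> front_crossings \<gamma>"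
  shows "0 < crossing_gap p" "crossing_gap p < 1"
proof -
  show "crossing_gap p < 1"
    by (simp add: crossing_gap_def frac_lt_1)
  have "crossing_gap p \<noteq> 0"
    using crossing_over [OF assms] by (auto simp: front_over_def)
  moreover have "crossing_gap p \<ge> 0"
    by (simp add: crossing_gap_def)
  ultimately show "0 < crossing_gap p"
    by simp
qed

lemma over_gap:
  assumes "front_over \<gamma> u (u + \<tau>)" "0 < \<tau>" "\<tau> < 1"
  shows "\<exists>p\<in>front_crossings \<gamma>. crossing_gap p = \<tau> \<and> fst p = frac u"
  using assms crossing_gap_frac [of \<tau> u] front_over_frac by (intro bexI [of _ "(frac u, frac (u + \<tau>))"]) auto

lemma crossing_eqI:
  assumes "p \<in> front_crossings \<gamma>" "q \<in> front_crossings \<gamma>"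
    and "fst p = fst q" and "crossing_gap p = crossing_gap q"
  shows "p = q"
proof -
  have r: "0 \<le> snd p" "snd p < 1" "0 \<le> snd q" "snd q < 1"
    using assms(1,2) by (auto simp: front_crossings_def)
  have "snd p - snd q = of_int (\<lfloor>snd p - fst p\<rfloor> - \<lfloor>snd q - fst q\<rfloor>)"
    using assms(3,4) by (simp add: crossing_gap_def frac_def)
  then obtain k :: int where k: "snd p - snd q = of_int k"
    by blast
  then have "\<bar>real_of_int k\<bar> < 1"
    using r by linarith
  then have "k = 0"
    by linarith
  then show ?thesis
    using k assms(3) by (simp add: prod_eq_iff)
qed

lemma negative_crossing_iff:
  "negative_crossing \<gamma> s t \<longleftrightarrow> \<gamma>' s $ 1 * \<gamma>' t $ 3 - \<gamma>' s $ 3 * \<gamma>' t $ 1 < 0"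
  by (simp add: negative_crossing_def vector_derivative_front [OF has_derivative1])

text \<open>The annulus of chords in a complex coordinate, with the base point as real part and the
  gap as imaginary part. The spinor of the chord is paired with that of the chord of fixed gap
  \<open>t\<close> at the same base point, so crossings appear as zeros.\<close>

definition strip_fun :: "real \<Rightarrow> complex \<Rightarrow> complex" where
  "strip_fun t w = spin_prod (chord \<gamma> (Re w) t) (chord \<gamma> (Re w) (Im w))"

lemma continuous_chord: "continuous_on S f \<Longrightarrow> continuous_on S g \<Longrightarrow> continuous_on S (\<lambda>x. chord \<gamma> (f x) (g x))"
  unfolding chord_def by (intro continuous_intros continuous_on_compose2 [OF continuous0 [of UNIV]]) auto

lemma continuous_spin_prod:
  "continuous_on S f \<Longrightarrow> continuous_on S g \<Longrightarrow> continuous_on S (\<lambda>x. spin_prod (f x) (g x))"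
  unfolding spin_prod_eq fpart_def Complex_eq by (intro continuous_intros)

text \<open>At a crossing \<open>norm D - D $ 2\<close> takes its minimum \<open>0\<close>, so to
  first order only the front part of the chord contributes, multiplied by \<open>a\<close>. Its
  partial derivatives are \<open>L\<close> in the base point and \<open>M\<close> in the gap; their
  determinant is minus that of the two strands, hence positive at a negative crossing.\<close>

lemma strip_fun_has_derivative:
  assumes p: "p \<in> front_crossings \<gamma>" and neg: "negative_crossing \<gamma> (fst p) (snd p)"
    and t: "0 < t" "t < 1"
    and pole: "\<not> front_over \<gamma> (fst p) (fst p + t)"
    and anti: "\<not> antiparallel (chord \<gamma> (fst p) t) (chord \<gamma> (fst p) (crossing_gap p))"
  shows "\<exists>\<alpha> \<beta>. norm \<beta> < norm \<alpha> \<and>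
    (strip_fun t has_derivative (\<lambda>h. \<alpha> * h + \<beta> * cnj h)) (at (Complex (fst p) (crossing_gap p)))"
proof -
  define s where "s = fst p"
  define \<tau> where "\<tau> = crossing_gap p"
  define q where "q = Complex s \<tau>"
  define D where "D w = chord \<gamma> (Re w) (Im w)" for w
  define D' where "D' h = (Re h + Im h) *\<^sub>R \<gamma>' (s + \<tau>) - Re h *\<^sub>R \<gamma>' s" for h
  define a where "a = cnj (fpart (chord \<gamma> s t))"
  define L where "L = fpart (\<gamma>' (s + \<tau>)) - fpart (\<gamma>' s)"
  define M where "M = fpart (\<gamma>' (s + \<tau>))"
  have over: "front_over \<gamma> s (s + \<tau>)"
    using crossing_over [OF p] by (simp add: s_def \<tau>_def)
  have \<tau>: "0 < \<tau>" "\<tau> < 1"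
    using crossing_gap_bounds [OF p] by (auto simp: \<tau>_def)
  have Dq: "D q $ 1 = 0" "D q $ 3 = 0" "D q $ 2 > 0" "norm (D q) = D q $ 2"
    using over pole_iff_over [OF \<tau>, of s] by (auto simp: D_def q_def chord_def front_over_def front_def)
  have deriv_\<gamma>: "(\<gamma> has_derivative (\<lambda>h. h *\<^sub>R \<gamma>' u)) (at u)" for u
    using has_derivative1 [of u] by (simp add: has_vector_derivative_def)
  have "((\<lambda>w. \<gamma> (Re w + Im w)) has_derivative (\<lambda>h. (Re h + Im h) *\<^sub>R \<gamma>' (Re q + Im q))) (at q)"
    by (rule has_derivative_compose [OF _ deriv_\<gamma>]) (auto intro!: derivative_intros)
  moreover have "((\<lambda>w. \<gamma> (Re w)) has_derivative (\<lambda>h. Re h *\<^sub>R \<gamma>' (Re q))) (at q)"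
    by (rule has_derivative_compose [OF _ deriv_\<gamma>]) (auto intro!: derivative_intros)
  ultimately have D: "(D has_derivative D') (at q)"
    unfolding D_def [abs_def] D'_def [abs_def] chord_def
    using has_derivative_diff by (fastforce simp: q_def)
  have B: "((\<lambda>w. of_real (norm (D w) - D w $ 2)) has_derivative (\<lambda>h. complex_of_real 0)) (at q)"
  proof (rule has_derivative_of_real)
    have "sgn (D q) = axis 2 1"
      using Dq by (auto simp: sgn_div_norm vec_eq_iff forall_3 axis_def)
    then have 0: "D' h \<bullet> sgn (D q) - D' h $ 2 = 0" for h
      by (simp add: inner_axis)
    have "((\<lambda>w. norm (D w) - D w $ 2) has_derivative (\<lambda>h. D' h \<bullet> sgn (D q) - D' h $ 2)) (at q)"
      using Dq by (intro has_derivative_diff has_derivative_compose [OF D has_derivative_norm]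
          bounded_linear.has_derivative [OF bounded_linear_vec_nth D]) auto
    then show "((\<lambda>w. norm (D w) - D w $ 2) has_derivative (\<lambda>h. 0)) (at q)"
      unfolding 0 .
  qed
  have P: "((\<lambda>w. fpart (D w)) has_derivative (\<lambda>h. fpart (D' h))) (at q)"
    by (rule bounded_linear.has_derivative [OF bounded_linear_fpart D])
  have cont: "isCont (\<lambda>w. complex_of_real (norm (chord \<gamma> (Re w) t) - chord \<gamma> (Re w) t $ 2)) q"
    "isCont (\<lambda>w. cnj (fpart (chord \<gamma> (Re w) t))) q"
  proof -
    have "continuous_on UNIV (\<lambda>w. chord \<gamma> (Re w) t)"
      by (intro continuous_chord continuous_intros)
    then have "continuous_on UNIV (\<lambda>w. complex_of_real (norm (chord \<gamma> (Re w) t) - chord \<gamma> (Re w) t $ 2))"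
      "continuous_on UNIV (\<lambda>w. cnj (fpart (chord \<gamma> (Re w) t)))"
      unfolding fpart_def Complex_eq by (intro continuous_intros; simp)+
    then show "isCont (\<lambda>w. complex_of_real (norm (chord \<gamma> (Re w) t) - chord \<gamma> (Re w) t $ 2)) q"
      "isCont (\<lambda>w. cnj (fpart (chord \<gamma> (Re w) t))) q"
      by (simp_all add: continuous_on_eq_continuous_at)
  qed
  have "(strip_fun t has_derivative (\<lambda>h. complex_of_real (norm (chord \<gamma> (Re q) t) - chord \<gamma> (Re q) t $ 2) * complex_of_real 0
       + cnj (fpart (chord \<gamma> (Re q) t)) * fpart (D' h))) (at q)"
    unfolding strip_fun_def [abs_def] spin_prod_eq D_def [symmetric]
    by (intro has_derivative_add has_derivative_mult_vanishing B P cont)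
      (use Dq in \<open>auto simp: fpart_def complex_eq_iff\<close>)
  then have deriv: "(strip_fun t has_derivative (\<lambda>h. a * fpart (D' h))) (at q)"
    by (simp add: a_def q_def)
  have "fpart (D' h) = of_real (Re h) * L + of_real (Im h) * M" for h
    by (simp add: D'_def L_def M_def fpart_def complex_eq_iff algebra_simps)
  moreover have "Im (cnj L * M) > 0"
  proof -
    have "\<gamma>' (s + \<tau>) = \<gamma>' (snd p)"
      using periodic_Ints [of \<gamma>' "s + \<tau>" "snd p"] period'
      by (simp add: s_def \<tau>_def crossing_gap_def frac_def)
    then have "\<gamma>' s $ 1 * \<gamma>' (s + \<tau>) $ 3 - \<gamma>' s $ 3 * \<gamma>' (s + \<tau>) $ 1 < 0"
      using neg by (simp add: negative_crossing_iff s_def)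
    then show ?thesis
      by (simp add: L_def M_def fpart_def algebra_simps)
  qed
  ultimately obtain \<alpha> \<beta> where ab: "norm \<beta> < norm \<alpha>" "\<And>h. fpart (D' h) = \<alpha> * h + \<beta> * cnj h"
    using real_linear_complex_split [of L M] by metis
  \<comment> \<open>Otherwise the chord of gap \<open>t\<close> would lie along the y-axis. The
    positive direction is excluded by \<open>pole\<close>, the negative one by \<open>anti\<close>,
    as the chord of the crossing points in the positive direction.\<close>
  have "a \<noteq> 0"
  proof
    assume "a = 0"
    then have 1: "chord \<gamma> s t $ 1 = 0" "chord \<gamma> s t $ 3 = 0"
      by (auto simp: a_def fpart_def complex_eq_iff)
    have nz: "chord \<gamma> s t \<noteq> 0"
      using chord_nonzero [of 0] t by simp
    then have "chord \<gamma> s t $ 2 < 0"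
      using pole 1 pole_iff_over [OF t, of s] norm_eq_nth2_iff [OF nz]
      by (simp add: s_def vec_eq_iff forall_3 not_less less_le)
    moreover have "(norm (chord \<gamma> s t))\<^sup>2 = (chord \<gamma> s t $ 2)\<^sup>2"
      using norm_squared_vec3 [of "chord \<gamma> s t"] 1 by simp
    ultimately have "norm (chord \<gamma> s t) = - chord \<gamma> s t $ 2"
      by (metis abs_norm_cancel abs_of_neg power2_eq_iff abs_minus_cancel norm_ge_zero not_less abs_of_nonneg)
    then have "antiparallel (chord \<gamma> s t) (D q)"
      using 1 Dq by (simp add: antiparallel_def inner_vec_def sum_3)
    then show False
      using anti by (simp add: D_def q_def s_def \<tau>_def)
  qed
  show ?thesis
  proof (intro exI conjI)
    show "norm (a * \<beta>) < norm (a * \<alpha>)"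
      using ab(1) \<open>a \<noteq> 0\<close> by (simp add: norm_mult)
    show "(strip_fun t has_derivative (\<lambda>h. a * \<alpha> * h + a * \<beta> * cnj h)) (at (Complex (fst p) (crossing_gap p)))"
      using deriv unfolding ab(2) by (simp add: q_def s_def \<tau>_def ring_distribs mult.assoc)
  qed
qed

text \<open>At gap \<open>t1\<close> the function is the squared norm of a nonzero spinor and does
  not turn. Raising the gap to \<open>t2\<close> loses one turn at each crossing in between.
  Conjugation exchanges the arguments of \<open>spin_prod\<close> and makes the result
  positive.\<close>

lemma has_wind_strip:
  assumes fin: "finite (front_crossings \<gamma>)"
    and neg: "\<And>p. p \<in> front_crossings \<gamma> \<Longrightarrow> negative_crossing \<gamma> (fst p) (snd p)"
    and t: "0 < t1" "t1 < t2" "t2 < 1"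
    and gap: "\<And>p. p \<in> front_crossings \<gamma> \<Longrightarrow> crossing_gap p \<noteq> t1 \<and> crossing_gap p \<noteq> t2"
    and anti: "\<And>u \<tau>. t1 \<le> \<tau> \<Longrightarrow> \<tau> \<le> t2 \<Longrightarrow> \<not> antiparallel (chord \<gamma> u t1) (chord \<gamma> u \<tau>)"
  shows "has_wind (\<lambda>u. spin_prod (chord \<gamma> u t2) (chord \<gamma> u t1))
     (int (card {p \<in> front_crossings \<gamma>. t1 < crossing_gap p \<and> crossing_gap p < t2}))"
proof -
  let ?S = "{p \<in> front_crossings \<gamma>. t1 < crossing_gap p \<and> crossing_gap p < t2}"
  define point where "point p = Complex (fst p) (crossing_gap p)" for p
  let ?Q = "point ` ?S"
  have pole1: "\<not> front_over \<gamma> u (u + t1)" for u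
    using over_gap [of u t1] gap t by fastforce
  have pole2: "\<not> front_over \<gamma> u (u + t2)" for u
    using over_gap [of u t2] gap t by fastforce
  have point_Ints: "p = q" if pq: "p \<in> ?S" "q \<in> ?S" "point p - point q \<in> \<int>" for p q
  proof -
    obtain k :: int where "point p - point q = of_int k"
      using pq(3) by (elim Ints_cases)
    then have k: "fst p - fst q = of_int k" "crossing_gap p = crossing_gap q"
      by (auto simp: point_def complex_eq_iff)
    have "0 \<le> fst p" "fst p < 1" "0 \<le> fst q" "fst q < 1"
      using pq(1,2) by (auto simp: front_crossings_def)
    then have "\<bar>real_of_int k\<bar> < 1"
      using k(1) by linarith
    then have "k = 0"
      by linarith
    then show ?thesis
      using k pq crossing_eqI by auto
  qed
  have inj: "inj_on point ?S"
    using point_Ints by (intro inj_onI) simp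
  have "has_wind (\<lambda>u. strip_fun t1 (Complex u t1)) 0"
  proof (rule has_wind_Re_pos)
    show "continuous_on UNIV (\<lambda>u. strip_fun t1 (Complex u t1))"
      unfolding strip_fun_def by (auto intro!: continuous_spin_prod continuous_chord continuous_intros)
    show "strip_fun t1 (Complex (u + 1) t1) = strip_fun t1 (Complex u t1)" for u
      using chord_periodic [of 0] by (simp add: strip_fun_def)
    show "Re (strip_fun t1 (Complex u t1)) > 0" for u
    proof -
      let ?D = "chord \<gamma> u t1"
      have "Re (strip_fun t1 (Complex u t1)) = (norm ?D - ?D $ 2)\<^sup>2 + ((Re (fpart ?D))\<^sup>2 + (Im (fpart ?D))\<^sup>2)"
        by (simp add: strip_fun_def spin_prod_eq power2_eq_square)
      moreover have "norm ?D - ?D $ 2 \<noteq> 0"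
        using pole1 [of u] pole_iff_over [of t1 u] t by auto
      ultimately show ?thesis
        by (simp add: add_pos_nonneg)
    qed
  qed
  then have "has_wind (\<lambda>u. strip_fun t1 (Complex u t2)) (0 - int (card ?Q))"
  proof (rule has_wind_jump [rotated -1])
    show "continuous_on {w. t1 \<le> Im w \<and> Im w \<le> t2} (strip_fun t1)"
      unfolding strip_fun_def [abs_def] by (intro continuous_spin_prod continuous_chord continuous_intros)
    show "strip_fun t1 (w + 1) = strip_fun t1 w" for w
      using chord_periodic [of 0] by (simp add: strip_fun_def)
    show "strip_fun t1 w = 0 \<longleftrightarrow> (\<exists>q\<in>?Q. w - q \<in> \<int>)" if w: "t1 \<le> Im w" "Im w \<le> t2" for w
    proof -
      have b: "0 < Im w" "Im w < 1"
        using w t by auto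
      have "strip_fun t1 w = 0 \<longleftrightarrow> front_over \<gamma> (Re w) (Re w + Im w)"
      proof
        assume "front_over \<gamma> (Re w) (Re w + Im w)"
        then have "spinor (chord \<gamma> (Re w) (Im w)) = 0"
          by (simp add: spinor_eq_0_iff pole_iff_over [OF b])
        then show "strip_fun t1 w = 0"
          by (simp add: strip_fun_def spin_prod_def spin_proj_def)
      next
        assume 0: "strip_fun t1 w = 0"
        show "front_over \<gamma> (Re w) (Re w + Im w)"
        proof (rule ccontr)
          assume "\<not> front_over \<gamma> (Re w) (Re w + Im w)"
          then have "strip_fun t1 w \<noteq> 0"
            unfolding strip_fun_def using anti [OF w, of "Re w"] pole1 [of "Re w"] t b
            by (intro spin_prod_nonzero) (auto simp: pole_iff_over antiparallel_commute)
          with 0 show False by simp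
        qed
      qed
      also have "\<dots> \<longleftrightarrow> (\<exists>q\<in>?Q. w - q \<in> \<int>)"
      proof
        assume over: "front_over \<gamma> (Re w) (Re w + Im w)"
        then obtain p where p: "p \<in> front_crossings \<gamma>" "crossing_gap p = Im w" "fst p = frac (Re w)"
          using over_gap [OF _ b] by blast
        have S: "p \<in> ?S"
          using p gap [OF p(1)] w by auto
        have "w - point p = of_int \<lfloor>Re w\<rfloor>"
          using p by (simp add: point_def complex_eq_iff frac_def)
        then have "w - point p \<in> \<int>"
          by simp
        then show "\<exists>q\<in>?Q. w - q \<in> \<int>"
          by (rule bexI [OF _ imageI [OF S]])
      next
        assume "\<exists>q\<in>?Q. w - q \<in> \<int>"
        then obtain p k where p: "p \<in> ?S" "w - point p = of_int k"
          by (auto elim!: Ints_cases)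
        then have "Re w = fst p + of_int k" "Im w = crossing_gap p"
          by (auto simp: point_def complex_eq_iff)
        moreover have "front_over \<gamma> (fst p) (fst p + crossing_gap p)"
          using crossing_over p(1) by simp
        ultimately show "front_over \<gamma> (Re w) (Re w + Im w)"
          using front_over_cong [of "Re w" "fst p" "Re w + Im w" "fst p + crossing_gap p"] by simp
      qed
      finally show ?thesis .
    qed
    show "\<exists>\<alpha> \<beta>. norm \<beta> < norm \<alpha> \<and> (strip_fun t1 has_derivative (\<lambda>h. \<alpha> * h + \<beta> * cnj h)) (at q)" if "q \<in> ?Q" for q
    proof -
      from that obtain p where p: "p \<in> ?S" "q = point p"
        by blast
      then show ?thesis
        unfolding p(2) point_def using neg t pole1 anti by (intro strip_fun_has_derivative) auto
    qed
    show "q = q'" if "q \<in> ?Q" "q' \<in> ?Q" "q - q' \<in> \<int>" for q q'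
      using that point_Ints by blast
  qed (use fin t in \<open>auto simp: point_def\<close>)
  from has_wind_cnj [OF this] show ?thesis
    by (simp add: strip_fun_def cnj_spin_prod card_image [OF inj])
qed

end

text \<open>A prime \<open>N\<close> keeps the grid \<open>i/N\<close> away from the finitely many crossings, since such fractions are reduced.\<close>

lemma finite_prime_denominators:
  fixes T :: "real set"
  assumes "finite T"
  shows "finite {N :: nat. prime N \<and> (\<exists>\<tau>\<in>T. \<exists>i. 0 < i \<and> i < N \<and> \<tau> = real i / real N)}"
proof -
  have one: "N = M" if N: "prime N" "0 < i" "i < N" "\<tau> = real i / real N"
    and M: "prime M" "0 < j" "j < M" "\<tau> = real j / real M" for N M i j :: nat and \<tau>
  proof (rule ccontr)
    assume "N \<noteq> M"
    have "real i * real M = real j * real N"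
      using N M by (simp add: field_simps)
    then have "i * M = j * N"
      by (metis of_nat_eq_iff of_nat_mult)
    then have "N dvd i * M"
      by simp
    moreover have "\<not> N dvd M"
      using primes_dvd_imp_eq [OF N(1) M(1)] \<open>N \<noteq> M\<close> by blast
    ultimately have "N dvd i"
      using N(1) prime_dvd_mult_iff by blast
    then show False
      using N(2,3) by (simp add: nat_dvd_not_less)
  qed
  have "finite {N :: nat. prime N \<and> (\<exists>i. 0 < i \<and> i < N \<and> \<tau> = real i / real N)}" (is "finite ?A") for \<tau>
  proof (cases "?A = {}")
    case False
    then obtain N where "N \<in> ?A"
      by blast
    then have "?A \<subseteq> {N}"
      using one by blast
    then show ?thesis
      by (rule finite_subset) simp
  next
    case True
    then show ?thesis
      by (simp only: finite.emptyI)
  qed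
  then have "finite (\<Union>\<tau>\<in>T. {N :: nat. prime N \<and> (\<exists>i. 0 < i \<and> i < N \<and> \<tau> = real i / real N)})"
    using assms by blast
  then show ?thesis
    by (rule finite_subset [rotated]) blast
qed

lemma eventually_inverse_less: "c > 0 \<Longrightarrow> \<forall>\<^sub>F N in sequentially. 1 / real N < c"
  using order_tendstoD(2) [OF lim_1_over_n] by blast

section \<open>The total winding number of the chain of chords\<close>

context generic_loop
begin

lemma wind_knot_hol:
  assumes fin: "finite (front_crossings \<gamma>)"
    and neg: "\<And>p. p \<in> front_crossings \<gamma> \<Longrightarrow> negative_crossing \<gamma> (fst p) (snd p)"
  shows "\<forall>\<^sub>F N in sequentially. prime N \<longrightarrow> has_wind (knot_hol \<gamma> N)
     (int (card (front_crossings \<gamma>)) + int (card {c \<in> {0..<1}. \<gamma>' c $ 1 = 0 \<and> \<gamma>'' c $ 1 < 0}))"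
proof -
  let ?X = "front_crossings \<gamma>"
  obtain \<eta> where \<eta>: "\<eta> > 0"
    "\<And>u \<tau> \<sigma>. 0 < \<tau> \<Longrightarrow> \<tau> < 1 \<Longrightarrow> 0 < \<sigma> \<Longrightarrow> \<sigma> < 1 \<Longrightarrow> \<bar>\<sigma> - \<tau>\<bar> < \<eta> \<Longrightarrow>
       \<not> antiparallel (chord \<gamma> u \<sigma>) (chord \<gamma> u \<tau>)"
    using chords_not_antiparallel by (metis atLeastAtMost_iff order_refl zero_le_one)
  obtain e where e: "e > 0" "\<And>c. \<gamma>' c $ 1 = 0 \<Longrightarrow> cusp_nbhd c e"
    using cusp_nbhd_uniform by blast
  let ?T = "crossing_gap ` ?X"
  \<comment> \<open>The strips between neighbouring grid points only cover the gaps from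
    \<open>1/N\<close> to \<open>(N - 1)/N\<close>, so all crossings must have their gaps in that
    range.\<close>
  have 1: "\<forall>\<^sub>F N in sequentially. \<forall>\<tau>\<in>?T. 1 / real N < \<tau> \<and> 1 / real N < 1 - \<tau>"
    using fin crossing_gap_bounds
    by (intro eventually_ball_finite finite_imageI ballI eventually_conj eventually_inverse_less) auto
  define B where "B = {N :: nat. prime N \<and> (\<exists>\<tau>\<in>?T. \<exists>i. 0 < i \<and> i < N \<and> \<tau> = real i / real N)}"
  have 2: "\<forall>\<^sub>F N in sequentially. N \<notin> B"
  proof -
    have "finite B"
      unfolding B_def by (intro finite_prime_denominators finite_imageI fin)
    then obtain k where "B \<subseteq> {..<k}"
      unfolding finite_nat_iff_bounded by blast
    then show ?thesis
      by (intro eventually_mono [OF eventually_ge_at_top [of k]]) auto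
  qed
  show ?thesis
    using 1 2 eventually_inverse_less [OF \<eta>(1)] eventually_inverse_less [OF e(1)] eventually_ge_at_top [of 3]
  proof eventually_elim
    case (elim N)
    show ?case
    proof
      assume "prime N"
      define \<delta> where "\<delta> = 1 / real N"
      have \<delta>: "0 < \<delta>" "\<delta> < e"
        using elim by (auto simp: \<delta>_def)
      have grid: "0 < real i / real N" "real i / real N < 1" if "1 \<le> i" "i < N" for i
        using that by auto
      have gap: "crossing_gap p \<noteq> real i / real N" if "p \<in> ?X" "1 \<le> i" "i < N" for p i
        using elim(2) \<open>prime N\<close> that unfolding B_def by auto
      define n where "n i = int (card {p \<in> ?X. real i / real N < crossing_gap p \<and> crossing_gap p < real (Suc i) / real N})" for i
      let ?R = "\<lambda>\<kappa>. {c \<in> {0..<1}. \<gamma>' c $ 1 = 0 \<and> \<gamma>'' c $ 1 < 0 \<and> \<kappa> * \<gamma>' c $ 2 > 0}"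
      have "has_wind (knot_hol \<gamma> N) (int (card (?R 1)) + (\<Sum>i = 1..<N - 1. n i) + int (card (?R (- 1))))"
        unfolding knot_hol_def [abs_def]
      proof (rule has_wind_hol)
        show "continuous_on UNIV (\<lambda>u. chord \<gamma> u (real i / real N))" for i
          by (intro continuous_chord continuous_intros)
        show "chord \<gamma> (u + 1) (real i / real N) = chord \<gamma> u (real i / real N)" for u i
          using chord_periodic [of 0] by simp
        show "norm (chord \<gamma> u (real i / real N)) \<noteq> chord \<gamma> u (real i / real N) $ 2" if "1 \<le> i" "i \<le> N - 1" for u i
        proof -
          have i: "1 \<le> i" "i < N"
            using that elim(5) by auto
          then show ?thesis
            using pole_iff_over [OF grid [OF i], of u] over_gap [OF _ grid [OF i], of u] gap [of _ i] by blast
        qed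
        show "has_wind (\<lambda>u. of_real (norm (chord \<gamma> u (real 1 / real N)) - chord \<gamma> u (real 1 / real N) $ 2)
            + \<i> * cnj (fpart (chord \<gamma> u (real 1 / real N)))) (int (card (?R 1)))"
        proof -
          have "has_wind (\<lambda>u. Complex (norm (chord \<gamma> u \<delta>) - 1 * (chord \<gamma> u \<delta> $ 2 - chord \<gamma> u \<delta> $ 3)) (chord \<gamma> u \<delta> $ 1)) (int (card (?R 1)))"
            using has_wind_end [OF e(2) \<delta>, of 1] by simp
          also have "(\<lambda>u. Complex (norm (chord \<gamma> u \<delta>) - 1 * (chord \<gamma> u \<delta> $ 2 - chord \<gamma> u \<delta> $ 3)) (chord \<gamma> u \<delta> $ 1)) =
            (\<lambda>u. of_real (norm (chord \<gamma> u \<delta>) - chord \<gamma> u \<delta> $ 2) + \<i> * cnj (fpart (chord \<gamma> u \<delta>)))"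
            by (simp add: fun_eq_iff complex_eq_iff fpart_def)
          finally show ?thesis
            by (simp add: \<delta>_def)
        qed
        show "has_wind (\<lambda>u. of_real (norm (chord \<gamma> u (real (N - 1) / real N)) - chord \<gamma> u (real (N - 1) / real N) $ 2)
            - \<i> * fpart (chord \<gamma> u (real (N - 1) / real N))) (int (card (?R (- 1))))"
        proof -
          let ?D = "\<lambda>u. chord \<gamma> (u + - \<delta>) \<delta>"
          \<comment> \<open>By periodicity the last chord is the reverse of a chord of parameter
            length \<open>1/N\<close> based at \<open>u - 1/N\<close>; shifting the base point does
            not affect the winding number.\<close>
          have D: "chord \<gamma> u (real (N - 1) / real N) = - ?D u" for u
          proof -
            have eq: "real (N - 1) / real N = 1 - \<delta>"
              using elim(5) by (simp add: \<delta>_def of_nat_diff diff_divide_distrib)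
            have "\<gamma> (u + (1 - \<delta>)) = \<gamma> (u - \<delta>)"
              using period [of "u - \<delta>"] by (simp add: algebra_simps)
            then show ?thesis
              unfolding chord_def eq by simp
          qed
          have "has_wind (\<lambda>u. Complex (norm (?D u) - (- 1) * (?D u $ 2 - ?D u $ 3)) (?D u $ 1)) (int (card (?R (- 1))))"
            using has_wind_shift [OF has_wind_end [OF e(2) \<delta>, of "- 1"], of "- \<delta>"] by simp
          also have "(\<lambda>u. Complex (norm (?D u) - (- 1) * (?D u $ 2 - ?D u $ 3)) (?D u $ 1)) =
            (\<lambda>u. of_real (norm (- ?D u) - (- ?D u) $ 2) - \<i> * fpart (- ?D u))"
            by (simp add: fun_eq_iff complex_eq_iff fpart_def)
          finally show ?thesis
            unfolding D .
        qed
        show "has_wind (\<lambda>u. spin_prod (chord \<gamma> u (real (Suc i) / real N)) (chord \<gamma> u (real i / real N))) (n i)"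
          if "1 \<le> i" "i < N - 1" for i
          unfolding n_def
        proof (rule has_wind_strip [OF fin neg])
          have i: "1 \<le> i" "i < N" "1 \<le> Suc i" "Suc i < N"
            using that by auto
          show "0 < real i / real N" "real (Suc i) / real N < 1"
            using grid i by blast+
          show "real i / real N < real (Suc i) / real N"
            using i by (simp add: divide_strict_right_mono)
          show "crossing_gap p \<noteq> real i / real N \<and> crossing_gap p \<noteq> real (Suc i) / real N" if "p \<in> ?X" for p
            using gap [OF that] i by blast
          show "\<not> antiparallel (chord \<gamma> u (real i / real N)) (chord \<gamma> u \<tau>)"
            if "real i / real N \<le> \<tau>" "\<tau> \<le> real (Suc i) / real N" for u \<tau>
          proof (rule \<eta>(2))
            have "real (Suc i) / real N = real i / real N + 1 / real N"
              by (simp add: add_divide_distrib)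
            then show "\<bar>real i / real N - \<tau>\<bar> < \<eta>"
              using that elim(3) by linarith
            show "0 < \<tau>" "\<tau> < 1" "0 < real i / real N" "real i / real N < 1"
              using that grid [OF i(1,2)] grid [OF i(3,4)] by linarith+
          qed
        qed
        show "N - 1 > 0"
          using elim(5) by simp
      qed
      moreover have "(\<Sum>i = 1..<N - 1. n i) = int (card ?X)"
      proof -
        let ?S = "\<lambda>i. {p \<in> ?X. real i / real N < crossing_gap p \<and> crossing_gap p < real (Suc i) / real N}"
        have N: "real N > 0"
          using elim(5) by simp
        have S: "?S i = {p \<in> ?X. real i < crossing_gap p * real N \<and> crossing_gap p * real N < real (Suc i)}" for i
          using N by (simp add: field_simps)
        have "?X = (\<Union>i\<in>{1..<N - 1}. ?S i)"
        proof (intro subset_antisym subsetI)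
          fix p assume p: "p \<in> ?X"
          define x where "x = crossing_gap p * real N"
          define i where "i = nat \<lfloor>x\<rfloor>"
          have b: "1 / real N < crossing_gap p" "1 / real N < 1 - crossing_gap p"
            using elim(1) p by auto
          have x: "1 < x" "x < real N - 1"
            using b N by (simp_all add: x_def field_simps)
          have fl: "real i \<le> x" "x < real i + 1"
            using x by (auto simp: i_def)
          have i: "1 \<le> i" "i < N - 1"
            using x fl elim(5) by linarith+
          have "x \<noteq> real i"
            using gap [OF p, of i] i N by (auto simp: x_def field_simps)
          then have "p \<in> ?S i"
            unfolding S using fl p by (simp add: x_def)
          then show "p \<in> (\<Union>i\<in>{1..<N - 1}. ?S i)"
            using i by auto
        qed auto
        then have "card ?X = card (\<Union>i\<in>{1..<N - 1}. ?S i)"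
          by simp
        also have "\<dots> = (\<Sum>i = 1..<N - 1. card (?S i))"
          unfolding S
        proof (rule card_UN_disjoint)
          show "\<forall>i\<in>{1..<N - 1}. finite {p \<in> ?X. real i < crossing_gap p * real N \<and> crossing_gap p * real N < real (Suc i)}"
            using fin by simp
          show "\<forall>i\<in>{1..<N - 1}. \<forall>j\<in>{1..<N - 1}. i \<noteq> j \<longrightarrow>
              {p \<in> ?X. real i < crossing_gap p * real N \<and> crossing_gap p * real N < real (Suc i)} \<inter>
              {p \<in> ?X. real j < crossing_gap p * real N \<and> crossing_gap p * real N < real (Suc j)} = {}"
            by (auto simp: nat_neq_iff)
        qed simp
        finally show ?thesis
          by (simp add: n_def)
      qed
      \<comment> \<open>A right cusp is seen by the first step of the chain if \<open>y' > 0\<close>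
        and by the last step if \<open>y' < 0\<close>.\<close>
      moreover have "card {c \<in> {0..<1}. \<gamma>' c $ 1 = 0 \<and> \<gamma>'' c $ 1 < 0} = card (?R 1) + card (?R (- 1))"
      proof -
        have "{c \<in> {0..<1}. \<gamma>' c $ 1 = 0 \<and> \<gamma>'' c $ 1 < 0} = ?R 1 \<union> ?R (- 1)"
          using cusp_slope_change by (auto simp: less_le)
        moreover have "finite (?R \<kappa>)" for \<kappa>
          by (rule finite_subset [OF _ finite_cusps]) auto
        moreover have "?R 1 \<inter> ?R (- 1) = {}"
          by auto
        ultimately show ?thesis
          using card_Un_disjoint [of "?R 1" "?R (- 1)"] by presburger
      qed
      ultimately show "has_wind (knot_hol \<gamma> N)
          (int (card ?X) + int (card {c \<in> {0..<1}. \<gamma>' c $ 1 = 0 \<and> \<gamma>'' c $ 1 < 0}))"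
        by (simp add: add_ac)
    qed
  qed
qed

end

section \<open>Legendrian trefoils\<close>

lemma smooth_on_real_derivatives:
  fixes f :: "real \<Rightarrow> 'b::real_normed_vector"
  assumes "smooth_on UNIV f"
  obtains f' f'' where "\<And>t. (f has_vector_derivative f' t) (at t)"
    "\<And>t. (f' has_vector_derivative f'' t) (at t)" "continuous_on UNIV f''"
proof -
  have "Ck_on (Suc (Suc 0)) UNIV f"
    using assms unfolding smooth_on_def by blast
  then obtain D D' where "\<And>x. (f has_derivative (\<lambda>h. h *\<^sub>R D (1::real) x)) (at x)"
    "\<And>x. (D 1 has_derivative (\<lambda>h. h *\<^sub>R D' (1::real) x)) (at x)" "continuous_on UNIV (D' 1)"
    by auto
  then show thesis
    using that [of "D 1" "D' 1"] by (simp add: has_vector_derivative_def)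
qed

lemma trefoil_generic_loop:
  assumes "legendrian_trefoil m n \<gamma>"
  obtains \<gamma>' \<gamma>'' where "generic_loop \<gamma> \<gamma>' \<gamma>''"
proof -
  have knot: "legendrian_knot \<gamma>" and gen: "generic_front \<gamma>"
    using assms by (auto simp: legendrian_trefoil_def)
  obtain \<gamma>' \<gamma>'' where d: "\<And>t. (\<gamma> has_vector_derivative \<gamma>' t) (at t)"
    "\<And>t. (\<gamma>' has_vector_derivative \<gamma>'' t) (at t)" "continuous_on UNIV \<gamma>''"
    using knot smooth_on_real_derivatives unfolding legendrian_knot_def by metis
  have vd: "vector_derivative \<gamma> (at t) = \<gamma>' t" for t
    by (rule vector_derivative_at [OF d(1)])
  have nth: "deriv (\<lambda>u. \<gamma> u $ 1) t = \<gamma>' t $ 1" "deriv (\<lambda>u. \<gamma>' u $ 1) t = \<gamma>'' t $ 1" for t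
    using bounded_linear.has_vector_derivative [OF bounded_linear_vec_nth d(1), of 1 t]
      bounded_linear.has_vector_derivative [OF bounded_linear_vec_nth d(2), of 1 t]
    by (auto simp: has_real_derivative_iff_has_vector_derivative [symmetric] intro: DERIV_imp_deriv)
  have leg: "\<gamma>' t $ 3 = \<gamma> t $ 2 * \<gamma>' t $ 1" for t
    using knot unfolding legendrian_knot_def vd contact_plane_def by auto
  have cusp: "cusp \<gamma> t \<longleftrightarrow> \<gamma>' t $ 1 = 0" for t
    using vector_derivative_front [OF d(1)] leg [of t] by (auto simp: cusp_def zero_prod_def)
  have "generic_loop \<gamma> \<gamma>' \<gamma>''"
  proof
    show "\<gamma>'' t $ 1 \<noteq> 0" if "\<gamma>' t $ 1 = 0" for t
      using gen that unfolding generic_front_def cusp nth(1) [abs_def] nth(2) by blast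
    show "finite {t \<in> {0..<1}. \<gamma>' t $ 1 = 0}"
      using gen unfolding generic_front_def cusp by blast
  qed (use d leg knot in \<open>auto simp: legendrian_knot_def vd\<close>)
  then show thesis
    by (rule that)
qed

lemma trefoil_rotation:
  assumes "legendrian_trefoil m n \<gamma>" and "generic_loop \<gamma> \<gamma>' \<gamma>''"
  shows "has_wind (\<lambda>u. (xy_velocity \<gamma>' u)\<^sup>2) (int (2 * n + 2) - int (2 * m))"
proof -
  interpret generic_loop \<gamma> \<gamma>' \<gamma>'' by fact
  have "continuous_on UNIV (\<lambda>u. (xy_velocity \<gamma>' u)\<^sup>2)"
    unfolding xy_velocity_def Complex_eq by (intro continuous_intros continuous1)
  then obtain r where r: "has_wind (\<lambda>u. (xy_velocity \<gamma>' u)\<^sup>2) r"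
    by (rule has_wind_ex) (use xy_velocity_nonzero [of 0] in \<open>auto simp: xy_velocity_def period'\<close>)
  then show ?thesis
    using wind_xy_velocity [OF r] assms(1) by (simp add: legendrian_trefoil_def)
qed

text \<open>Three crossings plus the right cusps, which make up half of the
  \<open>2m + 2n + 2\<close> cusps.\<close>

lemma trefoil_knot_hol:
  assumes "legendrian_trefoil m n \<gamma>" and "generic_loop \<gamma> \<gamma>' \<gamma>''"
  shows "\<forall>\<^sub>F N in sequentially. prime N \<longrightarrow> has_wind (knot_hol \<gamma> N) (int (m + n + 4))"
proof -
  interpret generic_loop \<gamma> \<gamma>' \<gamma>'' by fact
  have X: "card (front_crossings \<gamma>) = 3" "\<And>p. p \<in> front_crossings \<gamma> \<Longrightarrow> negative_crossing \<gamma> (fst p) (snd p)"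
    and U: "card {t \<in> {0..<1}. up_cusp \<gamma> t} = 2 * m" and D: "card {t \<in> {0..<1}. down_cusp \<gamma> t} = 2 * n + 2"
    using assms(1) by (auto simp: legendrian_trefoil_def)
  have fin: "finite (front_crossings \<gamma>)"
    using X(1) by (metis card.infinite zero_neq_numeral)
  let ?C = "{t \<in> {0..<1}. \<gamma>' t $ 1 = 0}"
  let ?R = "{t \<in> {0..<1}. \<gamma>' t $ 1 = 0 \<and> \<gamma>'' t $ 1 < 0}"
  let ?L = "{t \<in> {0..<1}. \<gamma>' t $ 1 = 0 \<and> \<gamma>'' t $ 1 > 0}"
  have k: "\<gamma>'' t $ 1 * \<gamma>' t $ 2 \<noteq> 0" if "\<gamma>' t $ 1 = 0" for t
    using cusp_nondeg [OF that] cusp_slope_change [OF that] by simp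
  then have k': "\<gamma>'' t $ 1 * \<gamma>' t $ 2 > 0 \<or> \<gamma>'' t $ 1 * \<gamma>' t $ 2 < 0" if "\<gamma>' t $ 1 = 0" for t
    using that by (simp only: linorder_neq_iff disj_commute)
  let ?U = "{t \<in> {0..<1}. up_cusp \<gamma> t}" and ?D = "{t \<in> {0..<1}. down_cusp \<gamma> t}"
  have "card (?U \<union> ?D) = card ?U + card ?D"
  proof (rule card_Un_disjoint)
    show "finite ?U" "finite ?D"
      by (rule finite_subset [OF _ finite_cusps], auto simp: up_down_cusp_iff)+
    show "?U \<inter> ?D = {}"
      unfolding up_down_cusp_iff by auto
  qed
  moreover have "?U \<union> ?D = ?C"
    unfolding up_down_cusp_iff using k' by blast
  moreover have "card (?L \<union> ?R) = card ?L + card ?R"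
    by (rule card_Un_disjoint) (auto intro: finite_subset [OF _ finite_cusps])
  moreover have "?L \<union> ?R = ?C"
    using cusp_nondeg by (auto simp: linorder_neq_iff)
  ultimately have "card ?R = m + n + 1"
    using card_left_right_cusps U D by simp
  then show ?thesis
    using wind_knot_hol [OF fin X(2)] X(1) by (simp add: algebra_simps)
qed

text \<open>Two families with a common end stand in for one family from \<open>\<gamma>\<close> to
  \<open>\<delta>\<close>: the isotopy, and a change of parametrisation of \<open>\<delta>\<close>.
  Large primes \<open>N\<close> satisfy the thresholds of both.\<close>

lemma trefoil_invariants:
  assumes "legendrian_trefoil m n \<gamma>" and "generic_loop \<gamma> \<gamma>' \<gamma>''"
    and "legendrian_trefoil k l \<delta>" and "generic_loop \<delta> \<delta>' \<delta>''"
    and G: "loop_family G G'" "G 0 = \<gamma>" "G' 0 = \<gamma>'"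
    and H: "loop_family H H'" "H 0 = \<delta>" "H' 0 = \<delta>'"
    and end_eq: "G 1 = H 1" "G' 1 = H' 1"
  shows "(m, n) = (k, l)"
proof -
  have "has_wind (\<lambda>u. (xy_velocity (G' 1) u)\<^sup>2) (int (2 * n + 2) - int (2 * m))"
    using loop_family.has_wind_xy_velocity [OF G(1)] trefoil_rotation [OF assms(1,2)] G(3) by simp
  moreover have "has_wind (\<lambda>u. (xy_velocity (G' 1) u)\<^sup>2) (int (2 * l + 2) - int (2 * k))"
    using loop_family.has_wind_xy_velocity [OF H(1)] trefoil_rotation [OF assms(3,4)] H(3) end_eq by simp
  ultimately have rot: "int (2 * n + 2) - int (2 * m) = int (2 * l + 2) - int (2 * k)"
    by (rule has_wind_unique)
  obtain \<eta> where \<eta>: "\<eta> > 0"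
    "\<And>N r. 1 / real N < \<eta> \<Longrightarrow> 2 \<le> N \<Longrightarrow> has_wind (knot_hol \<gamma> N) r \<Longrightarrow> has_wind (knot_hol (G 1) N) r"
    using loop_family.has_wind_knot_hol [OF G(1)] G(2) by auto
  obtain \<theta> where \<theta>: "\<theta> > 0"
    "\<And>N r. 1 / real N < \<theta> \<Longrightarrow> 2 \<le> N \<Longrightarrow> has_wind (knot_hol \<delta> N) r \<Longrightarrow> has_wind (knot_hol (H 1) N) r"
    using loop_family.has_wind_knot_hol [OF H(1)] H(2) by auto
  have "\<forall>\<^sub>F N in sequentially. prime N \<longrightarrow> int (m + n + 4) = int (k + l + 4)"
    using trefoil_knot_hol [OF assms(1,2)] trefoil_knot_hol [OF assms(3,4)]
      eventually_inverse_less [OF \<eta>(1)] eventually_inverse_less [OF \<theta>(1)] eventually_ge_at_top [of 2]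
  proof eventually_elim
    case (elim N)
    then show ?case
      using \<eta>(2) [of N] \<theta>(2) [of N] end_eq(1) has_wind_unique by metis
  qed
  then obtain N0 :: nat where "\<forall>N\<ge>N0. prime N \<longrightarrow> int (m + n + 4) = int (k + l + 4)"
    unfolding eventually_sequentially by blast
  moreover obtain N :: nat where "prime N" "N > N0"
    using bigger_prime by blast
  ultimately have "int (m + n + 4) = int (k + l + 4)"
    by (meson less_imp_le)
  with rot show ?thesis
    by simp
qed

section \<open>Isotopies and changes of parametrisation as families of loops\<close>

lemma loop_family_isotopy:
  assumes smooth: "smooth_on ({0..1} \<times> UNIV) \<Gamma>"
    and knot: "\<And>s. s \<in> {0..1} \<Longrightarrow> legendrian_knot (\<lambda>t. \<Gamma> (s, t))"
  obtains G' where "loop_family (\<lambda>s t. \<Gamma> (s, t)) G'"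
proof -
  let ?S = "{0..1} \<times> (UNIV :: real set)"
  have "Ck_on (Suc 0) ?S \<Gamma>"
    using smooth unfolding smooth_on_def by blast
  then obtain D where D: "\<And>x. x \<in> ?S \<Longrightarrow> (\<Gamma> has_derivative (\<lambda>h. \<Sum>b\<in>Basis. (h \<bullet> b) *\<^sub>R D b x)) (at x within ?S)"
    "\<And>b. b \<in> Basis \<Longrightarrow> continuous_on ?S (D b)"
    by auto
  have deriv: "((\<lambda>t. \<Gamma> (s, t)) has_vector_derivative D (0, 1) (s, t)) (at t)" if "s \<in> {0..1}" for s t
  proof -
    \<comment> \<open>Restricting to the line over \<open>s\<close> leaves a two-sided derivative in
      \<open>t\<close>, also at the ends of the strip, where the derivative in \<open>s\<close> is
      one-sided.\<close>
    have "(\<Gamma> has_derivative (\<lambda>h. \<Sum>b\<in>Basis. (h \<bullet> b) *\<^sub>R D b (s, t))) (at (s, t) within range (Pair s))"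
      by (rule has_derivative_subset [OF D(1)]) (use that in auto)
    moreover have "(Pair s has_derivative (\<lambda>h. (0, h))) (at t)"
      by (intro has_derivative_Pair has_derivative_const has_derivative_ident)
    ultimately have "((\<lambda>t. \<Gamma> (s, t)) has_derivative (\<lambda>h. \<Sum>b\<in>Basis. ((0, h) \<bullet> b) *\<^sub>R D b (s, t))) (at t)"
      using has_derivative_in_compose [of "Pair s" _ t UNIV \<Gamma>] by blast
    moreover have "(\<Sum>b\<in>Basis. ((0, h) \<bullet> b) *\<^sub>R D b (s, t)) = h *\<^sub>R D (0, 1) (s, t)" for h :: real
      by (simp add: Basis_prod_def sum.union_disjoint)
    ultimately show ?thesis
      by (simp add: has_vector_derivative_def)
  qed
  have vd: "vector_derivative (\<lambda>t. \<Gamma> (s, t)) (at t) = D (0, 1) (s, t)" if "s \<in> {0..1}" for s t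
    by (rule vector_derivative_at [OF deriv [OF that]])
  have "loop_family (\<lambda>s t. \<Gamma> (s, t)) (\<lambda>s t. D (0, 1) (s, t))"
  proof
    have "continuous_on ?S \<Gamma>"
      by (rule has_derivative_continuous_on) (rule D(1))
    then show "continuous_on ({0..1} \<times> UNIV) (\<lambda>p. \<Gamma> (fst p, snd p))"
      by simp
    show "continuous_on ({0..1} \<times> UNIV) (\<lambda>p. D (0, 1) (fst p, snd p))"
      using D(2) [of "(0, 1)"] by (simp add: Basis_prod_def)
    fix s t :: real assume s: "s \<in> {0..1}"
    show "((\<lambda>t. \<Gamma> (s, t)) has_vector_derivative D (0, 1) (s, t)) (at t)"
      by (rule deriv [OF s])
    show "D (0, 1) (s, t) \<noteq> 0"
      using knot [OF s] unfolding legendrian_knot_def vd [OF s] by blast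
    show "D (0, 1) (s, t) $ 3 = \<Gamma> (s, t) $ 2 * D (0, 1) (s, t) $ 1"
      using knot [OF s] unfolding legendrian_knot_def vd [OF s] contact_plane_def by auto
    show "\<Gamma> (s, t) = \<Gamma> (s, r) \<longleftrightarrow> t - r \<in> \<int>" for r
      using knot [OF s] unfolding legendrian_knot_def by blast
  qed
  then show thesis
    by (rule that)
qed

text \<open>The straight-line homotopy \<open>\<psi>\<close> joins the identity to
  \<open>\<phi>\<close>. Convex combinations keep the derivative positive and commute with integer
  translations, so every \<open>\<psi> s\<close> is the lift of an orientation-preserving change of
  parameter on the circle.\<close>

lemma loop_family_reparametrisation:
  assumes "generic_loop \<delta> \<delta>' \<delta>''" and \<phi>: "oriented_reparametrisation \<phi>"
  obtains H H' where "loop_family H H'" "H 0 = \<delta>" "H' 0 = \<delta>'" "H 1 = \<delta> \<circ> \<phi>"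
proof -
  interpret generic_loop \<delta> \<delta>' \<delta>'' by fact
  obtain \<phi>' \<phi>'' where d: "\<And>t. (\<phi> has_vector_derivative \<phi>' t) (at t)" "\<And>t. (\<phi>' has_vector_derivative \<phi>'' t) (at t)"
    using \<phi> smooth_on_real_derivatives unfolding oriented_reparametrisation_def by metis
  have d\<phi>: "(\<phi> has_real_derivative \<phi>' t) (at t)" for t
    using d(1) by (simp add: has_real_derivative_iff_has_vector_derivative)
  have pos: "\<phi>' t > 0" and per: "\<phi> (t + 1) = \<phi> t + 1" for t
    using \<phi> DERIV_imp_deriv [OF d\<phi>, of t] unfolding oriented_reparametrisation_def by metis+
  have cont\<phi>: "continuous_on UNIV \<phi>" "continuous_on UNIV \<phi>'"
    using d by (meson continuous_at_imp_continuous_on has_vector_derivative_continuous)+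
  define \<psi> where "\<psi> s t = (1 - s) * t + s * \<phi> t" for s t
  define \<psi>' where "\<psi>' s t = (1 - s) + s * \<phi>' t" for s t
  have d\<psi>: "(\<psi> s has_real_derivative \<psi>' s t) (at t)" for s t
    unfolding \<psi>_def [abs_def] \<psi>'_def by (auto intro!: derivative_eq_intros d\<phi>)
  have pos\<psi>: "\<psi>' s t > 0" if "s \<in> {0..1}" for s t
  proof (cases "s = 0")
    case False
    then show ?thesis
      using that pos [of t] by (simp add: \<psi>'_def add_nonneg_pos)
  qed (simp add: \<psi>'_def)
  have inj: "\<psi> s t = \<psi> s r \<longleftrightarrow> t = r" if "s \<in> {0..1}" for s t r
  proof -
    have "strict_mono (\<psi> s)"
    proof (rule strict_monoI)
      fix a b :: real assume "a < b"
      then show "\<psi> s a < \<psi> s b"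
        by (rule DERIV_pos_imp_increasing) (use d\<psi> pos\<psi> [OF that] in blast)
    qed
    then show ?thesis
      by (simp add: strict_mono_eq)
  qed
  have shift: "\<psi> s (r + of_int k) = \<psi> s r + of_int k" for s r k
  proof -
    have "\<phi> (r + 1) - (r + 1) = \<phi> r - r" for r
      by (simp add: per)
    from periodic_of_int [of "\<lambda>r. \<phi> r - r", OF this, of r k]
    have "\<phi> (r + of_int k) = \<phi> r + of_int k"
      by simp
    then show ?thesis
      by (simp add: \<psi>_def algebra_simps)
  qed
  have Ints: "\<psi> s t - \<psi> s r \<in> \<int> \<longleftrightarrow> t - r \<in> \<int>" if s: "s \<in> {0..1}" for s t r
  proof
    assume "\<psi> s t - \<psi> s r \<in> \<int>"
    then obtain k where "\<psi> s t - \<psi> s r = of_int k"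
      by (elim Ints_cases)
    then have "\<psi> s t = \<psi> s (r + of_int k)"
      by (simp add: shift)
    then have "t = r + of_int k"
      using inj [OF s] by blast
    then show "t - r \<in> \<int>"
      by simp
  next
    assume "t - r \<in> \<int>"
    then obtain k where "t - r = of_int k"
      by (elim Ints_cases)
    then have "t = r + of_int k"
      by simp
    then show "\<psi> s t - \<psi> s r \<in> \<int>"
      by (simp add: shift)
  qed
  let ?H = "\<lambda>s t. \<delta> (\<psi> s t)" and ?H' = "\<lambda>s t. \<psi>' s t *\<^sub>R \<delta>' (\<psi> s t)"
  have "loop_family ?H ?H'"
  proof
    have c: "continuous_on ({0..1} \<times> UNIV) (\<lambda>p. \<psi> (fst p) (snd p))" "continuous_on ({0..1} \<times> UNIV) (\<lambda>p. \<psi>' (fst p) (snd p))"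
      unfolding \<psi>_def \<psi>'_def
      by (intro continuous_intros continuous_on_compose2 [OF cont\<phi>(1)] continuous_on_compose2 [OF cont\<phi>(2)]; simp)+
    show "continuous_on ({0..1} \<times> UNIV) (\<lambda>p. \<delta> (\<psi> (fst p) (snd p)))"
      by (rule continuous_on_compose2 [OF continuous0 [of UNIV] c(1)]) simp
    show "continuous_on ({0..1} \<times> UNIV) (\<lambda>p. \<psi>' (fst p) (snd p) *\<^sub>R \<delta>' (\<psi> (fst p) (snd p)))"
      by (intro continuous_intros c continuous_on_compose2 [OF continuous1 [of UNIV] c(1)]) simp
    fix s t :: real assume s: "s \<in> {0..1}"
    show "((\<lambda>t. \<delta> (\<psi> s t)) has_vector_derivative \<psi>' s t *\<^sub>R \<delta>' (\<psi> s t)) (at t)"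
      using vector_diff_chain_at [of "\<psi> s" "\<psi>' s t" t \<delta>] d\<psi> has_derivative1
      by (simp add: has_real_derivative_iff_has_vector_derivative o_def)
    show "\<delta> (\<psi> s t) = \<delta> (\<psi> s r) \<longleftrightarrow> t - r \<in> \<int>" for r
      by (simp add: closed Ints [OF s])
    show "\<psi>' s t *\<^sub>R \<delta>' (\<psi> s t) \<noteq> 0"
      using pos\<psi> [OF s, of t] immersed by simp
    show "(\<psi>' s t *\<^sub>R \<delta>' (\<psi> s t)) $ 3 = \<delta> (\<psi> s t) $ 2 * (\<psi>' s t *\<^sub>R \<delta>' (\<psi> s t)) $ 1"
      by (simp add: legendrian)
  qed
  then show thesis
    by (rule that) (auto simp: \<psi>_def \<psi>'_def)
qed

theorem theorem4p7:
  fixes m n k l :: nat and \<gamma> \<delta> :: "real \<Rightarrow> real ^ 3"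
  assumes "m > 0" and "n > 0" and "k > 0" and "l > 0"
    and "(m, n) \<noteq> (k, l)"
    and "legendrian_trefoil m n \<gamma>" and "legendrian_trefoil k l \<delta>"
  shows "\<not> legendrian_isotopic \<gamma> \<delta>"
proof
  assume "legendrian_isotopic \<gamma> \<delta>"
  then obtain \<Gamma> :: "real \<times> real \<Rightarrow> real ^ 3" and \<phi> :: "real \<Rightarrow> real" where \<Gamma>: "smooth_on ({0..1} \<times> UNIV) \<Gamma>"
      "\<forall>s\<in>{0..1}. legendrian_knot (\<lambda>t. \<Gamma> (s, t))"
    and \<phi>: "oriented_reparametrisation \<phi>"
    and ends: "\<forall>t. \<Gamma> (0, t) = \<gamma> t" "\<forall>t. \<Gamma> (1, t) = \<delta> (\<phi> t)"
    unfolding legendrian_isotopic_def by blast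
  obtain \<gamma>' \<gamma>'' where \<gamma>: "generic_loop \<gamma> \<gamma>' \<gamma>''"
    using trefoil_generic_loop [OF assms(6)] .
  obtain \<delta>' \<delta>'' where \<delta>: "generic_loop \<delta> \<delta>' \<delta>''"
    using trefoil_generic_loop [OF assms(7)] .
  obtain G' where G: "loop_family (\<lambda>s t. \<Gamma> (s, t)) G'"
    using loop_family_isotopy [OF \<Gamma>(1) \<Gamma>(2) [rule_format]] .
  obtain H H' where H: "loop_family H H'" "H 0 = \<delta>" "H' 0 = \<delta>'" "H 1 = \<delta> \<circ> \<phi>"
    using loop_family_reparametrisation [OF \<delta> \<phi>] .
  have G0: "(\<lambda>t. \<Gamma> (0, t)) = \<gamma>" and G1: "(\<lambda>t. \<Gamma> (1, t)) = H 1"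
    using ends H(4) by auto
  have "G' 0 = \<gamma>'"
  proof
    fix t
    have "(\<gamma> has_vector_derivative G' 0 t) (at t)"
      using loop_family.deriv [OF G, of 0 t] unfolding G0 by simp
    then show "G' 0 t = \<gamma>' t"
      using generic_loop.has_derivative1 [OF \<gamma>] by (rule vector_derivative_unique_at)
  qed
  moreover have "G' 1 = H' 1"
  proof
    fix t
    have "(H 1 has_vector_derivative G' 1 t) (at t)" "(H 1 has_vector_derivative H' 1 t) (at t)"
      using loop_family.deriv [OF G, of 1 t] loop_family.deriv [OF H(1), of 1 t] unfolding G1 by simp_all
    then show "G' 1 t = H' 1 t"
      by (rule vector_derivative_unique_at)
  qed
  ultimately have "(m, n) = (k, l)"
    using trefoil_invariants [OF assms(6) \<gamma> assms(7) \<delta> G _ _ H(1-3)] G0 G1 by blast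
  with assms(5) show False
    by contradiction
qed

end
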